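(* Let $(M,\Omega,D)$ be a non-generic Lagrangian Engel structure (i.e. $p_3\equiv0$). Let $\varepsilon\in\{1,-1\}$ be the sign, let $P$ be the bundle of normalized coframings, and let $A_3$ (and, when $A_3\equiv\varepsilon$, also $A_4$) be the invariants described in the context. 1. On a domain where either $A_3\equiv0$, or $A_3\neq\varepsilon$ and $A_3\neq0$ everywhere, one gets an $e$-structure, i.e. there is exactly one section $\omega=(\omega_1,\omega_2,\omega_3,\omega_4)$ of $P$ satisfying the defining conditions $$d\omega_1=\varepsilon\,\omega_4\wedge\omega_2+A_3\,\omega_3\wedge\omega_1,$$ $$d\omega_2=(a\,\omega_1+b\,\omega_4)\wedge\omega_2+c\,\omega_3\wedge\omega_1+\omega_3\wedge\omega_4$$ for some functions $a,b,c$. 2. On a domain where $A_3\equiv\varepsilon$: (a) on the domain where $A_4\equiv0$, there are sections $\omega$ of $P$ satisfying the structure equations $$d\omega_1=\varepsilon\,\omega_4\wedge\omega_2+\varepsilon\,\omega_3\wedge\omega_1+A_2\,\omega_2\wedge\omega_1,\qquad d\omega_2\equiv\omega_3\wedge\omega_4 \bmod \omega_1,$$ for some function $A_2$; (b) on the domain where $A_4\neq0$, there are sections $\omega$ of $P$ satisfying the structure equations $$d\omega_1=\varepsilon\,\omega_4\wedge\omega_2+\varepsilon\,\omega_3\wedge\omega_1+A_4\,\omega_4\wedge\omega_1,\qquad d\omega_2\equiv q_3\,\omega_3\wedge\omega_2+\omega_3\wedge\omega_4 \bmod \omega_1,$$ for some function $q_3$.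
   Context: Everything is smooth. An Engel structure on a $4$-manifold $M$ is a rank $2$ subbundle $D\subset TM$ such that, writing $I=D^\perp\subset T^*M$ for its annihilator, the first derived system $I^{(1)}$ has rank $1$ and the second derived system $I^{(2)}$ is $0$. Here, for a subbundle $J\subset T^*M$, the derived system $J^{(1)}$ is the kernel of the bundle map $\delta:J\to\Lambda^2(T^*M/J)$ induced by $\omega\mapsto d\omega \bmod J$, and $I^{(2)}=(I^{(1)})^{(1)}$. A Lagrangian Engel structure $(M,\Omega,D)$ is a $4$-manifold with a symplectic form $\Omega$ and an Engel structure $D$ whose $2$-planes are $\Omega$-Lagrangian. A coframing $\omega=(\omega_1,\dots,\omega_4)$ is $0$-adapted if $\Omega=\omega_1\wedge\omega_3+\omega_2\wedge\omega_4$, $I=\langle\omega_1,\omega_2\rangle$, $I^{(1)}=\langle\omega_1\rangle$; it is $1$-adapted if moreover $d\omega_2\equiv\omega_3\wedge\omega_4\bmod\omega_1,\omega_2$. For a $1$-adapted coframing, $d\omega_1\equiv(p_3\omega_3+p_4\omega_4)\wedge\omega_2\bmod\omega_1$ with $p_3,p_4$ not simultaneously zero; the vanishing of $p_3$ does not depend on the $1$-adapted coframing. The structure is non-generic if $p_3\equiv0$; then $p_4$ is nowhere zero. Normalized coframings. In the non-generic case the $1$-adapted coframings can be normalized so that $p_4=\varepsilon\in\{\pm1\}$ ($\varepsilon$ is the sign of $p_4$; assume it is constant, e.g. on a connected domain). Such coframings are determined up to changes $\tilde\omega=B\omega$ with $$B=\begin{pmatrix} B_{11} & 0 \\ (B_{11}^T)^{-1}S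 & (B_{11}^T)^{-1} \end{pmatrix},\quad B_{11}=\begin{pmatrix} 1 & 0 \\ b_{21} & b_{22} \end{pmatrix},\ b_{22}=\pm1,\quad S=S^T\in\mathbb{R}^{2\times2}.$$ By convention the sign ambiguity, generated by $(\omega_2,\omega_4)\mapsto(-\omega_2,-\omega_4)$, is fixed once and for all: one chooses a reduction to the subgroup with $b_{22}=1$, and $P$ denotes the resulting bundle of coframings. For sections of $P$ one writes $$d\omega_1=\varepsilon\,\omega_4\wedge\omega_2+(A_2\omega_2+A_3\omega_3+A_4\omega_4)\wedge\omega_1 .$$ The function $A_3$ does not depend on the choice of section of $P$; equivalently $d\omega_1\wedge\omega_2\wedge\omega_4=-\tfrac{A_3}{2}\,\Omega\wedge\Omega$. When $A_3\equiv\varepsilon$, the function $A_4$ is also independent of the choice of section of $P$. An $e$-structure is a $G$-structure with trivial group $G$, i.e. a canonical coframing. *)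

theory Defs
  imports "HOL-Analysis.Analysis"
begin

section \<open>Smooth maps between open sets of normed spaces\<close>

text \<open>\<open>Ck_on k S f\<close> is meant for open \<open>S\<close>. A function is of class \<open>C\<^sup>k\<^sup>+\<^sup>1\<close> iff it is
  differentiable and all its directional derivatives are of class \<open>C\<^sup>k\<close>
  (the domain is finite-dimensional in all uses).\<close>

primrec Ck_on :: "nat \<Rightarrow> 'a::real_normed_vector set \<Rightarrow> ('a \<Rightarrow> 'b::real_normed_vector) \<Rightarrow> bool" where
  "Ck_on 0 S f \<longleftrightarrow> continuous_on S f"
| "Ck_on (Suc k) S f \<longleftrightarrow>
     f differentiable_on S \<and> (\<forall>v. Ck_on k S (\<lambda>x. frechet_derivative f (at x) v))"

definition smooth_on :: "'a::real_normed_vector set \<Rightarrow> ('a \<Rightarrow> 'b::real_normed_vector) \<Rightarrow> bool" where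
  "smooth_on S f \<longleftrightarrow> (\<forall>k. Ck_on k S f)"


section \<open>Smooth 4-manifolds\<close>

text \<open>The manifold is the whole type \<open>'a\<close>; Hausdorff and second countable are imposed through
  the type classes \<open>t2_space\<close> and \<open>second_countable_topology\<close> in the final statement.
  A chart is a pair (domain, coordinate map); coordinate maps are relevant on their domains only.\<close>

type_synonym 'a chart = "'a set \<times> ('a \<Rightarrow> real^4)"

definition is_chart :: "'a::topological_space chart \<Rightarrow> bool" where
  "is_chart c \<longleftrightarrow> open (fst c) \<and> open (snd c ` fst c) \<and>
     homeomorphism (fst c) (snd c ` fst c) (snd c) (inv_into (fst c) (snd c))"

definition chart_inv :: "'a chart \<Rightarrow> real^4 \<Rightarrow> 'a" where
  "chart_inv c = inv_into (fst c) (snd c)"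

definition smooth_atlas :: "'a::topological_space chart set \<Rightarrow> bool" where
  "smooth_atlas A \<longleftrightarrow> (\<forall>c\<in>A. is_chart c) \<and> (\<Union>c\<in>A. fst c) = UNIV \<and>
     (\<forall>c\<in>A. \<forall>c'\<in>A. smooth_on (snd c ` (fst c \<inter> fst c')) (snd c' \<circ> chart_inv c))"

text \<open>Every point \<open>p\<close> has a preferred chart. The tangent space at \<open>p\<close> is identified with \<open>\<real>\<^sup>4\<close>
  by the components of tangent vectors in the preferred chart at \<open>p\<close>, and the cotangent space by
  the components with respect to the coordinate differentials \<open>dx\<^sub>1, \<dots>, dx\<^sub>4\<close> of that chart. So
  \<open>\<alpha> \<bullet> v\<close> is the evaluation of the covector \<open>\<alpha>\<close> on the vector \<open>v\<close>, and an alternating bilinear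
  form is a skew-symmetric matrix. Vector fields and forms are functions of the point; since the
  preferred chart may jump from point to point, regularity and derivatives are always taken after
  transforming the components to one fixed chart.\<close>

definition chart_at :: "'a chart set \<Rightarrow> 'a \<Rightarrow> 'a chart" where
  "chart_at A p = (SOME c. c \<in> A \<and> p \<in> fst c)"

definition chart_jac :: "'a chart \<Rightarrow> 'a chart \<Rightarrow> 'a \<Rightarrow> real^4^4" where
  "chart_jac c c' p = jacobian (snd c' \<circ> chart_inv c) (at (snd c p))"

definition smooth_fun :: "'a chart set \<Rightarrow> 'a set \<Rightarrow> ('a \<Rightarrow> real) \<Rightarrow> bool" where
  "smooth_fun A U f \<longleftrightarrow> (\<forall>c\<in>A. smooth_on (snd c ` (U \<inter> fst c)) (f \<circ> chart_inv c))"

definition vec_rep :: "'a chart set \<Rightarrow> ('a \<Rightarrow> real^4) \<Rightarrow> 'a chart \<Rightarrow> real^4 \<Rightarrow> real^4" where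
  "vec_rep A X c x = (let q = chart_inv c x in chart_jac (chart_at A q) c q *v X q)"

definition smooth_vector_field :: "'a chart set \<Rightarrow> 'a set \<Rightarrow> ('a \<Rightarrow> real^4) \<Rightarrow> bool" where
  "smooth_vector_field A U X \<longleftrightarrow> (\<forall>c\<in>A. smooth_on (snd c ` (U \<inter> fst c)) (vec_rep A X c))"

definition form_rep :: "'a chart set \<Rightarrow> ('a \<Rightarrow> real^4) \<Rightarrow> 'a chart \<Rightarrow> real^4 \<Rightarrow> real^4" where
  "form_rep A \<alpha> c x = (let q = chart_inv c x in \<alpha> q v* chart_jac c (chart_at A q) q)"

definition smooth_form :: "'a chart set \<Rightarrow> 'a set \<Rightarrow> ('a \<Rightarrow> real^4) \<Rightarrow> bool" where
  "smooth_form A U \<alpha> \<longleftrightarrow> (\<forall>c\<in>A. smooth_on (snd c ` (U \<inter> fst c)) (form_rep A \<alpha> c))"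

definition form2_rep :: "'a chart set \<Rightarrow> ('a \<Rightarrow> real^4^4) \<Rightarrow> 'a chart \<Rightarrow> real^4 \<Rightarrow> real^4^4" where
  "form2_rep A F c x = (let q = chart_inv c x; J = chart_jac c (chart_at A q) q
                        in transpose J ** F q ** J)"

definition smooth_form2 :: "'a chart set \<Rightarrow> 'a set \<Rightarrow> ('a \<Rightarrow> real^4^4) \<Rightarrow> bool" where
  "smooth_form2 A U F \<longleftrightarrow>
     (\<forall>q\<in>U. transpose (F q) = - F q) \<and>
     (\<forall>c\<in>A. smooth_on (snd c ` (U \<inter> fst c)) (form2_rep A F c))"

definition eval2 :: "real^4^4 \<Rightarrow> real^4 \<Rightarrow> real^4 \<Rightarrow> real" where
  "eval2 F u v = u \<bullet> (F *v v)"

definition wedge :: "real^4 \<Rightarrow> real^4 \<Rightarrow> real^4^4" (infixl "\<and>\<^sub>f" 73) where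
  "\<alpha> \<and>\<^sub>f \<beta> = (\<chi> i j. \<alpha> $ i * \<beta> $ j - \<alpha> $ j * \<beta> $ i)"

definition partial :: "4 \<Rightarrow> (real^4 \<Rightarrow> 'b::real_normed_vector) \<Rightarrow> real^4 \<Rightarrow> 'b" where
  "partial i f x = frechet_derivative f (at x) (axis i 1)"

definition ext_d :: "'a chart set \<Rightarrow> ('a \<Rightarrow> real^4) \<Rightarrow> 'a \<Rightarrow> real^4^4" where
  "ext_d A \<alpha> p = (let c = chart_at A p; r = form_rep A \<alpha> c; x = snd c p
                  in \<chi> i j. partial i r x $ j - partial j r x $ i)"

definition closed_form2 :: "'a chart set \<Rightarrow> ('a \<Rightarrow> real^4^4) \<Rightarrow> bool" where
  "closed_form2 A F \<longleftrightarrow> (\<forall>p. let c = chart_at A p; r = form2_rep A F c; x = snd c p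
     in \<forall>i j k. partial i r x $ j $ k + partial j r x $ k $ i + partial k r x $ i $ j = 0)"

definition symplectic_form :: "'a chart set \<Rightarrow> ('a \<Rightarrow> real^4^4) \<Rightarrow> bool" where
  "symplectic_form A \<Omega> \<longleftrightarrow> smooth_form2 A UNIV \<Omega> \<and> closed_form2 A \<Omega> \<and>
     (\<forall>p u. (\<forall>v. eval2 (\<Omega> p) u v = 0) \<longrightarrow> u = 0)"


section \<open>Lagrangian Engel structures\<close>

definition tangent_subbundle ::
  "'a::topological_space chart set \<Rightarrow> nat \<Rightarrow> ('a \<Rightarrow> (real^4) set) \<Rightarrow> bool" where
  "tangent_subbundle A k D \<longleftrightarrow>
     (\<forall>p. subspace (D p) \<and> dim (D p) = k) \<and>
     (\<forall>p. \<exists>V X. open V \<and> p \<in> V \<and> (\<forall>i<k. smooth_vector_field A V (X i)) \<and>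
        (\<forall>q\<in>V. D q = span ((\<lambda>i. X i q) ` {..<k})))"

definition annihilator :: "('a \<Rightarrow> (real^4) set) \<Rightarrow> 'a \<Rightarrow> (real^4) set" where
  "annihilator D p = {\<alpha>. \<forall>v\<in>D p. \<alpha> \<bullet> v = 0}"

text \<open>The subspace \<open>J \<and> T\<^sup>*\<close> of 2-covectors; its quotient is \<open>\<Lambda>\<^sup>2(T\<^sup>*/J)\<close>.\<close>

definition ideal2 :: "(real^4) set \<Rightarrow> (real^4^4) set" where
  "ideal2 J = span {\<alpha> \<and>\<^sub>f \<beta> |\<alpha> \<beta>. \<alpha> \<in> J}"

definition cong_mod :: "real^4^4 \<Rightarrow> real^4^4 \<Rightarrow> (real^4) set \<Rightarrow> bool"
    ("(_ \<equiv>\<^sub>f _/ mod\<^sub>f _)" [51, 51, 51] 50) where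
  "(\<theta> \<equiv>\<^sub>f \<eta> mod\<^sub>f J) \<longleftrightarrow> \<theta> - \<eta> \<in> ideal2 J"

text \<open>The kernel of \<open>\<delta>\<close> at \<open>p\<close>: covectors in \<open>J p\<close> extended to a local section of \<open>J\<close>.
  As \<open>\<delta>\<close> is a bundle map, the choice of the extension does not matter.\<close>

definition derived_system ::
  "'a::topological_space chart set \<Rightarrow> ('a \<Rightarrow> (real^4) set) \<Rightarrow> 'a \<Rightarrow> (real^4) set" where
  "derived_system A J p = {\<omega> p |\<omega>. \<exists>V. open V \<and> p \<in> V \<and> smooth_form A V \<omega> \<and>
     (\<forall>q\<in>V. \<omega> q \<in> J q) \<and> (ext_d A \<omega> p \<equiv>\<^sub>f 0 mod\<^sub>f J p)}"

definition engel_structure ::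
  "'a::topological_space chart set \<Rightarrow> ('a \<Rightarrow> (real^4) set) \<Rightarrow> bool" where
  "engel_structure A D \<longleftrightarrow> tangent_subbundle A 2 D \<and>
     (let I = annihilator D; I1 = derived_system A I; I2 = derived_system A I1
      in (\<forall>p. dim (I1 p) = 1) \<and> (\<forall>p. I2 p = {0}))"

definition lagrangian_engel_structure ::
  "'a::topological_space chart set \<Rightarrow> ('a \<Rightarrow> real^4^4) \<Rightarrow> ('a \<Rightarrow> (real^4) set) \<Rightarrow> bool" where
  "lagrangian_engel_structure A \<Omega> D \<longleftrightarrow>
     symplectic_form A \<Omega> \<and> engel_structure A D \<and>
     (\<forall>p. D p = {u. \<forall>v\<in>D p. eval2 (\<Omega> p) u v = 0})"


section \<open>Adapted and normalized coframings\<close>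

text \<open>A coframe at a point is an invertible matrix whose rows are the four covectors; a change of
  coframe \<open>\<omega>' = B \<omega>\<close> is then the matrix product. Note that \<open>4 = 0\<close> in the index type \<open>4\<close>,
  which is nevertheless distinct from \<open>1, 2, 3\<close>.\<close>

definition coframing :: "'a chart set \<Rightarrow> 'a set \<Rightarrow> ('a \<Rightarrow> real^4^4) \<Rightarrow> bool" where
  "coframing A V \<omega> \<longleftrightarrow> (\<forall>q\<in>V. invertible (\<omega> q)) \<and> (\<forall>i. smooth_form A V (\<lambda>q. \<omega> q $ i))"

definition d_comp :: "'a chart set \<Rightarrow> ('a \<Rightarrow> real^4^4) \<Rightarrow> 4 \<Rightarrow> 'a \<Rightarrow> real^4^4" where
  "d_comp A \<omega> i p = ext_d A (\<lambda>q. \<omega> q $ i) p"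

definition adapted0 :: "'a::topological_space chart set \<Rightarrow> ('a \<Rightarrow> real^4^4) \<Rightarrow>
    ('a \<Rightarrow> (real^4) set) \<Rightarrow> 'a set \<Rightarrow> ('a \<Rightarrow> real^4^4) \<Rightarrow> bool" where
  "adapted0 A \<Omega> D V \<omega> \<longleftrightarrow> coframing A V \<omega> \<and>
     (\<forall>q\<in>V. \<Omega> q = \<omega> q $ 1 \<and>\<^sub>f \<omega> q $ 3 + \<omega> q $ 2 \<and>\<^sub>f \<omega> q $ 4 \<and>
       annihilator D q = span {\<omega> q $ 1, \<omega> q $ 2} \<and>
       derived_system A (annihilator D) q = span {\<omega> q $ 1})"

definition adapted1 :: "'a::topological_space chart set \<Rightarrow> ('a \<Rightarrow> real^4^4) \<Rightarrow>
    ('a \<Rightarrow> (real^4) set) \<Rightarrow> 'a set \<Rightarrow> ('a \<Rightarrow> real^4^4) \<Rightarrow> bool" where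
  "adapted1 A \<Omega> D V \<omega> \<longleftrightarrow> adapted0 A \<Omega> D V \<omega> \<and>
     (\<forall>q\<in>V. d_comp A \<omega> 2 q \<equiv>\<^sub>f \<omega> q $ 3 \<and>\<^sub>f \<omega> q $ 4 mod\<^sub>f {\<omega> q $ 1, \<omega> q $ 2})"

definition p_coeffs :: "'a chart set \<Rightarrow> ('a \<Rightarrow> real^4^4) \<Rightarrow> 'a \<Rightarrow> real \<Rightarrow> real \<Rightarrow> bool" where
  "p_coeffs A \<omega> q p3 p4 \<longleftrightarrow>
     (d_comp A \<omega> 1 q \<equiv>\<^sub>f (p3 *\<^sub>R \<omega> q $ 3 + p4 *\<^sub>R \<omega> q $ 4) \<and>\<^sub>f \<omega> q $ 2 mod\<^sub>f {\<omega> q $ 1})"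

text \<open>Non-generic (\<open>p\<^sub>3 \<equiv> 0\<close>), with \<open>\<epsilon>\<close> the constant sign of \<open>p\<^sub>4\<close>.\<close>

definition non_generic :: "'a::topological_space chart set \<Rightarrow> ('a \<Rightarrow> real^4^4) \<Rightarrow>
    ('a \<Rightarrow> (real^4) set) \<Rightarrow> bool" where
  "non_generic A \<Omega> D \<longleftrightarrow>
     (\<forall>V \<omega>. open V \<and> adapted1 A \<Omega> D V \<omega> \<longrightarrow> (\<forall>q\<in>V. \<exists>p4. p_coeffs A \<omega> q 0 p4))"

definition sign_p4 :: "'a::topological_space chart set \<Rightarrow> ('a \<Rightarrow> real^4^4) \<Rightarrow>
    ('a \<Rightarrow> (real^4) set) \<Rightarrow> real \<Rightarrow> bool" where
  "sign_p4 A \<Omega> D \<epsilon> \<longleftrightarrow> \<epsilon> \<in> {1, -1} \<and>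
     (\<forall>V \<omega>. open V \<and> adapted1 A \<Omega> D V \<omega> \<longrightarrow>
        (\<forall>q\<in>V. \<forall>p3 p4. p_coeffs A \<omega> q p3 p4 \<longrightarrow> sgn p4 = \<epsilon>))"

definition normalized :: "'a::topological_space chart set \<Rightarrow> ('a \<Rightarrow> real^4^4) \<Rightarrow>
    ('a \<Rightarrow> (real^4) set) \<Rightarrow> real \<Rightarrow> 'a set \<Rightarrow> ('a \<Rightarrow> real^4^4) \<Rightarrow> bool" where
  "normalized A \<Omega> D \<epsilon> V \<omega> \<longleftrightarrow> adapted1 A \<Omega> D V \<omega> \<and> (\<forall>q\<in>V. p_coeffs A \<omega> q 0 \<epsilon>)"

definition block_matrix ::
  "real^2^2 \<Rightarrow> real^2^2 \<Rightarrow> real^2^2 \<Rightarrow> real^2^2 \<Rightarrow> real^4^4" where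
  "block_matrix B11 B12 B21 B22 = vector
     [vector [B11 $ 1 $ 1, B11 $ 1 $ 2, B12 $ 1 $ 1, B12 $ 1 $ 2],
      vector [B11 $ 2 $ 1, B11 $ 2 $ 2, B12 $ 2 $ 1, B12 $ 2 $ 2],
      vector [B21 $ 1 $ 1, B21 $ 1 $ 2, B22 $ 1 $ 1, B22 $ 1 $ 2],
      vector [B21 $ 2 $ 1, B21 $ 2 $ 2, B22 $ 2 $ 1, B22 $ 2 $ 2]]"

text \<open>The group of the normalized coframings after the reduction to \<open>b\<^sub>2\<^sub>2 = 1\<close>.\<close>

definition structure_group :: "(real^4^4) set" where
  "structure_group = {block_matrix B11 0 (matrix_inv (transpose B11) ** S)
                        (matrix_inv (transpose B11)) |B11 S.
     transpose S = S \<and> (\<exists>b21. B11 = vector [vector [1, 0], vector [b21, 1]])}"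

text \<open>A choice of the bundle \<open>P\<close>: near each point it is the orbit, under the reduced group, of a
  smooth normalized coframing. \<open>P p\<close> is the fibre over \<open>p\<close>.\<close>

definition normalized_bundle :: "'a::topological_space chart set \<Rightarrow> ('a \<Rightarrow> real^4^4) \<Rightarrow>
    ('a \<Rightarrow> (real^4) set) \<Rightarrow> real \<Rightarrow> ('a \<Rightarrow> (real^4^4) set) \<Rightarrow> bool" where
  "normalized_bundle A \<Omega> D \<epsilon> P \<longleftrightarrow>
     (\<forall>p. \<exists>V \<omega>. open V \<and> p \<in> V \<and> normalized A \<Omega> D \<epsilon> V \<omega> \<and>
        (\<forall>q\<in>V. P q = {B ** \<omega> q |B. B \<in> structure_group}))"

definition section_of :: "'a chart set \<Rightarrow> ('a \<Rightarrow> (real^4^4) set) \<Rightarrow> 'a set \<Rightarrow>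
    ('a \<Rightarrow> real^4^4) \<Rightarrow> bool" where
  "section_of A P V \<omega> \<longleftrightarrow> coframing A V \<omega> \<and> (\<forall>q\<in>V. \<omega> q \<in> P q)"

definition A_coeffs :: "'a chart set \<Rightarrow> real \<Rightarrow> ('a \<Rightarrow> real^4^4) \<Rightarrow> 'a \<Rightarrow>
    real \<Rightarrow> real \<Rightarrow> real \<Rightarrow> bool" where
  "A_coeffs A \<epsilon> \<omega> q a2 a3 a4 \<longleftrightarrow>
     d_comp A \<omega> 1 q = \<epsilon> *\<^sub>R (\<omega> q $ 4 \<and>\<^sub>f \<omega> q $ 2) +
       (a2 *\<^sub>R \<omega> q $ 2 + a3 *\<^sub>R \<omega> q $ 3 + a4 *\<^sub>R \<omega> q $ 4) \<and>\<^sub>f \<omega> q $ 1"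

text \<open>The value at \<open>q\<close> of the common coefficient of all local sections of \<open>P\<close>. The number
  \<open>inv_A4 A \<epsilon> P q\<close> is meaningful only if \<open>inv_A3 A \<epsilon> P q = \<epsilon>\<close>.\<close>

definition inv_A3 :: "'a::topological_space chart set \<Rightarrow> real \<Rightarrow>
    ('a \<Rightarrow> (real^4^4) set) \<Rightarrow> 'a \<Rightarrow> real" where
  "inv_A3 A \<epsilon> P q = (THE a3. \<exists>V \<omega> a2 a4. open V \<and> q \<in> V \<and> section_of A P V \<omega> \<and>
     A_coeffs A \<epsilon> \<omega> q a2 a3 a4)"

definition inv_A4 :: "'a::topological_space chart set \<Rightarrow> real \<Rightarrow>
    ('a \<Rightarrow> (real^4^4) set) \<Rightarrow> 'a \<Rightarrow> real" where
  "inv_A4 A \<epsilon> P q = (THE a4. \<exists>V \<omega> a2 a3. open V \<and> q \<in> V \<and> section_of A P V \<omega> \<and>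
     A_coeffs A \<epsilon> \<omega> q a2 a3 a4)"


section \<open>The structure equations\<close>

definition structure_eqs_1 :: "'a chart set \<Rightarrow> real \<Rightarrow> ('a \<Rightarrow> real) \<Rightarrow> 'a set \<Rightarrow>
    ('a \<Rightarrow> real^4^4) \<Rightarrow> bool" where
  "structure_eqs_1 A \<epsilon> A3 U \<omega> \<longleftrightarrow>
     (\<forall>q\<in>U. d_comp A \<omega> 1 q = \<epsilon> *\<^sub>R (\<omega> q $ 4 \<and>\<^sub>f \<omega> q $ 2) + A3 q *\<^sub>R (\<omega> q $ 3 \<and>\<^sub>f \<omega> q $ 1)) \<and>
     (\<exists>a b c. smooth_fun A U a \<and> smooth_fun A U b \<and> smooth_fun A U c \<and>
       (\<forall>q\<in>U. d_comp A \<omega> 2 q = (a q *\<^sub>R \<omega> q $ 1 + b q *\<^sub>R \<omega> q $ 4) \<and>\<^sub>f \<omega> q $ 2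
           + c q *\<^sub>R (\<omega> q $ 3 \<and>\<^sub>f \<omega> q $ 1) + \<omega> q $ 3 \<and>\<^sub>f \<omega> q $ 4))"

definition structure_eqs_2a :: "'a chart set \<Rightarrow> real \<Rightarrow> 'a set \<Rightarrow> ('a \<Rightarrow> real^4^4) \<Rightarrow> bool" where
  "structure_eqs_2a A \<epsilon> U \<omega> \<longleftrightarrow>
     (\<exists>A2. smooth_fun A U A2 \<and>
       (\<forall>q\<in>U. d_comp A \<omega> 1 q = \<epsilon> *\<^sub>R (\<omega> q $ 4 \<and>\<^sub>f \<omega> q $ 2) + \<epsilon> *\<^sub>R (\<omega> q $ 3 \<and>\<^sub>f \<omega> q $ 1)
           + A2 q *\<^sub>R (\<omega> q $ 2 \<and>\<^sub>f \<omega> q $ 1))) \<and>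
     (\<forall>q\<in>U. d_comp A \<omega> 2 q \<equiv>\<^sub>f \<omega> q $ 3 \<and>\<^sub>f \<omega> q $ 4 mod\<^sub>f {\<omega> q $ 1})"

definition structure_eqs_2b :: "'a chart set \<Rightarrow> real \<Rightarrow> ('a \<Rightarrow> real) \<Rightarrow> 'a set \<Rightarrow>
    ('a \<Rightarrow> real^4^4) \<Rightarrow> bool" where
  "structure_eqs_2b A \<epsilon> A4 U \<omega> \<longleftrightarrow>
     (\<forall>q\<in>U. d_comp A \<omega> 1 q = \<epsilon> *\<^sub>R (\<omega> q $ 4 \<and>\<^sub>f \<omega> q $ 2) + \<epsilon> *\<^sub>R (\<omega> q $ 3 \<and>\<^sub>f \<omega> q $ 1)
         + A4 q *\<^sub>R (\<omega> q $ 4 \<and>\<^sub>f \<omega> q $ 1)) \<and>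
     (\<exists>q3. smooth_fun A U q3 \<and>
       (\<forall>q\<in>U. d_comp A \<omega> 2 q \<equiv>\<^sub>f q3 q *\<^sub>R (\<omega> q $ 3 \<and>\<^sub>f \<omega> q $ 2) + \<omega> q $ 3 \<and>\<^sub>f \<omega> q $ 4
           mod\<^sub>f {\<omega> q $ 1}))"

end

theory Submission
  imports Defs
begin

text \<open>A change of section of \<open>P\<close> is given by functions \<open>b, x, s, t\<close>. Write
  \<open>d\<omega>\<^sub>2 = (a \<omega>\<^sub>1 + q\<^sub>3 \<omega>\<^sub>3 + q\<^sub>4 \<omega>\<^sub>4) \<and> \<omega>\<^sub>2 + (c \<omega>\<^sub>3 + e \<omega>\<^sub>4) \<and> \<omega>\<^sub>1 + \<omega>\<^sub>3 \<and> \<omega>\<^sub>4\<close>.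
  Under the change, \<open>A\<^sub>3\<close> is invariant, \<open>A\<^sub>4\<close> becomes \<open>A\<^sub>4 - (\<epsilon> - A\<^sub>3) b\<close> and \<open>A\<^sub>2\<close> becomes
  \<open>A\<^sub>2 + (\<epsilon> - A\<^sub>3) s - t A\<^sub>4\<close>; for \<open>b = 0\<close>, moreover, \<open>q\<^sub>3, q\<^sub>4, e\<close> become \<open>q\<^sub>3 - t, q\<^sub>4 + s, e + x\<close>.
  If \<open>A\<^sub>3 \<noteq> \<epsilon>\<close>, the conditions \<open>A\<^sub>4 = A\<^sub>2 = q\<^sub>3 = e = 0\<close> determine \<open>b, s, t, x\<close> one after the other.
  If \<open>A\<^sub>3 = \<epsilon>\<close>, take \<open>b = x = 0\<close>, \<open>s = - q\<^sub>4\<close>, and \<open>t = q\<^sub>3\<close> or \<open>t = A\<^sub>2 / A\<^sub>4\<close>. In this case the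
  conditions do not determine a section, so a section of \<open>P\<close> over the whole domain is needed to
  start from; it comes from a partition of unity.\<close>

section \<open>Smooth maps\<close>

text \<open>The parameters \<open>x, s, t\<close> leave \<open>\<omega>1\<close> and
  \<open>\<omega>2\<close> alone when \<open>b = 0\<close>, so they act on the coefficients of
  \<open>d\<omega>1\<close> and \<open>d\<omega>2\<close> by algebra at a point. Only
  \<open>b\<close> is ever differentiated, through \<open>d(\<omega>2 + b \<omega>1) = d\<omega>2 +
  b d\<omega>1 + db \<and> \<omega>1\<close>. Hence \<open>b\<close> is settled first, from A4,
  which belongs to \<open>d\<omega>1\<close>; the coefficients of \<open>d\<omega>2\<close> are then
  computed afresh for the new section. Once A4 = 0, the term \<open>t A4\<close> disappears from the
  change of A2, so that \<open>s\<close> can be found without knowing \<open>t\<close>. The obstacle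
  is smoothness. Components refer to a preferred chart that may jump from point to point, so the
  coefficients are read off as values of \<open>d\<omega>1\<close> and \<open>d\<omega>2\<close> on
  the dual frame and moved to one fixed chart. There the dual frame is smooth by Cramer's rule, and
  the move needs the naturality of d, which rests on the symmetry of second derivatives.\<close>

lemma frechet_derivative_cong_open:
  assumes "open S" "x \<in> S" "\<And>y. y \<in> S \<Longrightarrow> f y = g y"
  shows "frechet_derivative f (at x) = frechet_derivative g (at x)"
proof -
  have "(f has_derivative f') (at x) \<longleftrightarrow> (g has_derivative f') (at x)" for f'
    using assms has_derivative_transform_within_open[of f f' x UNIV S g]
      has_derivative_transform_within_open[of g f' x UNIV S f] by auto
  then show ?thesis by (simp add: frechet_derivative_def)
qed

section \<open>Calculus of maps of class C^k\<close>

lemma Ck_on_cong: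
  assumes "open S" "\<And>x. x \<in> S \<Longrightarrow> f x = g x" "Ck_on k S f"
  shows "Ck_on k S g"
  using assms(2,3)
proof (induction k arbitrary: f g)
  case 0
  then show ?case by (simp cong: continuous_on_cong)
next
  case (Suc k)
  have fd: "frechet_derivative f (at x) = frechet_derivative g (at x)" if "x \<in> S" for x
    using frechet_derivative_cong_open[OF assms(1) that] Suc.prems(1) by blast
  have "g differentiable_on S"
    using Suc.prems assms(1) has_derivative_transform_within_open[of f _ _ UNIV S g]
    by (simp add: differentiable_on_eq_differentiable_at) (metis differentiable_def)
  moreover have "Ck_on k S (\<lambda>x. frechet_derivative g (at x) v)" for v
    by (rule Suc.IH[of "\<lambda>x. frechet_derivative f (at x) v"]) (use fd Suc.prems(2) in auto)
  ultimately show ?case by simp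
qed

text \<open>The definition speaks of \<open>frechet_derivative\<close>, which is a choice. With this
  rule the closure proofs below only have to exhibit a derivative formula and check that it is of
  class k.\<close>

lemma Ck_on_SucI:
  assumes "open S" "\<And>x. x \<in> S \<Longrightarrow> (f has_derivative f' x) (at x)"
    "\<And>v. Ck_on k S (\<lambda>x. f' x v)"
  shows "Ck_on (Suc k) S f"
proof -
  have fd: "frechet_derivative f (at x) = f' x" if "x \<in> S" for x
    using assms(2)[OF that] frechet_derivative_at by metis
  have "f differentiable_on S"
    using assms(1,2) by (meson differentiableI differentiable_at_imp_differentiable_on)
  moreover have "Ck_on k S (\<lambda>x. frechet_derivative f (at x) v)" for v
    by (rule Ck_on_cong[OF assms(1) _ assms(3)[of v]]) (simp add: fd)
  ultimately show ?thesis by simp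
qed

lemma Ck_on_has_derivative:
  assumes "open S" "Ck_on (Suc k) S f" "x \<in> S"
  shows "(f has_derivative frechet_derivative f (at x)) (at x)"
  using assms differentiable_on_eq_differentiable_at frechet_derivative_works by (metis Ck_on.simps(2))

lemma Ck_on_SucD:
  assumes "Ck_on (Suc k) S f"
  shows "Ck_on k S f"
  using assms
proof (induction k arbitrary: f)
  case 0
  then show ?case by (simp add: differentiable_imp_continuous_on)
next
  case (Suc k)
  then show ?case by (metis Ck_on.simps(2))
qed

lemma Ck_on_subset:
  assumes "Ck_on k S f" "T \<subseteq> S"
  shows "Ck_on k T f"
  using assms(1)
proof (induction k arbitrary: f)
  case 0
  then show ?case using assms(2) continuous_on_subset by auto
next
  case (Suc k)
  then show ?case using assms(2) differentiable_on_subset by auto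
qed

text \<open>Derivatives are taken \<open>at x\<close>, so each condition is tested on an open
  neighbourhood of the point. This is what allows smoothness of functions and forms defined
  piecewise to be checked piece by piece.\<close>

lemma Ck_on_local:
  assumes "\<And>x. x \<in> S \<Longrightarrow> \<exists>T. open T \<and> x \<in> T \<and> Ck_on k T f"
  shows "Ck_on k S f"
  using assms
proof (induction k arbitrary: f)
  case 0
  then have "continuous (at x within S) f" if "x \<in> S" for x
    using that by (metis Ck_on.simps(1) continuous_at_imp_continuous_at_within continuous_on_eq_continuous_at)
  then show ?case by (simp add: continuous_on_eq_continuous_within)
next
  case (Suc k)
  have "f differentiable (at x within S)" if x: "x \<in> S" for x
  proof -
    obtain T where "open T" "x \<in> T" "f differentiable_on T" using Suc.prems[OF x] by auto
    then show ?thesis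
      using differentiable_on_eq_differentiable_at differentiable_at_withinI by blast
  qed
  moreover have "Ck_on k S (\<lambda>x. frechet_derivative f (at x) v)" for v
    by (rule Suc.IH) (use Suc.prems in auto)
  ultimately show ?case by (simp add: differentiable_on_def)
qed

lemma Ck_on_const: "open S \<Longrightarrow> Ck_on k S (\<lambda>x. c)"
proof (induction k arbitrary: c)
  case (Suc k)
  show ?case by (rule Ck_on_SucI[where f' = "\<lambda>x v. 0"]) (use Suc in auto)
qed auto

lemma Ck_on_bounded_linear:
  assumes "open S" "bounded_linear L" "Ck_on k S f"
  shows "Ck_on k S (\<lambda>x. L (f x))"
  using assms(3)
proof (induction k arbitrary: f)
  case 0
  then show ?case using assms(2) by (simp add: linear_continuous_on_compose linear_linear bounded_linear.continuous_on)
next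
  case (Suc k)
  show ?case
    by (rule Ck_on_SucI[where f' = "\<lambda>x v. L (frechet_derivative f (at x) v)"])
      (use Suc assms bounded_linear.has_derivative[OF assms(2) Ck_on_has_derivative[OF assms(1) Suc.prems]] in auto)
qed

lemma Ck_on_id: "open S \<Longrightarrow> Ck_on k S (\<lambda>x. x)"
proof (cases k)
  case (Suc n)
  assume "open S"
  then show ?thesis unfolding Suc
    by (intro Ck_on_SucI[where f' = "\<lambda>x v. v"]) (auto intro: Ck_on_const)
qed auto

lemma Ck_on_add:
  assumes "open S" "Ck_on k S f" "Ck_on k S g"
  shows "Ck_on k S (\<lambda>x. f x + g x)"
  using assms(2,3)
proof (induction k arbitrary: f g)
  case 0
  then show ?case by (simp add: continuous_on_add)
next
  case (Suc k)
  note d = Ck_on_has_derivative[OF assms(1)]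
  show ?case
    by (rule Ck_on_SucI[where
          f' = "\<lambda>x v. frechet_derivative f (at x) v + frechet_derivative g (at x) v"])
      (use Suc assms(1) d[OF Suc.prems(1)] d[OF Suc.prems(2)] in \<open>auto intro: has_derivative_add\<close>)
qed

text \<open>The product rule has the same shape for every bounded bilinear map, so one induction
  serves multiplication, scaling and inner products. In the induction step the undifferentiated
  factor is first demoted from class k + 1 to class k.\<close>

lemma Ck_on_bilinear:
  assumes "open S" "bounded_bilinear m" "Ck_on k S f" "Ck_on k S g"
  shows "Ck_on k S (\<lambda>x. m (f x) (g x))"
  using assms(3,4)
proof (induction k arbitrary: f g)
  case 0
  then show ?case using bounded_bilinear.continuous_on[OF assms(2)] by simp
next
  case (Suc k)
  note d = Ck_on_has_derivative[OF assms(1)]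
  show ?case
  proof (rule Ck_on_SucI[where f' = "\<lambda>x v. m (f x) (frechet_derivative g (at x) v) +
        m (frechet_derivative f (at x) v) (g x)"])
    show "Ck_on k S (\<lambda>x. m (f x) (frechet_derivative g (at x) v) +
        m (frechet_derivative f (at x) v) (g x))" for v
      using Suc.prems by (intro Ck_on_add assms Suc.IH) (auto intro: Ck_on_SucD simp del: Ck_on.simps(2) simp: Ck_on.simps(2)[of k S f] Ck_on.simps(2)[of k S g])
  qed (use assms(1) bounded_bilinear.FDERIV[OF assms(2) d[OF Suc.prems(1)] d[OF Suc.prems(2)]] in auto)
qed

lemmas Ck_on_scaleR = Ck_on_bilinear[OF _ bounded_bilinear_scaleR]
lemmas Ck_on_mult = Ck_on_bilinear[OF _ bounded_bilinear_mult]
lemmas Ck_on_inner = Ck_on_bilinear[OF _ bounded_bilinear_inner]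

lemma Ck_on_sum:
  assumes "open S" "\<And>i. i \<in> I \<Longrightarrow> Ck_on k S (f i)"
  shows "Ck_on k S (\<lambda>x. \<Sum>i\<in>I. f i x)"
  using assms(2)
  by (induction I rule: infinite_finite_induct) (auto intro: Ck_on_const Ck_on_add assms(1))

lemma Ck_on_prod:
  fixes f :: "'i \<Rightarrow> 'a::real_normed_vector \<Rightarrow> 'b::real_normed_field"
  assumes "open S" "\<And>i. i \<in> I \<Longrightarrow> Ck_on k S (f i)"
  shows "Ck_on k S (\<lambda>x. \<Prod>i\<in>I. f i x)"
  using assms(2)
  by (induction I rule: infinite_finite_induct) (auto intro: Ck_on_const Ck_on_mult assms(1))

text \<open>The derivative of 1/f is a product of f' with two copies of 1/f. The induction
  hypothesis supplies 1/f in class k, and the product lemma does the rest.\<close>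

lemma Ck_on_inverse:
  fixes f :: "'a::real_normed_vector \<Rightarrow> real"
  assumes "open S" "Ck_on k S f" "\<And>x. x \<in> S \<Longrightarrow> f x \<noteq> 0"
  shows "Ck_on k S (\<lambda>x. inverse (f x))"
  using assms(2)
proof (induction k)
  case 0
  then show ?case using assms(3) by (simp add: continuous_on_inverse)
next
  case (Suc k)
  have inv: "Ck_on k S (\<lambda>x. inverse (f x))" using Suc Ck_on_SucD by blast
  show ?case
  proof (rule Ck_on_SucI[where
        f' = "\<lambda>x v. - (inverse (f x) * frechet_derivative f (at x) v * inverse (f x))"])
    show "Ck_on k S (\<lambda>x. - (inverse (f x) * frechet_derivative f (at x) v * inverse (f x)))" for v
      by (rule Ck_on_bounded_linear[OF assms(1) bounded_linear_minus[OF bounded_linear_ident]])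
        (use Suc.prems in \<open>auto intro!: Ck_on_mult inv assms(1)\<close>)
  qed (use assms Ck_on_has_derivative[OF assms(1) Suc.prems] in \<open>auto intro!: has_derivative_inverse\<close>)
qed

text \<open>The chain rule expresses the derivatives of \<open>f \<circ> g\<close> through the partial derivatives of \<open>f\<close>
  composed with \<open>g\<close>, which is why the intermediate space must be finite-dimensional.\<close>

lemma Ck_on_compose:
  fixes g :: "'a::real_normed_vector \<Rightarrow> 'b::euclidean_space"
  assumes "open S" "open T" "Ck_on k T f" "Ck_on k S g" "g ` S \<subseteq> T"
  shows "Ck_on k S (\<lambda>x. f (g x))"
  using assms(3,4)
proof (induction k arbitrary: f)
  case 0
  then show ?case using assms(5) by (auto intro: continuous_on_compose2)
next
  case (Suc k)
  let ?f' = "\<lambda>x v. \<Sum>b\<in>Basis. (frechet_derivative g (at x) v \<bullet> b) *\<^sub>R frechet_derivative f (at (g x)) b"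
  show ?case
  proof (rule Ck_on_SucI[where f' = ?f'])
    fix x assume x: "x \<in> S"
    have f: "(f has_derivative frechet_derivative f (at (g x))) (at (g x))"
      using x assms Suc.prems(1) Ck_on_has_derivative by blast
    have g: "(g has_derivative frechet_derivative g (at x)) (at x)"
      using Ck_on_has_derivative[OF assms(1) Suc.prems(2) x] .
    have rep: "frechet_derivative f (at (g x)) w = (\<Sum>b\<in>Basis. (w \<bullet> b) *\<^sub>R frechet_derivative f (at (g x)) b)" for w
      using linear_sum[OF has_derivative_linear[OF f], of "\<lambda>b. (w \<bullet> b) *\<^sub>R b" Basis]
      by (simp add: euclidean_representation linear_cmul[OF has_derivative_linear[OF f]])
    have "?f' x = frechet_derivative f (at (g x)) \<circ> frechet_derivative g (at x)"
      by (rule ext) (simp only: comp_def rep[of "frechet_derivative g (at x) _"])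
    then show "((\<lambda>x. f (g x)) has_derivative ?f' x) (at x)"
      using diff_chain_at[OF g f] by (simp add: comp_def)
  next
    fix v
    have "Ck_on k S (\<lambda>x. frechet_derivative f (at (g x)) b)" for b
      using Suc.IH[of "\<lambda>y. frechet_derivative f (at y) b"] Suc.prems Ck_on_SucD by auto
    moreover have "Ck_on k S (\<lambda>x. frechet_derivative g (at x) v \<bullet> b)" for b
      using Suc.prems(2) by (intro Ck_on_inner assms Ck_on_const) auto
    ultimately show "Ck_on k S (\<lambda>x. ?f' x v)"
      by (intro Ck_on_sum Ck_on_scaleR assms)
  qed (rule assms)
qed

section \<open>Closure properties of smooth maps\<close>

lemma smooth_on_cong: "open S \<Longrightarrow> (\<And>x. x \<in> S \<Longrightarrow> f x = g x) \<Longrightarrow> smooth_on S f \<Longrightarrow> smooth_on S g"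
  by (auto simp: smooth_on_def intro: Ck_on_cong[of S f g])

lemma smooth_on_subset: "smooth_on S f \<Longrightarrow> T \<subseteq> S \<Longrightarrow> smooth_on T f"
  by (simp add: smooth_on_def Ck_on_subset[of _ S f])

lemma smooth_on_local:
  "(\<And>x. x \<in> S \<Longrightarrow> \<exists>T. open T \<and> x \<in> T \<and> smooth_on T f) \<Longrightarrow> smooth_on S f"
  by (simp add: smooth_on_def) (rule allI, rule Ck_on_local, blast)

lemma smooth_on_const: "open S \<Longrightarrow> smooth_on S (\<lambda>x. c)"
  by (simp add: smooth_on_def Ck_on_const)

lemma smooth_on_id: "open S \<Longrightarrow> smooth_on S (\<lambda>x. x)"
  by (simp add: smooth_on_def Ck_on_id)

lemma smooth_on_bounded_linear:
  "open S \<Longrightarrow> bounded_linear L \<Longrightarrow> smooth_on S f \<Longrightarrow> smooth_on S (\<lambda>x. L (f x))"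
  by (simp add: smooth_on_def Ck_on_bounded_linear)

lemma smooth_on_add:
  "open S \<Longrightarrow> smooth_on S f \<Longrightarrow> smooth_on S g \<Longrightarrow> smooth_on S (\<lambda>x. f x + g x)"
  by (simp add: smooth_on_def Ck_on_add)

lemma smooth_on_bilinear:
  "open S \<Longrightarrow> bounded_bilinear m \<Longrightarrow> smooth_on S f \<Longrightarrow> smooth_on S g \<Longrightarrow>
    smooth_on S (\<lambda>x. m (f x) (g x))"
  by (simp add: smooth_on_def Ck_on_bilinear)

lemmas smooth_on_scaleR = smooth_on_bilinear[OF _ bounded_bilinear_scaleR]
lemmas smooth_on_mult = smooth_on_bilinear[OF _ bounded_bilinear_mult]
lemmas smooth_on_inner = smooth_on_bilinear[OF _ bounded_bilinear_inner]
lemmas smooth_on_minus = smooth_on_bounded_linear[OF _ bounded_linear_minus[OF bounded_linear_ident]]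

lemma smooth_on_diff:
  "open S \<Longrightarrow> smooth_on S f \<Longrightarrow> smooth_on S g \<Longrightarrow> smooth_on S (\<lambda>x. f x - g x)"
  using smooth_on_add[OF _ _ smooth_on_minus] by fastforce

lemma smooth_on_sum:
  "open S \<Longrightarrow> (\<And>i. i \<in> I \<Longrightarrow> smooth_on S (f i)) \<Longrightarrow> smooth_on S (\<lambda>x. \<Sum>i\<in>I. f i x)"
  by (simp add: smooth_on_def Ck_on_sum)

lemma smooth_on_prod:
  fixes f :: "'i \<Rightarrow> 'a::real_normed_vector \<Rightarrow> 'b::real_normed_field"
  shows "open S \<Longrightarrow> (\<And>i. i \<in> I \<Longrightarrow> smooth_on S (f i)) \<Longrightarrow> smooth_on S (\<lambda>x. \<Prod>i\<in>I. f i x)"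
  by (simp add: smooth_on_def Ck_on_prod)

lemma smooth_on_divide:
  fixes f g :: "'a::real_normed_vector \<Rightarrow> real"
  assumes "open S" "smooth_on S f" "smooth_on S g" "\<And>x. x \<in> S \<Longrightarrow> g x \<noteq> 0"
  shows "smooth_on S (\<lambda>x. f x / g x)"
  using assms by (auto simp: divide_inverse smooth_on_def intro!: Ck_on_mult Ck_on_inverse)

lemma smooth_on_compose:
  fixes g :: "'a::real_normed_vector \<Rightarrow> 'b::euclidean_space"
  shows "open S \<Longrightarrow> open T \<Longrightarrow> smooth_on T f \<Longrightarrow> smooth_on S g \<Longrightarrow> g ` S \<subseteq> T \<Longrightarrow>
    smooth_on S (\<lambda>x. f (g x))"
  by (simp add: smooth_on_def Ck_on_compose)

lemma smooth_on_frechet_derivative: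
  "smooth_on S f \<Longrightarrow> smooth_on S (\<lambda>x. frechet_derivative f (at x) v)"
  unfolding smooth_on_def by (metis Ck_on.simps(2))

lemma smooth_on_has_derivative:
  "open S \<Longrightarrow> smooth_on S f \<Longrightarrow> x \<in> S \<Longrightarrow> (f has_derivative frechet_derivative f (at x)) (at x)"
  by (rule Ck_on_has_derivative[of S 0]) (simp_all only: smooth_on_def)

lemma smooth_on_component:
  fixes f :: "'a::real_normed_vector \<Rightarrow> 'b::real_normed_vector^'n"
  shows "open S \<Longrightarrow> smooth_on S f \<Longrightarrow> smooth_on S (\<lambda>x. f x $ i)"
  by (rule smooth_on_bounded_linear[OF _ bounded_linear_vec_nth])

lemma smooth_on_vec:
  fixes f :: "'a::real_normed_vector \<Rightarrow> real^'n"
  assumes "open S" "\<And>i. smooth_on S (\<lambda>x. f x $ i)"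
  shows "smooth_on S f"
proof -
  have "smooth_on S (\<lambda>x. \<Sum>i\<in>UNIV. f x $ i *\<^sub>R (axis i 1 :: real^'n))"
    by (intro smooth_on_sum smooth_on_scaleR smooth_on_const assms)
  moreover have "(\<Sum>i\<in>UNIV. v $ i *\<^sub>R axis i 1) = v" for v :: "real^'n"
    using basis_expansion[of v] by (simp add: scalar_mult_eq_scaleR)
  ultimately show ?thesis by simp
qed

section \<open>Smoothness of determinants and inverse matrices\<close>

lemma smooth_on_det:
  fixes M :: "'a::real_normed_vector \<Rightarrow> real^'n^'n"
  assumes "open S" "\<And>i j. smooth_on S (\<lambda>x. M x $ i $ j)"
  shows "smooth_on S (\<lambda>x. det (M x))"
  unfolding det_def by (intro smooth_on_sum smooth_on_mult smooth_on_const smooth_on_prod assms)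

lemma matrix_inv_inverse:
  fixes M :: "'a::semiring_1^'n^'n"
  assumes "invertible M"
  shows "M ** matrix_inv M = mat 1" "matrix_inv M ** M = mat 1"
  using someI_ex[OF assms[unfolded invertible_def]] by (simp_all add: matrix_inv_def)

text \<open>Column \<open>l\<close> of the inverse solves a linear system with right-hand side
  \<open>axis l 1\<close>. By Cramer's rule its entries are quotients of determinants, that is, of
  polynomials in the entries of \<open>M\<close>.\<close>

lemma smooth_on_matrix_inv:
  fixes M :: "'a::real_normed_vector \<Rightarrow> real^'n^'n"
  assumes S: "open S" and M: "\<And>i j. smooth_on S (\<lambda>x. M x $ i $ j)"
    and inv: "\<And>x. x \<in> S \<Longrightarrow> invertible (M x)"
  shows "smooth_on S (\<lambda>x. matrix_inv (M x) $ k $ l)"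
proof -
  let ?C = "\<lambda>x. \<chi> i j. if j = k then axis l 1 $ i else M x $ i $ j"
  have eq: "matrix_inv (M x) $ k $ l = det (?C x) / det (M x)" if "x \<in> S" for x
  proof -
    have "M x *v column l (matrix_inv (M x)) = axis l 1"
      using matrix_inv_inverse[OF inv[OF that]]
      by (metis matrix_vector_mul_assoc matrix_vector_mul_lid matrix_vector_mult_basis)
    moreover have "det (M x) \<noteq> 0" using inv[OF that] invertible_det_nz by blast
    ultimately have "column l (matrix_inv (M x)) = (\<chi> k. det (\<chi> i j. if j = k then axis l 1 $ i else M x $ i $ j) / det (M x))"
      using cramer by blast
    then show ?thesis by (metis (no_types, lifting) column_def vec_lambda_beta)
  qed
  have "smooth_on S (\<lambda>x. ?C x $ i $ j)" for i j
    by (cases "j = k") (auto intro: smooth_on_const S M)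
  then have "smooth_on S (\<lambda>x. det (?C x) / det (M x))"
    by (intro smooth_on_divide S smooth_on_det M) (use inv invertible_det_nz in auto)
  then show ?thesis
    by (rule smooth_on_cong[OF S, rotated]) (rule eq[symmetric])
qed

section \<open>Second derivatives and bump functions\<close>

lemma has_real_derivative_line:
  fixes f :: "'a::real_normed_vector \<Rightarrow> real"
  assumes "(f has_derivative f') (at (p + s *\<^sub>R u))"
  shows "((\<lambda>s. f (p + s *\<^sub>R u)) has_real_derivative f' u) (at s)"
proof -
  have "((\<lambda>s. p + s *\<^sub>R u) has_derivative (\<lambda>r. r *\<^sub>R u)) (at s)"
    by (auto intro!: derivative_eq_intros)
  from has_derivative_compose[OF this assms]
  show ?thesis
    by (simp add: has_field_derivative_def linear_cmul[OF has_derivative_linear[OF assms]] mult_commute_abs)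
qed

text \<open>The mean value theorem is applied twice: in direction \<open>u\<close> to the difference
  of \<open>f\<close> along two parallel sides, and then in direction \<open>v\<close> to the
  derivative so obtained.\<close>

lemma second_difference_mvt:
  fixes f :: "'a::real_normed_vector \<Rightarrow> real"
  assumes S: "open S" and f: "Ck_on (Suc (Suc 0)) S f" and h: "0 < h"
    and sub: "\<And>s t. 0 \<le> s \<Longrightarrow> s \<le> h \<Longrightarrow> 0 \<le> t \<Longrightarrow> t \<le> h \<Longrightarrow> x + s *\<^sub>R u + t *\<^sub>R v \<in> S"
  obtains s t where "0 < s" "s < h" "0 < t" "t < h"
    "f (x + h *\<^sub>R u + h *\<^sub>R v) - f (x + h *\<^sub>R u) - f (x + h *\<^sub>R v) + f x =
      h * h * frechet_derivative (\<lambda>y. frechet_derivative f (at y) u) (at (x + s *\<^sub>R u + t *\<^sub>R v)) v"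
proof -
  define D where "D y = frechet_derivative f (at y) u" for y
  have f1: "(f has_derivative frechet_derivative f (at y)) (at y)" if "y \<in> S" for y
    using Ck_on_has_derivative[OF S f that] .
  have D1: "(D has_derivative frechet_derivative D (at y)) (at y)" if "y \<in> S" for y
    unfolding D_def by (rule Ck_on_has_derivative[OF S _ that, of 0]) (use f in simp)
  let ?\<phi> = "\<lambda>s. f ((x + h *\<^sub>R v) + s *\<^sub>R u) - f (x + s *\<^sub>R u)"
  have d1: "(?\<phi> has_real_derivative (D (x + s *\<^sub>R u + h *\<^sub>R v) - D (x + s *\<^sub>R u))) (at s)"
    if "0 \<le> s" "s \<le> h" for s
  proof -
    have "x + h *\<^sub>R v + s *\<^sub>R u \<in> S" "x + s *\<^sub>R u \<in> S"
      using sub[OF that, of h] sub[OF that, of 0] h by (simp_all add: ac_simps)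
    from has_real_derivative_line[OF f1[OF this(1)]] has_real_derivative_line[OF f1[OF this(2)]]
    have "(?\<phi> has_real_derivative (D (x + h *\<^sub>R v + s *\<^sub>R u) - D (x + s *\<^sub>R u))) (at s)"
      unfolding D_def by (rule DERIV_diff)
    then show ?thesis by (simp add: ac_simps)
  qed
  obtain s where s: "0 < s" "s < h"
    and eq1: "?\<phi> h - ?\<phi> 0 = (h - 0) * (D (x + s *\<^sub>R u + h *\<^sub>R v) - D (x + s *\<^sub>R u))"
    using MVT2[OF h d1] by blast
  let ?\<psi> = "\<lambda>t. D ((x + s *\<^sub>R u) + t *\<^sub>R v)"
  have d2: "(?\<psi> has_real_derivative frechet_derivative D (at (x + s *\<^sub>R u + t *\<^sub>R v)) v) (at t)"
    if "0 \<le> t" "t \<le> h" for t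
    by (rule has_real_derivative_line, rule D1) (use sub[of s t] s that in auto)
  obtain t where t: "0 < t" "t < h"
    and eq2: "?\<psi> h - ?\<psi> 0 = (h - 0) * frechet_derivative D (at (x + s *\<^sub>R u + t *\<^sub>R v)) v"
    using MVT2[OF h d2] by blast
  have "f (x + h *\<^sub>R u + h *\<^sub>R v) - f (x + h *\<^sub>R u) - f (x + h *\<^sub>R v) + f x =
      h * h * frechet_derivative D (at (x + s *\<^sub>R u + t *\<^sub>R v)) v"
    using eq1 eq2 by (simp add: algebra_simps)
  then show thesis using that s t unfolding D_def by blast
qed

text \<open>The second difference of \<open>f\<close> over a parallelogram is symmetric in
  \<open>u\<close> and \<open>v\<close>. So both mixed derivatives take a common value at suitable
  points of an arbitrarily small parallelogram, and continuity brings this to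
  \<open>x\<close>.\<close>

lemma second_derivative_symmetric_real:
  fixes f :: "'a::real_normed_vector \<Rightarrow> real"
  assumes S: "open S" and f: "Ck_on (Suc (Suc 0)) S f" and x: "x \<in> S"
  shows "frechet_derivative (\<lambda>y. frechet_derivative f (at y) u) (at x) v =
    frechet_derivative (\<lambda>y. frechet_derivative f (at y) v) (at x) u" (is "?G x = ?H x")
proof (rule ccontr)
  assume neq: "?G x \<noteq> ?H x"
  \<comment> \<open>Half of the gap: no real number is closer than this to both mixed derivatives at
    \<open>x\<close>.\<close>
  define e where "e = \<bar>?G x - ?H x\<bar> / 2"
  have e: "0 < e" using neq by (simp add: e_def)
  have "continuous_on S ?G" "continuous_on S ?H" using f by auto
  then have "continuous (at x) ?G" "continuous (at x) ?H"
    using S x by (auto simp: continuous_on_eq_continuous_at)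
  then obtain d1 d2 where d1: "0 < d1" "\<And>y. dist y x < d1 \<Longrightarrow> dist (?G y) (?G x) < e"
    and d2: "0 < d2" "\<And>y. dist y x < d2 \<Longrightarrow> dist (?H y) (?H x) < e"
    unfolding continuous_at_eps_delta using e by metis
  obtain d3 where d3: "0 < d3" "ball x d3 \<subseteq> S" using S x open_contains_ball by blast
  define d where "d = min d1 (min d2 d3)"
  have d: "0 < d" using d1 d2 d3 by (simp add: d_def)
  \<comment> \<open>This keeps the whole parallelogram with sides \<open>h u\<close> and
    \<open>h v\<close> within distance d/2 of \<open>x\<close>; the summand 1 covers the case that
    both directions vanish.\<close>
  define h where "h = d / (2 * (norm u + norm v + 1))"
  have pos: "0 < norm u + norm v + 1" by (meson add_nonneg_pos norm_ge_zero add_nonneg_nonneg zero_less_one)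
  then have h: "0 < h" using d by (simp add: h_def)
  have near: "dist (x + s *\<^sub>R u + t *\<^sub>R v) x < d" if "0 \<le> s" "s \<le> h" "0 \<le> t" "t \<le> h" for s t
  proof -
    have "norm (s *\<^sub>R u + t *\<^sub>R v) \<le> s * norm u + t * norm v"
      using norm_triangle_ineq[of "s *\<^sub>R u" "t *\<^sub>R v"] that by simp
    also have "\<dots> \<le> h * norm u + h * norm v"
      using that by (intro add_mono mult_right_mono) auto
    also have "\<dots> \<le> h * (norm u + norm v + 1)" using h by (simp add: algebra_simps)
    also have "\<dots> = d / 2" 
    proof -
      have "d / (2 * N) * N = d / 2" if "0 < N" for N using that by simp
      from this[OF pos] show ?thesis unfolding h_def .
    qed
    also have "\<dots> < d" using d by simp
    finally show ?thesis by (simp add: dist_norm)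
  qed
  have sub: "x + s *\<^sub>R u + t *\<^sub>R v \<in> S" "x + s *\<^sub>R v + t *\<^sub>R u \<in> S"
    if "0 \<le> s" "s \<le> h" "0 \<le> t" "t \<le> h" for s t
    using near[OF that] near[OF that(3,4,1,2)] d3(2)
    by (auto simp: d_def dist_commute subset_iff ac_simps)
  obtain s t where st: "0 < s" "s < h" "0 < t" "t < h"
    and G: "f (x + h *\<^sub>R u + h *\<^sub>R v) - f (x + h *\<^sub>R u) - f (x + h *\<^sub>R v) + f x = h * h * ?G (x + s *\<^sub>R u + t *\<^sub>R v)"
    using second_difference_mvt[OF S f h sub(1)] by blast
  obtain s' t' where st': "0 < s'" "s' < h" "0 < t'" "t' < h"
    and H: "f (x + h *\<^sub>R v + h *\<^sub>R u) - f (x + h *\<^sub>R v) - f (x + h *\<^sub>R u) + f x = h * h * ?H (x + s' *\<^sub>R v + t' *\<^sub>R u)"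
    using second_difference_mvt[OF S f h sub(2)] by blast
  have "h * h * ?G (x + s *\<^sub>R u + t *\<^sub>R v) = h * h * ?H (x + s' *\<^sub>R v + t' *\<^sub>R u)"
    unfolding G[symmetric] H[symmetric] by (simp add: ac_simps)
  then have eq: "?G (x + s *\<^sub>R u + t *\<^sub>R v) = ?H (x + t' *\<^sub>R u + s' *\<^sub>R v)"
    using h by (simp add: ac_simps)
  have "dist (?G (x + s *\<^sub>R u + t *\<^sub>R v)) (?G x) < e"
    using d1(2) near[of s t] st by (simp add: d_def)
  moreover have "dist (?H (x + t' *\<^sub>R u + s' *\<^sub>R v)) (?H x) < e"
    using d2(2) near[of t' s'] st' by (simp add: d_def)
  moreover have "\<not> (dist z a < \<bar>a - b\<bar> / 2 \<and> dist z b < \<bar>a - b\<bar> / 2)" for a b z :: real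
    using dist_triangle2[of a b z] by (simp add: dist_real_def abs_minus_commute)
  ultimately show False unfolding eq e_def by blast
qed

lemma frechet_derivative_component:
  fixes f :: "'a::real_normed_vector \<Rightarrow> real^'n"
  assumes "f differentiable at x"
  shows "frechet_derivative (\<lambda>y. f y $ k) (at x) v = frechet_derivative f (at x) v $ k"
proof -
  have "((\<lambda>y. f y $ k) has_derivative (\<lambda>v. frechet_derivative f (at x) v $ k)) (at x)"
    by (rule bounded_linear.has_derivative[OF bounded_linear_vec_nth])
      (use assms frechet_derivative_works in blast)
  then show ?thesis by (metis frechet_derivative_at)
qed

lemma smooth_on_differentiable: "open S \<Longrightarrow> smooth_on S f \<Longrightarrow> x \<in> S \<Longrightarrow> f differentiable at x"
  using smooth_on_has_derivative differentiableI by blast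

lemma second_derivative_symmetric:
  fixes f :: "'a::real_normed_vector \<Rightarrow> real^'n"
  assumes S: "open S" and f: "smooth_on S f" and x: "x \<in> S"
  shows "frechet_derivative (\<lambda>y. frechet_derivative f (at y) u) (at x) v =
    frechet_derivative (\<lambda>y. frechet_derivative f (at y) v) (at x) u"
proof -
  have *: "frechet_derivative (\<lambda>y. frechet_derivative f (at y) u) (at x) v $ k =
    frechet_derivative (\<lambda>y. frechet_derivative (\<lambda>y. f y $ k) (at y) u) (at x) v" for u v k
  proof -
    have "frechet_derivative (\<lambda>y. frechet_derivative f (at y) u) (at x) v $ k =
        frechet_derivative (\<lambda>y. frechet_derivative f (at y) u $ k) (at x) v"
      by (rule frechet_derivative_component[symmetric])
        (rule smooth_on_differentiable[OF S smooth_on_frechet_derivative[OF f] x])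
    also have "\<dots> = frechet_derivative (\<lambda>y. frechet_derivative (\<lambda>y. f y $ k) (at y) u) (at x) v"
      by (subst frechet_derivative_cong_open[OF S x, where g = "\<lambda>y. frechet_derivative (\<lambda>y. f y $ k) (at y) u"])
        (simp_all add: frechet_derivative_component smooth_on_differentiable[OF S f])
    finally show ?thesis .
  qed
  have "Ck_on (Suc (Suc 0)) S (\<lambda>y. f y $ k)" for k
    using smooth_on_component[OF S f] unfolding smooth_on_def by blast
  then show ?thesis
    unfolding vec_eq_iff * using second_derivative_symmetric_real[OF S _ x] by blast
qed

section \<open>Flat functions and bump functions\<close>

definition flat :: "nat \<Rightarrow> real \<Rightarrow> real" where
  "flat k t = (if 0 < t then inverse t ^ k / exp (inverse t) else 0)"

text \<open>The powers of 1/t in front of exp(-1/t) make the family closed under differentiation up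
  to linear combinations, which turns smoothness into an induction. Only t = 0 needs an argument:
  the difference quotient from the right is u^(k+1)/exp(u) with u = 1/t, which tends to 0.\<close>

lemma flat_has_derivative:
  "(flat k has_real_derivative (flat (k + 2) t - real k * flat (k + 1) t)) (at t)"
proof (cases t "0::real" rule: linorder_cases)
  case less
  have "((\<lambda>t. 0) has_real_derivative 0) (at t)" by simp
  then have "(flat k has_real_derivative 0) (at t)"
    by (rule has_field_derivative_transform_within_open[OF _ open_lessThan[of 0]]) (use less in \<open>auto simp: flat_def\<close>)
  then show ?thesis using less by (simp add: flat_def)
next
  case equal
  have "((\<lambda>h. flat k h / h) \<longlongrightarrow> 0) (at_right 0)"
  proof -
    have "((\<lambda>h. inverse h ^ Suc k / exp (inverse h)) \<longlongrightarrow> (0::real)) (at_right 0)"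
      by (rule filterlim_compose[OF tendsto_power_div_exp_0 filterlim_inverse_at_top_right])
    then show ?thesis
      by (rule Lim_transform_eventually)
        (auto simp: eventually_at_filter flat_def divide_inverse ac_simps)
  qed
  moreover have "((\<lambda>h. flat k h / h) \<longlongrightarrow> 0) (at_left 0)"
    by (rule tendsto_eventually) (auto simp: eventually_at_filter flat_def)
  ultimately have "((\<lambda>h. flat k h / h) \<longlongrightarrow> 0) (at 0)"
    by (simp add: filterlim_split_at)
  then show ?thesis using equal by (simp add: DERIV_def flat_def)
next
  case greater
  have "((\<lambda>t. inverse t ^ k / exp (inverse t)) has_real_derivative
      (flat (k + 2) t - real k * flat (k + 1) t)) (at t)"
  proof -
    have "((\<lambda>t. inverse t ^ k) has_real_derivative - real k * inverse t ^ (k + 1)) (at t)"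
      using DERIV_power[OF DERIV_inverse, of t k UNIV] greater by (cases k) (simp_all add: algebra_simps)
    moreover have "((\<lambda>t. exp (- inverse t)) has_real_derivative inverse t ^ 2 * exp (- inverse t)) (at t)"
      using greater by (auto intro!: derivative_eq_intros simp: power2_eq_square)
    ultimately have "((\<lambda>t. inverse t ^ k * exp (- inverse t)) has_real_derivative
        - real k * inverse t ^ (k + 1) * exp (- inverse t) + inverse t ^ 2 * exp (- inverse t) * inverse t ^ k) (at t)"
      by (rule DERIV_mult)
    then show ?thesis
      using greater by (simp add: flat_def exp_minus divide_inverse power_add power2_eq_square algebra_simps)
  qed
  then show ?thesis
    by (rule has_field_derivative_transform_within_open[OF _ open_greaterThan[of 0]]) (use greater in \<open>auto simp: flat_def\<close>)
qed

lemma smooth_on_flat: "smooth_on UNIV (flat k)"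
proof -
  have "Ck_on n UNIV (flat k)" for n
  proof (induction n arbitrary: k)
    case 0
    then show ?case
      using flat_has_derivative by (auto intro!: DERIV_continuous_on)
  next
    case (Suc n)
    show ?case
    proof (rule Ck_on_SucI[where f' = "\<lambda>t v. (flat (k + 2) t + (- real k) * flat (k + 1) t) * v"])
      show "(flat k has_derivative (*) (flat (k + 2) t + (- real k) * flat (k + 1) t)) (at t)" for t
        using flat_has_derivative[of k t] by (simp add: has_field_derivative_def)
          show "Ck_on n UNIV (\<lambda>t. (flat (k + 2) t + (- real k) * flat (k + 1) t) * v)" for v
        by (intro Ck_on_mult Ck_on_add Ck_on_const Suc.IH open_UNIV)
    qed simp
  qed
  then show ?thesis by (simp add: smooth_on_def)
qed

text \<open>The usual quotient p/(p + q): \<open>p\<close> is positive exactly inside radius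
  \<open>r\<close>, \<open>q\<close> exactly outside radius r/2, and these regions cover the space,
  so the denominator never vanishes. Squared distances are used since the distance itself is not
  smooth at \<open>x\<close>.\<close>

lemma smooth_bump:
  fixes x :: "'a::euclidean_space"
  assumes r: "0 < r"
  obtains h :: "'a \<Rightarrow> real" where "smooth_on UNIV h" "\<And>y. 0 \<le> h y" "\<And>y. h y \<le> 1"
    "\<And>y. dist x y < r / 2 \<Longrightarrow> h y = 1" "\<And>y. r \<le> dist x y \<Longrightarrow> h y = 0"
proof -
  define N where "N y = (y - x) \<bullet> (y - x)" for y
  define p where "p y = flat 0 (r\<^sup>2 - N y)" for y
  define q where "q y = flat 0 (N y - (r / 2)\<^sup>2)" for y
  have N: "N y = (dist x y)\<^sup>2" for y
    by (simp add: N_def dist_norm norm_minus_commute[of x] power2_norm_eq_inner)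
  have sq: "a\<^sup>2 \<le> b\<^sup>2 \<longleftrightarrow> a \<le> b" if "0 \<le> a" "0 \<le> b" for a b :: real
    using that by (meson power2_le_imp_le power_mono)
  have p: "0 \<le> p y" "p y = 0 \<longleftrightarrow> r \<le> dist x y" for y
    using r by (simp_all add: p_def flat_def N sq not_le[symmetric])
  have q: "0 \<le> q y" "q y = 0 \<longleftrightarrow> dist x y \<le> r / 2" for y
    using r sq[of "dist x y" "r / 2"] by (simp_all add: q_def flat_def N not_le[symmetric])
  have pos: "0 < p y + q y" for y
    using p[of y] q[of y] r by (smt (verit) field_sum_of_halves)
  have sN: "smooth_on UNIV N"
    unfolding N_def by (intro smooth_on_inner smooth_on_diff smooth_on_const smooth_on_id) auto
  have "smooth_on UNIV p" "smooth_on UNIV q"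
    unfolding p_def q_def
    by (rule smooth_on_compose[OF _ _ smooth_on_flat]; intro open_UNIV smooth_on_diff smooth_on_const sN subset_UNIV)+
  then have "smooth_on UNIV (\<lambda>y. p y / (p y + q y))"
    by (intro smooth_on_divide smooth_on_add open_UNIV) (use pos in \<open>auto simp: less_imp_neq[symmetric]\<close>)
  moreover have "0 \<le> p y / (p y + q y)" "p y / (p y + q y) \<le> 1" for y
    using p(1)[of y] q(1)[of y] pos[of y] by (auto simp: field_simps)
  moreover have "p y / (p y + q y) = 1" if "dist x y < r / 2" for y
    using q(2)[of y] pos[of y] that by auto
  moreover have "p y / (p y + q y) = 0" if "r \<le> dist x y" for y
    using p(2)[of y] that by auto
  ultimately show thesis by (rule that)
qed

section \<open>Charts and the exterior derivative\<close>

lemma eval2_congruence: "eval2 (transpose J ** F ** J) u v = eval2 F (J *v u) (J *v v)"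
  unfolding eval2_def matrix_vector_mul_assoc[symmetric]
  by (metis dot_lmul_matrix inner_commute vector_transpose_matrix transpose_transpose transpose_matrix_vector)

lemma eval2_axis: "eval2 F (axis i 1) (axis j 1) = F $ i $ j"
  by (simp add: eval2_def inner_axis' matrix_vector_mult_basis column_def)

lemma eval2_eqI:
  assumes "\<And>u v. eval2 F u v = eval2 G u v"
  shows "F = G"
  using assms eval2_axis by (metis vec_eq_iff)

locale smooth_manifold =
  fixes A :: "'a::{t2_space, second_countable_topology} chart set"
  assumes atlas: "smooth_atlas A"
begin

section \<open>Charts and the Jacobians of their transitions\<close>

lemma chart_at: "chart_at A p \<in> A" "p \<in> fst (chart_at A p)"
proof -
  have "p \<in> (\<Union>c\<in>A. fst c)" using atlas by (simp add: smooth_atlas_def)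
  then have "\<exists>c. c \<in> A \<and> p \<in> fst c" by blast
  from someI_ex[OF this] show "chart_at A p \<in> A" "p \<in> fst (chart_at A p)"
    by (simp_all add: chart_at_def)
qed

context
  fixes c assumes c: "c \<in> A"
begin

lemma is_chart: "is_chart c"
  using atlas c by (simp add: smooth_atlas_def)

lemma open_chart_dom: "open (fst c)"
  using is_chart by (simp add: is_chart_def)

lemma inj_on_chart: "inj_on (snd c) (fst c)"
  using is_chart unfolding is_chart_def homeomorphism_def by (metis inj_on_inverseI)

lemma chart_inv_chart [simp]: "q \<in> fst c \<Longrightarrow> chart_inv c (snd c q) = q"
  by (simp add: chart_inv_def inj_on_chart)

lemma continuous_on_chart: "continuous_on (fst c) (snd c)"
  using is_chart unfolding is_chart_def homeomorphism_def by blast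

lemma continuous_on_chart_inv: "continuous_on (snd c ` fst c) (chart_inv c)"
  using is_chart unfolding is_chart_def homeomorphism_def chart_inv_def by blast

lemma open_chart_image:
  assumes "open U" "U \<subseteq> fst c"
  shows "open (snd c ` U)"
proof -
  have "homeomorphism (fst c) (snd c ` fst c) (snd c) (chart_inv c)" and o: "open (snd c ` fst c)"
    using is_chart by (simp_all add: is_chart_def chart_inv_def)
  then have "openin (top_of_set (snd c ` fst c)) (snd c ` U)"
    using assms homeomorphism_imp_open_map open_openin_trans open_subset by metis
  then show ?thesis using o openin_open_trans by blast
qed

lemma open_chart_image_Int: "open U \<Longrightarrow> open (snd c ` (U \<inter> fst c))"
  by (rule open_chart_image) (auto simp: open_chart_dom open_Int)

lemma open_chart_vimage:
  assumes "open T"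
  shows "open {q \<in> fst c. snd c q \<in> T}"
proof -
  have "open (fst c \<inter> snd c -` T)"
    using continuous_open_preimage[OF continuous_on_chart open_chart_dom assms] .
  then show ?thesis by (simp add: Int_def vimage_def)
qed

end

lemma smooth_on_transition:
  assumes "c \<in> A" "c' \<in> A"
  shows "smooth_on (snd c ` (fst c \<inter> fst c')) (snd c' \<circ> chart_inv c)"
  using atlas assms by (simp add: smooth_atlas_def)

lemma open_overlap:
  assumes "c \<in> A" "c' \<in> A" "open U"
  shows "open (snd c ` (U \<inter> fst c \<inter> fst c'))"
  using open_chart_image_Int[of c "U \<inter> fst c'"] assms open_chart_dom
  by (simp add: open_Int Int_ac)

lemma transition_has_derivative:
  assumes "c \<in> A" "c' \<in> A" "q \<in> fst c" "q \<in> fst c'"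
  shows "((snd c' \<circ> chart_inv c) has_derivative (\<lambda>v. chart_jac c c' q *v v)) (at (snd c q))"
proof -
  have "(snd c' \<circ> chart_inv c) differentiable at (snd c q)"
    using smooth_on_differentiable[OF _ smooth_on_transition[OF assms(1,2)]] assms
      open_overlap[OF assms(1,2) open_UNIV] by simp
  then show ?thesis unfolding chart_jac_def using jacobian_works by blast
qed

lemma chart_jac_column:
  assumes "c \<in> A" "c' \<in> A" "q \<in> fst c" "q \<in> fst c'"
  shows "frechet_derivative (snd c' \<circ> chart_inv c) (at (snd c q)) v = chart_jac c c' q *v v"
  using frechet_derivative_at[OF transition_has_derivative[OF assms]] by metis

lemma has_derivative_matrix_unique:
  fixes f :: "real^'n \<Rightarrow> real^'m"
  assumes "(f has_derivative (\<lambda>v. M *v v)) (at x)" "(f has_derivative (\<lambda>v. N *v v)) (at x)"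
  shows "M = N"
  using has_derivative_unique[OF assms] by (metis matrix_eq)

lemma chart_jac_cocycle:
  assumes A: "c \<in> A" "c' \<in> A" "c'' \<in> A" and q: "q \<in> fst c" "q \<in> fst c'" "q \<in> fst c''"
  shows "chart_jac c c'' q = chart_jac c' c'' q ** chart_jac c c' q"
proof (rule has_derivative_matrix_unique[OF transition_has_derivative[OF A(1,3) q(1,3)]])
  let ?T = "snd c ` (UNIV \<inter> fst c \<inter> fst c')"
  have eq: "(snd c' \<circ> chart_inv c) (snd c q) = snd c' q" using A q by simp
  have "((snd c'' \<circ> chart_inv c') \<circ> (snd c' \<circ> chart_inv c) has_derivative
      (\<lambda>v. chart_jac c' c'' q *v v) \<circ> (\<lambda>v. chart_jac c c' q *v v)) (at (snd c q))"
    by (rule diff_chain_at[OF transition_has_derivative[OF A(1,2) q(1,2)]])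
      (unfold eq, rule transition_has_derivative[OF A(2,3) q(2,3)])
  then have "((snd c'' \<circ> chart_inv c') \<circ> (snd c' \<circ> chart_inv c) has_derivative
      (\<lambda>v. (chart_jac c' c'' q ** chart_jac c c' q) *v v)) (at (snd c q))"
    by (simp only: comp_def matrix_vector_mul_assoc)
  then show "((snd c'' \<circ> chart_inv c) has_derivative
      (\<lambda>v. (chart_jac c' c'' q ** chart_jac c c' q) *v v)) (at (snd c q))"
    by (rule has_derivative_transform_within_open[OF _ open_overlap[OF A(1,2) open_UNIV]])
      (use A q in auto)
qed

lemma chart_jac_refl:
  assumes A: "c \<in> A" and q: "q \<in> fst c"
  shows "chart_jac c c q = mat 1"
proof (rule has_derivative_matrix_unique[OF transition_has_derivative[OF A A q q]])
  have "(*v) (mat 1 :: real^4^4) = (\<lambda>v. v)" by (simp add: fun_eq_iff)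
  then have "((\<lambda>x. x) has_derivative (*v) (mat 1 :: real^4^4)) (at (snd c q))" by simp
  then show "((snd c \<circ> chart_inv c) has_derivative (*v) (mat 1)) (at (snd c q))"
    by (rule has_derivative_transform_within_open[OF _ open_chart_image_Int[OF A open_UNIV]])
      (use A q open_chart_image_Int[OF A open_UNIV] in auto)
qed

lemma invertible_chart_jac:
  assumes "c \<in> A" "c' \<in> A" "q \<in> fst c" "q \<in> fst c'"
  shows "invertible (chart_jac c c' q)"
  unfolding invertible_def
  using chart_jac_cocycle[of c c' c q] chart_jac_cocycle[of c' c c' q] chart_jac_refl assms by metis

lemma form_rep_chart:
  "c \<in> A \<Longrightarrow> q \<in> fst c \<Longrightarrow> form_rep A \<alpha> c (snd c q) = \<alpha> q v* chart_jac c (chart_at A q) q"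
  by (simp add: form_rep_def)

lemma form_rep_change:
  assumes "c \<in> A" "c' \<in> A" "q \<in> fst c" "q \<in> fst c'"
  shows "form_rep A \<alpha> c (snd c q) = form_rep A \<alpha> c' (snd c' q) v* chart_jac c c' q"
  using assms chart_at[of q]
  by (simp add: form_rep_chart vector_matrix_mul_assoc chart_jac_cocycle[of c c' "chart_at A q"])

section \<open>The exterior derivative in coordinates and its naturality\<close>

definition coord_d :: "(real^4 \<Rightarrow> real^4) \<Rightarrow> real^4 \<Rightarrow> real^4^4" where
  "coord_d r x = (\<chi> i j. partial i r x $ j - partial j r x $ i)"

text \<open>This replaces the index formula by directional derivatives, for which a change of
  coordinates can be computed by the chain rule.\<close>

lemma eval2_coord_d:
  assumes "r differentiable at x"
  shows "eval2 (coord_d r x) u v = frechet_derivative r (at x) u \<bullet> v - frechet_derivative r (at x) v \<bullet> u"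
proof -
  define G :: "real^4^4" where "G = (\<chi> i j. partial i r x $ j)"
  have lin: "linear (frechet_derivative r (at x))"
    using assms linear_frechet_derivative by blast
  have fd: "frechet_derivative r (at x) w = w v* G" for w
  proof -
    have "frechet_derivative r (at x) w = frechet_derivative r (at x) (\<Sum>i\<in>UNIV. w $ i *\<^sub>R axis i 1)"
      using basis_expansion[of w] by (simp add: scalar_mult_eq_scaleR)
    also have "\<dots> = (\<Sum>i\<in>UNIV. w $ i *\<^sub>R partial i r x)"
      by (simp add: linear_sum[OF lin] linear_cmul[OF lin] partial_def)
    also have "\<dots> = w v* G"
      by (simp add: vec_eq_iff vector_matrix_mult_def G_def mult.commute)
    finally show ?thesis .
  qed
  have "coord_d r x = G - transpose G"
    by (simp add: coord_d_def G_def vec_eq_iff transpose_def)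
  then have "eval2 (coord_d r x) u v = u \<bullet> (G *v v) - u \<bullet> (v v* G)"
    by (simp add: eval2_def matrix_vector_mult_diff_rdistrib inner_diff_right)
  then show ?thesis
    by (simp only: fd dot_lmul_matrix[of u G v] inner_commute[of u "v v* G"])
qed

lemma ext_d_eq_coord_d: "ext_d A \<alpha> p = coord_d (form_rep A \<alpha> (chart_at A p)) (snd (chart_at A p) p)"
  by (simp add: ext_d_def coord_d_def Let_def)

lemma form_rep_differentiable:
  assumes "open U" "smooth_form A U \<alpha>" "c \<in> A" "q \<in> U" "q \<in> fst c"
  shows "form_rep A \<alpha> c differentiable at (snd c q)"
  using assms smooth_on_differentiable[OF open_chart_image_Int]
  unfolding smooth_form_def by blast

text \<open>Differentiating \<open>r y \<bullet> z = r' (\<tau> y) \<bullet> D\<tau>(y) z\<close> in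
  direction \<open>w\<close> gives the pulled-back derivative plus a term with the second derivative
  of the transition map \<open>\<tau>\<close>. That term is symmetric in \<open>w\<close> and
  \<open>z\<close> and cancels under antisymmetrization.\<close>

lemma coord_d_change:
  assumes U: "open U" and \<alpha>: "smooth_form A U \<alpha>" and A: "c \<in> A" "c' \<in> A"
    and q: "q \<in> U" "q \<in> fst c" "q \<in> fst c'"
  shows "coord_d (form_rep A \<alpha> c) (snd c q) =
    transpose (chart_jac c c' q) ** coord_d (form_rep A \<alpha> c') (snd c' q) ** chart_jac c c' q"
proof (rule eval2_eqI)
  fix u v
  define \<tau> where "\<tau> = snd c' \<circ> chart_inv c"
  define r where "r = form_rep A \<alpha> c"
  define r' where "r' = form_rep A \<alpha> c'"
  define x where "x = snd c q"
  define T where "T = snd c ` (U \<inter> fst c \<inter> fst c')"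
  have T: "open T" "x \<in> T" using open_overlap[OF A U] q by (auto simp: T_def x_def)
  have \<tau>x: "\<tau> x = snd c' q" using A q by (simp add: \<tau>_def x_def)
  have sm\<tau>: "smooth_on T \<tau>"
    unfolding \<tau>_def T_def by (rule smooth_on_subset[OF smooth_on_transition[OF A]]) auto
  have d\<tau>: "(\<tau> has_derivative frechet_derivative \<tau> (at x)) (at x)"
    by (rule smooth_on_has_derivative[OF T(1) sm\<tau> T(2)])
  have dr: "r differentiable at x"
    unfolding r_def x_def by (rule form_rep_differentiable[OF U \<alpha> A(1) q(1,2)])
  have dr': "(r' has_derivative frechet_derivative r' (at (\<tau> x))) (at (\<tau> x))"
    unfolding r'_def \<tau>x using form_rep_differentiable[OF U \<alpha> A(2) q(1,3)] frechet_derivative_works by blast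
  have rr': "r y \<bullet> w = r' (\<tau> y) \<bullet> frechet_derivative \<tau> (at y) w" if y: "y \<in> T" for y w
  proof -
    obtain p where p: "p \<in> U" "p \<in> fst c" "p \<in> fst c'" "y = snd c p" using y by (auto simp: T_def)
    show ?thesis
      unfolding r_def r'_def \<tau>_def p(4) form_rep_change[OF A p(2,3)] chart_jac_column[OF A p(2,3)]
      using A p by (simp add: dot_lmul_matrix)
  qed
  have key: "frechet_derivative r (at x) w \<bullet> z =
      r' (\<tau> x) \<bullet> frechet_derivative (\<lambda>y. frechet_derivative \<tau> (at y) z) (at x) w +
      frechet_derivative r' (at (\<tau> x)) (frechet_derivative \<tau> (at x) w) \<bullet> frechet_derivative \<tau> (at x) z" for w z
  proof -
    have d1: "((\<lambda>y. r y \<bullet> z) has_derivative (\<lambda>w. frechet_derivative r (at x) w \<bullet> z)) (at x)"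
      using dr frechet_derivative_works by (blast intro: has_derivative_inner_left)
    have "((\<lambda>y. r' (\<tau> y)) has_derivative (\<lambda>w. frechet_derivative r' (at (\<tau> x)) (frechet_derivative \<tau> (at x) w))) (at x)"
      by (rule has_derivative_compose[OF d\<tau> dr'])
    moreover have "((\<lambda>y. frechet_derivative \<tau> (at y) z) has_derivative
        frechet_derivative (\<lambda>y. frechet_derivative \<tau> (at y) z) (at x)) (at x)"
      by (rule smooth_on_has_derivative[OF T(1) smooth_on_frechet_derivative[OF sm\<tau>] T(2)])
    ultimately have "((\<lambda>y. r' (\<tau> y) \<bullet> frechet_derivative \<tau> (at y) z) has_derivative
      (\<lambda>w. r' (\<tau> x) \<bullet> frechet_derivative (\<lambda>y. frechet_derivative \<tau> (at y) z) (at x) w +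
      frechet_derivative r' (at (\<tau> x)) (frechet_derivative \<tau> (at x) w) \<bullet> frechet_derivative \<tau> (at x) z)) (at x)"
      by (rule has_derivative_inner)
    then have "((\<lambda>y. r y \<bullet> z) has_derivative
      (\<lambda>w. r' (\<tau> x) \<bullet> frechet_derivative (\<lambda>y. frechet_derivative \<tau> (at y) z) (at x) w +
      frechet_derivative r' (at (\<tau> x)) (frechet_derivative \<tau> (at x) w) \<bullet> frechet_derivative \<tau> (at x) z)) (at x)"
      by (rule has_derivative_transform_within_open[OF _ T]) (simp add: rr')
    from has_derivative_unique[OF d1 this] show ?thesis by metis
  qed
  have "eval2 (coord_d r x) u v = frechet_derivative r (at x) u \<bullet> v - frechet_derivative r (at x) v \<bullet> u"
    by (rule eval2_coord_d[OF dr])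
  also have "\<dots> = eval2 (coord_d r' (\<tau> x)) (frechet_derivative \<tau> (at x) u) (frechet_derivative \<tau> (at x) v)"
    unfolding key second_derivative_symmetric[OF T(1) sm\<tau> T(2), of u v]
    by (subst eval2_coord_d) (use dr' differentiableI in auto)
  also have "\<dots> = eval2 (transpose (chart_jac c c' q) ** coord_d r' (\<tau> x) ** chart_jac c c' q) u v"
    using chart_jac_column[OF A q(2,3)] by (simp add: eval2_congruence \<tau>_def x_def)
  finally show "eval2 (coord_d (form_rep A \<alpha> c) (snd c q)) u v = eval2 (transpose (chart_jac c c' q) **
      coord_d (form_rep A \<alpha> c') (snd c' q) ** chart_jac c c' q) u v"
    by (simp add: r_def r'_def x_def \<tau>x[unfolded x_def])
qed

lemma form_rep_cong_open:
  assumes "open U" "\<And>q. q \<in> U \<Longrightarrow> \<alpha> q = \<beta> q" "c \<in> A" "x \<in> snd c ` (U \<inter> fst c)"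
  shows "form_rep A \<alpha> c x = form_rep A \<beta> c x"
  using assms by (auto simp: form_rep_chart)

lemma ext_d_cong_open:
  assumes "open U" "q \<in> U" "\<And>q. q \<in> U \<Longrightarrow> \<alpha> q = \<beta> q"
  shows "ext_d A \<alpha> q = ext_d A \<beta> q"
proof -
  let ?c = "chart_at A q"
  have "snd ?c q \<in> snd ?c ` (U \<inter> fst ?c)" using chart_at(2) assms(2) by blast
  then have "frechet_derivative (form_rep A \<alpha> ?c) (at (snd ?c q)) =
      frechet_derivative (form_rep A \<beta> ?c) (at (snd ?c q))"
    by (rule frechet_derivative_cong_open[OF open_chart_image_Int[OF chart_at(1) assms(1)]])
      (rule form_rep_cong_open[OF assms(1,3) chart_at(1)])
  then show ?thesis by (simp add: ext_d_eq_coord_d coord_d_def partial_def)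
qed

text \<open>The covector \<open>\<eta>\<close> is \<open>df\<close>; it stays unspecified, since the rule is only applied modulo \<open>\<beta>\<close>.\<close>

lemma ext_d_add_scaleR:
  assumes U: "open U" and \<alpha>: "smooth_form A U \<alpha>" and \<beta>: "smooth_form A U \<beta>" and f: "smooth_fun A U f"
    and q: "q \<in> U"
  obtains \<eta> where "ext_d A (\<lambda>q. \<alpha> q + f q *\<^sub>R \<beta> q) q = ext_d A \<alpha> q + f q *\<^sub>R ext_d A \<beta> q + \<eta> \<and>\<^sub>f \<beta> q"
proof -
  define c where "c = chart_at A q"
  have c: "c \<in> A" "q \<in> fst c" unfolding c_def by (rule chart_at)+
  define x where "x = snd c q"
  let ?S = "snd c ` (U \<inter> fst c)"
  have S: "open ?S" "x \<in> ?S" using open_chart_image_Int[OF c(1) U] c q by (auto simp: x_def)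
  let ?a = "form_rep A \<alpha> c" and ?b = "form_rep A \<beta> c" and ?f = "f \<circ> chart_inv c"
  have da: "(?a has_derivative frechet_derivative ?a (at x)) (at x)"
    using \<alpha> c(1) S smooth_on_has_derivative unfolding smooth_form_def by blast
  have db: "(?b has_derivative frechet_derivative ?b (at x)) (at x)"
    using \<beta> c(1) S smooth_on_has_derivative unfolding smooth_form_def by blast
  have df: "(?f has_derivative frechet_derivative ?f (at x)) (at x)"
    using f c(1) S smooth_on_has_derivative unfolding smooth_fun_def by blast
  have rep: "form_rep A (\<lambda>q. \<alpha> q + f q *\<^sub>R \<beta> q) c = (\<lambda>y. ?a y + ?f y *\<^sub>R ?b y)"
    by (simp add: fun_eq_iff form_rep_def Let_def vec.add vector_matrix_left_distrib scaleR_vector_matrix_assoc)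
  have fx: "?f x = f q" using c by (simp add: x_def)
  have bx: "?b x = \<beta> q"
    using c chart_jac_refl[OF c] by (simp add: x_def form_rep_chart flip: c_def)
  have "((\<lambda>y. ?a y + ?f y *\<^sub>R ?b y) has_derivative (\<lambda>v. frechet_derivative ?a (at x) v +
      (?f x *\<^sub>R frechet_derivative ?b (at x) v + frechet_derivative ?f (at x) v *\<^sub>R ?b x))) (at x)"
    by (intro has_derivative_add da has_derivative_scaleR df db)
  then have fd: "frechet_derivative (form_rep A (\<lambda>q. \<alpha> q + f q *\<^sub>R \<beta> q) c) (at x) =
      (\<lambda>v. frechet_derivative ?a (at x) v +
      (f q *\<^sub>R frechet_derivative ?b (at x) v + frechet_derivative ?f (at x) v *\<^sub>R \<beta> q))"
    unfolding rep fx bx by (rule frechet_derivative_at[symmetric])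
  have p: "partial i (form_rep A (\<lambda>q. \<alpha> q + f q *\<^sub>R \<beta> q) c) x =
      partial i ?a x + f q *\<^sub>R partial i ?b x + frechet_derivative ?f (at x) (axis i 1) *\<^sub>R \<beta> q" for i
    by (simp add: partial_def fd add.assoc)
  have "ext_d A (\<lambda>q. \<alpha> q + f q *\<^sub>R \<beta> q) q = ext_d A \<alpha> q + f q *\<^sub>R ext_d A \<beta> q +
      (\<chi> i. frechet_derivative ?f (at x) (axis i 1)) \<and>\<^sub>f \<beta> q"
    unfolding ext_d_eq_coord_d coord_d_def c_def[symmetric] x_def[symmetric] p wedge_def
    by (simp add: vec_eq_iff algebra_simps)
  then show thesis by (rule that)
qed

end

section \<open>Smooth forms, dual frames and gluing\<close>

definition dual_vec :: "real^4^4 \<Rightarrow> 4 \<Rightarrow> real^4" where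
  "dual_vec W i = matrix_inv W *v axis i 1"

lemma coframe_mult_dual_vec: "invertible W \<Longrightarrow> W *v dual_vec W i = axis i 1"
  by (simp add: dual_vec_def matrix_vector_mul_assoc matrix_inv_inverse)

lemma inner_dual_vec [simp]: "invertible W \<Longrightarrow> W $ j \<bullet> dual_vec W i = (if i = j then 1 else 0)"
  using coframe_mult_dual_vec[of W i] by (auto simp: vec_eq_iff matrix_vector_mul_component axis_def)

text \<open>A coframe with matrix \<open>W\<close> in the preferred chart has matrix
  \<open>W ** J\<close> in another chart, and the dual vectors transform the opposite way. This
  links dual vectors across charts.\<close>

lemma dual_vec_mult:
  assumes "invertible W" "invertible J"
  shows "J *v dual_vec (W ** J) i = dual_vec W i"
proof -
  have "W *v (J *v dual_vec (W ** J) i) = axis i 1"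
    using coframe_mult_dual_vec[OF invertible_mult[OF assms]] by (simp add: matrix_vector_mul_assoc)
  then have "matrix_inv W *v (W *v (J *v dual_vec (W ** J) i)) = dual_vec W i"
    by (simp add: dual_vec_def)
  then show ?thesis
    using matrix_inv_inverse(2)[OF assms(1)] by (simp only: matrix_vector_mul_assoc[of "matrix_inv W"] matrix_vector_mul_lid)
qed

lemma row_matrix_mult: "(W ** J) $ i = W $ i v* J"
  by (simp add: matrix_matrix_mult_def vector_matrix_mult_def vec_eq_iff mult.commute)

context smooth_manifold
begin

section \<open>Smooth functions, forms and dual frames on open subsets\<close>

lemma smooth_fun_subset: "smooth_fun A U f \<Longrightarrow> V \<subseteq> U \<Longrightarrow> smooth_fun A V f"
  unfolding smooth_fun_def by (meson Int_mono image_mono order_refl smooth_on_subset)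

lemma smooth_form_subset: "smooth_form A U f \<Longrightarrow> V \<subseteq> U \<Longrightarrow> smooth_form A V f"
  unfolding smooth_form_def by (meson Int_mono image_mono order_refl smooth_on_subset)

lemma smooth_form_local:
  assumes "\<And>p. p \<in> U \<Longrightarrow> \<exists>V. open V \<and> p \<in> V \<and> smooth_form A V \<alpha>"
  shows "smooth_form A U \<alpha>"
  unfolding smooth_form_def
proof (intro ballI smooth_on_local)
  fix c x assume c: "c \<in> A" and "x \<in> snd c ` (U \<inter> fst c)"
  then obtain p where p: "p \<in> U" "p \<in> fst c" "x = snd c p" by blast
  then obtain V where "open V" "p \<in> V" "smooth_form A V \<alpha>" using assms by blast
  then show "\<exists>T. open T \<and> x \<in> T \<and> smooth_on T (form_rep A \<alpha> c)"
    using c p open_chart_image_Int[OF c] by (intro exI[of _ "snd c ` (V \<inter> fst c)"]) (auto simp: smooth_form_def)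
qed

lemma smooth_form_cong:
  assumes "open U" "\<And>q. q \<in> U \<Longrightarrow> \<alpha> q = \<beta> q" "smooth_form A U \<alpha>"
  shows "smooth_form A U \<beta>"
  unfolding smooth_form_def
proof
  fix c assume c: "c \<in> A"
  show "smooth_on (snd c ` (U \<inter> fst c)) (form_rep A \<beta> c)"
    by (rule smooth_on_cong[OF open_chart_image_Int[OF c assms(1)] form_rep_cong_open[OF assms(1,2) c]])
      (use assms(3) c in \<open>auto simp: smooth_form_def\<close>)
qed

context
  fixes U :: "'a set" assumes U: "open U"
begin

lemma smooth_fun_const: "smooth_fun A U (\<lambda>q. k)"
  using open_chart_image_Int[OF _ U] by (auto simp: smooth_fun_def comp_def intro: smooth_on_const)

lemma smooth_fun_add: "smooth_fun A U f \<Longrightarrow> smooth_fun A U g \<Longrightarrow> smooth_fun A U (\<lambda>q. f q + g q)"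
  using open_chart_image_Int[OF _ U] by (auto simp: smooth_fun_def comp_def intro: smooth_on_add)

lemma smooth_fun_diff: "smooth_fun A U f \<Longrightarrow> smooth_fun A U g \<Longrightarrow> smooth_fun A U (\<lambda>q. f q - g q)"
  using open_chart_image_Int[OF _ U] by (auto simp: smooth_fun_def comp_def intro: smooth_on_diff)

lemma smooth_fun_mult: "smooth_fun A U f \<Longrightarrow> smooth_fun A U g \<Longrightarrow> smooth_fun A U (\<lambda>q. f q * g q)"
  using open_chart_image_Int[OF _ U] by (auto simp: smooth_fun_def comp_def intro: smooth_on_mult)

lemma smooth_fun_minus: "smooth_fun A U f \<Longrightarrow> smooth_fun A U (\<lambda>q. - f q)"
  using open_chart_image_Int[OF _ U] by (auto simp: smooth_fun_def comp_def intro: smooth_on_minus)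

lemma smooth_fun_prod:
  "(\<And>i. i \<in> I \<Longrightarrow> smooth_fun A U (f i)) \<Longrightarrow> smooth_fun A U (\<lambda>q. \<Prod>i\<in>I. f i q)"
  using open_chart_image_Int[OF _ U] by (auto simp: smooth_fun_def comp_def intro!: smooth_on_prod)

lemma smooth_fun_divide:
  assumes "smooth_fun A U f" "smooth_fun A U g" "\<And>q. q \<in> U \<Longrightarrow> g q \<noteq> 0"
  shows "smooth_fun A U (\<lambda>q. f q / g q)"
  unfolding smooth_fun_def comp_def
proof (intro ballI smooth_on_divide open_chart_image_Int U)
  fix c assume c: "c \<in> A"
  show "smooth_on (snd c ` (U \<inter> fst c)) (\<lambda>x. f (chart_inv c x))"
    "smooth_on (snd c ` (U \<inter> fst c)) (\<lambda>x. g (chart_inv c x))"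
    using assms(1,2) c by (simp_all add: smooth_fun_def comp_def)
  show "g (chart_inv c x) \<noteq> 0" if "x \<in> snd c ` (U \<inter> fst c)" for x
    using that assms(3) chart_inv_chart[OF c] by fastforce
qed

lemma smooth_form_zero: "smooth_form A U (\<lambda>q. 0)"
proof -
  have "form_rep A (\<lambda>q. 0) c = (\<lambda>x. 0)" for c
    by (simp add: form_rep_def fun_eq_iff)
  then show ?thesis
    using open_chart_image_Int[OF _ U] by (auto simp: smooth_form_def intro: smooth_on_const)
qed

lemma smooth_form_add:
  assumes "smooth_form A U \<alpha>" "smooth_form A U \<beta>"
  shows "smooth_form A U (\<lambda>q. \<alpha> q + \<beta> q)"
proof -
  have "form_rep A (\<lambda>q. \<alpha> q + \<beta> q) c = (\<lambda>x. form_rep A \<alpha> c x + form_rep A \<beta> c x)" for c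
    by (simp add: form_rep_def fun_eq_iff Let_def vector_matrix_left_distrib)
  then show ?thesis
    using open_chart_image_Int[OF _ U] assms by (auto simp: smooth_form_def intro: smooth_on_add)
qed

lemma smooth_form_scaleR:
  assumes "smooth_fun A U f" "smooth_form A U \<beta>"
  shows "smooth_form A U (\<lambda>q. f q *\<^sub>R \<beta> q)"
proof -
  have "form_rep A (\<lambda>q. f q *\<^sub>R \<beta> q) c = (\<lambda>x. (f \<circ> chart_inv c) x *\<^sub>R form_rep A \<beta> c x)" for c
    by (simp add: form_rep_def fun_eq_iff Let_def scaleR_vector_matrix_assoc)
  then show ?thesis
    using open_chart_image_Int[OF _ U] assms
    by (auto simp: smooth_form_def smooth_fun_def simp del: comp_apply intro!: smooth_on_scaleR)
qed

lemma smooth_form_diff: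
  assumes "smooth_form A U \<alpha>" "smooth_form A U \<beta>"
  shows "smooth_form A U (\<lambda>q. \<alpha> q - \<beta> q)"
  using smooth_form_add[OF assms(1) smooth_form_scaleR[OF smooth_fun_const[of "-1"] assms(2)]] by simp

lemma smooth_form_sum:
  "(\<And>i. i \<in> I \<Longrightarrow> smooth_form A U (\<alpha> i)) \<Longrightarrow> smooth_form A U (\<lambda>q. \<Sum>i\<in>I. \<alpha> i q)"
  by (induction I rule: infinite_finite_induct) (auto intro: smooth_form_zero smooth_form_add)

context
  fixes W assumes W: "coframing A U W"
begin

text \<open>The functions \<open>d i\<close> are the components of the dual frame in the fixed chart
  \<open>c\<close>. They are columns of the inverse of the matrix whose rows are the representatives
  of the coframe in \<open>c\<close>, hence smooth.\<close>

lemma dual_vec_chart: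
  assumes c: "c \<in> A"
  obtains d where "\<And>i. smooth_on (snd c ` (U \<inter> fst c)) (d i)"
    "\<And>i q. q \<in> U \<Longrightarrow> q \<in> fst c \<Longrightarrow> dual_vec (W q) i = chart_jac c (chart_at A q) q *v d i (snd c q)"
proof
  let ?S = "snd c ` (U \<inter> fst c)"
  define M where "M y = (\<chi> i. form_rep A (\<lambda>q. W q $ i) c y)" for y
  have S: "open ?S" by (rule open_chart_image_Int[OF c U])
  have M: "M (snd c q) = W q ** chart_jac c (chart_at A q) q" if "q \<in> fst c" for q
    using that by (simp add: M_def vec_eq_iff row_matrix_mult form_rep_chart[OF c])
  have J: "invertible (chart_jac c (chart_at A q) q)" if "q \<in> fst c" for q
    using c that chart_at by (simp add: invertible_chart_jac)
  have inv: "invertible (M y)" if "y \<in> ?S" for y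
    using that W J by (auto simp: M coframing_def invertible_mult)
  have "smooth_on ?S (\<lambda>y. M y $ i $ j)" for i j
    using W c unfolding M_def coframing_def smooth_form_def by (auto intro: smooth_on_component S)
  then have "smooth_on ?S (\<lambda>y. matrix_inv (M y) $ k $ i)" for k i
    by (intro smooth_on_matrix_inv S inv)
  then show "smooth_on ?S (\<lambda>y. dual_vec (M y) i)" for i
    by (intro smooth_on_vec S) (simp add: dual_vec_def matrix_vector_mult_basis column_def)
  show "dual_vec (W q) i = chart_jac c (chart_at A q) q *v dual_vec (M (snd c q)) i"
    if "q \<in> U" "q \<in> fst c" for i q
    using that W J by (simp add: M dual_vec_mult coframing_def)
qed

text \<open>Parameters of a change between two sections are contractions of this kind, and this
  makes them smooth. The pairing does not depend on the chart, so it may be computed in a fixed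
  one.\<close>

lemma smooth_fun_inner_dual_vec:
  assumes \<alpha>: "smooth_form A U \<alpha>"
  shows "smooth_fun A U (\<lambda>q. \<alpha> q \<bullet> dual_vec (W q) i)"
  unfolding smooth_fun_def
proof
  fix c assume c: "c \<in> A"
  let ?S = "snd c ` (U \<inter> fst c)"
  have S: "open ?S" by (rule open_chart_image_Int[OF c U])
  obtain d where d: "\<And>i. smooth_on ?S (d i)"
    "\<And>i q. q \<in> U \<Longrightarrow> q \<in> fst c \<Longrightarrow> dual_vec (W q) i = chart_jac c (chart_at A q) q *v d i (snd c q)"
    using dual_vec_chart[OF c] by blast
  have "smooth_on ?S (\<lambda>y. form_rep A \<alpha> c y \<bullet> d i y)"
    using \<alpha> c by (intro smooth_on_inner S d(1)) (simp add: smooth_form_def)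
  then show "smooth_on ?S ((\<lambda>q. \<alpha> q \<bullet> dual_vec (W q) i) \<circ> chart_inv c)"
    by (rule smooth_on_cong[OF S, rotated]) (use c in \<open>auto simp: form_rep_chart d(2) dot_lmul_matrix\<close>)
qed

text \<open>This yields the smoothness of all coefficients in the structure equations.
  \<open>ext_d\<close> is computed at each point in the preferred chart there;
  \<open>coord_d_change\<close> trades it for the derivative in one fixed chart, where everything is
  smooth.\<close>

lemma smooth_fun_ext_d:
  assumes \<alpha>: "smooth_form A U \<alpha>"
  shows "smooth_fun A U (\<lambda>q. eval2 (ext_d A \<alpha> q) (dual_vec (W q) i) (dual_vec (W q) j))"
  unfolding smooth_fun_def
proof
  fix c assume c: "c \<in> A"
  let ?S = "snd c ` (U \<inter> fst c)"
  have S: "open ?S" by (rule open_chart_image_Int[OF c U])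
  obtain d where d: "\<And>i. smooth_on ?S (d i)"
    "\<And>i q. q \<in> U \<Longrightarrow> q \<in> fst c \<Longrightarrow> dual_vec (W q) i = chart_jac c (chart_at A q) q *v d i (snd c q)"
    using dual_vec_chart[OF c] by blast
  let ?D = "coord_d (form_rep A \<alpha> c)"
  have r: "smooth_on ?S (form_rep A \<alpha> c)" using \<alpha> c by (simp add: smooth_form_def)
  have D: "smooth_on ?S (\<lambda>y. ?D y $ k $ l)" for k l
    unfolding coord_d_def partial_def
    by (simp, intro smooth_on_diff smooth_on_component smooth_on_frechet_derivative S r)
  have ev: "eval2 F u v = (\<Sum>k\<in>UNIV. u $ k * (\<Sum>l\<in>UNIV. F $ k $ l * v $ l))" for F u v
    by (simp add: eval2_def inner_vec_def matrix_vector_mult_def)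
  have "smooth_on ?S (\<lambda>y. eval2 (?D y) (d i y) (d j y))"
    unfolding ev by (intro smooth_on_sum smooth_on_mult D smooth_on_component[OF S d(1)] S)
  then show "smooth_on ?S ((\<lambda>q. eval2 (ext_d A \<alpha> q) (dual_vec (W q) i) (dual_vec (W q) j)) \<circ> chart_inv c)"
  proof (rule smooth_on_cong[OF S, rotated])
    fix y assume "y \<in> ?S"
    then obtain q where q: "q \<in> U" "q \<in> fst c" "y = snd c q" by blast
    have "eval2 (?D y) (d i y) (d j y) = eval2 (ext_d A \<alpha> q) (dual_vec (W q) i) (dual_vec (W q) j)"
      unfolding q(3) coord_d_change[OF U \<alpha> c chart_at(1) q(1,2) chart_at(2)] eval2_congruence
        ext_d_eq_coord_d d(2)[OF q(1,2)] ..
    then show "eval2 (?D y) (d i y) (d j y) =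
        ((\<lambda>q. eval2 (ext_d A \<alpha> q) (dual_vec (W q) i) (dual_vec (W q) j)) \<circ> chart_inv c) y"
      using q c by simp
  qed
qed

end

end

section \<open>Bump functions on the manifold and gluing\<close>

lemma manifold_bump:
  assumes V: "open V" and p: "p \<in> V"
  obtains \<psi> Q K where "open Q" "p \<in> Q" "closed K" "K \<subseteq> V" "smooth_fun A UNIV \<psi>"
    "\<And>q. 0 \<le> \<psi> q" "\<And>q. \<psi> q \<le> 1" "\<And>q. q \<in> Q \<Longrightarrow> \<psi> q = 1" "\<And>q. q \<notin> K \<Longrightarrow> \<psi> q = 0"
proof -
  define c where "c = chart_at A p"
  have c: "c \<in> A" "p \<in> fst c" unfolding c_def by (rule chart_at)+
  define x where "x = snd c p"
  let ?W = "snd c ` (V \<inter> fst c)"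
  have "open ?W" "x \<in> ?W" using open_chart_image_Int[OF c(1) V] c p by (auto simp: x_def)
  then obtain r where r: "0 < r" "cball x r \<subseteq> ?W" using open_contains_cball by blast
  obtain h :: "real^4 \<Rightarrow> real" where h: "smooth_on UNIV h" "\<And>y. 0 \<le> h y" "\<And>y. h y \<le> 1"
    "\<And>y. dist x y < r / 2 \<Longrightarrow> h y = 1" "\<And>y. r \<le> dist x y \<Longrightarrow> h y = 0"
    using smooth_bump[OF r(1)] by blast
  define K where "K = chart_inv c ` cball x r"
  define Q where "Q = {q \<in> fst c. snd c q \<in> ball x (r / 2)}"
  define \<psi> where "\<psi> q = (if q \<in> fst c then h (snd c q) else 0)" for q
  have "compact K" unfolding K_def
    using continuous_on_subset[OF continuous_on_chart_inv[OF c(1)]] r(2)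
    by (intro compact_continuous_image) auto
  \<comment> \<open>Compact sets are closed because the manifold is Hausdorff. The complement of
    \<open>K\<close> is thus open, and the extension of the bump by zero beyond the chart domain is
    smooth there.\<close>
  then have K: "closed K" by (rule compact_imp_closed)
  have KV: "K \<subseteq> V \<inter> fst c" using r(2) c by (auto simp: K_def)
  have \<psi>0: "\<psi> q = 0" if "q \<notin> K" for q
  proof (cases "q \<in> fst c")
    case True
    then have "snd c q \<notin> cball x r" using that c by (metis K_def chart_inv_chart image_eqI)
    then show ?thesis using True h(5) by (simp add: \<psi>_def)
  qed (simp add: \<psi>_def)
  have "smooth_fun A UNIV \<psi>"
    unfolding smooth_fun_def
  proof (intro ballI smooth_on_local)
    fix c' y assume c': "c' \<in> A" and "y \<in> snd c' ` (UNIV \<inter> fst c')"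
    then obtain q where q: "q \<in> fst c'" "y = snd c' q" by blast
    show "\<exists>T. open T \<and> y \<in> T \<and> smooth_on T (\<psi> \<circ> chart_inv c')"
    proof (cases "q \<in> fst c")
      case True
      let ?T = "snd c' ` (UNIV \<inter> fst c' \<inter> fst c)"
      have T: "open ?T" by (rule open_overlap[OF c' c(1) open_UNIV])
      have "smooth_on ?T (snd c \<circ> chart_inv c')"
        using smooth_on_transition[OF c' c(1)] by simp
      then have "smooth_on ?T (\<lambda>y. h ((snd c \<circ> chart_inv c') y))"
        by (rule smooth_on_compose[OF T open_UNIV h(1)]) simp
      then have "smooth_on ?T (\<psi> \<circ> chart_inv c')"
        by (rule smooth_on_cong[OF T, rotated]) (use c' in \<open>auto simp: \<psi>_def\<close>)
      then show ?thesis using T True q by blast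
    next
      case False
      let ?T = "snd c' ` (- K \<inter> fst c')"
      have T: "open ?T" by (rule open_chart_image_Int[OF c']) (use K in auto)
      have "smooth_on ?T (\<psi> \<circ> chart_inv c')"
        by (rule smooth_on_cong[OF T _ smooth_on_const[OF T, of 0]]) (use c' \<psi>0 in auto)
      moreover have "y \<in> ?T" using False KV q by blast
      ultimately show ?thesis using T by blast
    qed
  qed
  moreover have "open Q" unfolding Q_def by (rule open_chart_vimage[OF c(1) open_ball])
  moreover have "p \<in> Q" using c r by (simp add: Q_def x_def)
  moreover have "\<psi> q = 1" if "q \<in> Q" for q using that h(4) by (simp add: \<psi>_def Q_def)
  ultimately show thesis
    using that[of Q K \<psi>] K KV \<psi>0 h(2,3) by (auto simp: \<psi>_def)
qed

text \<open>For a sequence of bump functions \<open>\<psi>\<^sub>n\<close> that equal 1 on the members of an open cover, the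
  functions \<open>\<psi>\<^sub>n \<Prod>\<^sub>k\<^sub><\<^sub>n (1 - \<psi>\<^sub>k)\<close> form a partition of unity which is locally finite without any
  further condition on the cover.\<close>

lemma glue_convex:
  fixes F :: "'a \<Rightarrow> (real^4^4) set"
  assumes conv: "\<And>q. convex (F q)"
    and loc: "\<And>p. \<exists>V \<omega>. open V \<and> p \<in> V \<and> (\<forall>i. smooth_form A V (\<lambda>q. \<omega> q $ i)) \<and> (\<forall>q\<in>V. \<omega> q \<in> F q)"
  obtains \<omega> where "\<And>i. smooth_form A UNIV (\<lambda>q. \<omega> q $ i)" "\<And>q. \<omega> q \<in> F q"
proof -
  define good where "good Q K \<psi> \<omega> \<longleftrightarrow> open Q \<and> closed K \<and> smooth_fun A UNIV \<psi> \<and>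
    (\<forall>q. 0 \<le> \<psi> q \<and> \<psi> q \<le> 1) \<and> (\<forall>q\<in>Q. \<psi> q = 1) \<and> (\<forall>q. q \<notin> K \<longrightarrow> \<psi> q = 0) \<and>
    (\<exists>V. open V \<and> K \<subseteq> V \<and> (\<forall>i. smooth_form A V (\<lambda>q. \<omega> q $ i)) \<and> (\<forall>q\<in>V. \<omega> q \<in> F q))"
    for Q K and \<psi> :: "'a \<Rightarrow> real" and \<omega>
  have "\<exists>Q K \<psi> \<omega>. p \<in> Q \<and> good Q K \<psi> \<omega>" for p
    using loc[of p]
  proof (elim exE conjE)
    fix V \<omega>
    assume V: "open V" "p \<in> V" "\<forall>i. smooth_form A V (\<lambda>q. \<omega> q $ i)" "\<forall>q\<in>V. \<omega> q \<in> F q"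
    obtain \<psi> Q K where \<psi>: "open Q" "p \<in> Q" "closed K" "K \<subseteq> V" "smooth_fun A UNIV \<psi>"
      "\<And>q. 0 \<le> \<psi> q" "\<And>q. \<psi> q \<le> 1" "\<And>q. q \<in> Q \<Longrightarrow> \<psi> q = 1" "\<And>q. q \<notin> K \<Longrightarrow> \<psi> q = 0"
      using manifold_bump[OF V(1,2)] by metis
    have "\<exists>V. open V \<and> K \<subseteq> V \<and> (\<forall>i. smooth_form A V (\<lambda>q. \<omega> q $ i)) \<and> (\<forall>q\<in>V. \<omega> q \<in> F q)"
      using V \<psi>(4) by (intro exI[of _ V] conjI)
    then have "good Q K \<psi> \<omega>" unfolding good_def using \<psi> by simp
    then show ?thesis using \<psi>(2) by metis
  qed
  then have "\<forall>p. \<exists>Q K \<psi> \<omega>. p \<in> Q \<and> good Q K \<psi> \<omega>" by (rule allI)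
  from choice[OF this] obtain Q where "\<forall>p. \<exists>K \<psi> \<omega>. p \<in> Q p \<and> good (Q p) K \<psi> \<omega>" by (rule exE)
  from choice[OF this] obtain K where "\<forall>p. \<exists>\<psi> \<omega>. p \<in> Q p \<and> good (Q p) (K p) \<psi> \<omega>" by (rule exE)
  from choice[OF this] obtain \<psi> where "\<forall>p. \<exists>\<omega>. p \<in> Q p \<and> good (Q p) (K p) (\<psi> p) \<omega>" by (rule exE)
  from choice[OF this] obtain \<omega> where "\<forall>p. p \<in> Q p \<and> good (Q p) (K p) (\<psi> p) (\<omega> p)" by (rule exE)
  then have Q: "\<And>p. p \<in> Q p" and good: "\<And>p. good (Q p) (K p) (\<psi> p) (\<omega> p)" by auto
  \<comment> \<open>Second countability enters here: the bumps can be numbered by the natural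
    numbers, which the product formula for the partition requires.\<close>
  obtain \<Q> where \<Q>: "\<Q> \<subseteq> range Q" "countable \<Q>" "\<Union>\<Q> = \<Union>(range Q)"
    by (rule Lindelof[of "range Q"]) (use good good_def in auto)
  have cover: "\<Union>\<Q> = UNIV" using \<Q>(3) Q by blast
  then have "\<Q> \<noteq> {}" by auto
  then have e: "range (from_nat_into \<Q>) = \<Q>" using \<Q>(2) by (rule range_from_nat_into)
  then have "\<forall>n. \<exists>p. from_nat_into \<Q> n = Q p" using \<Q>(1) by blast
  from choice[OF this] obtain z where z: "\<forall>n. from_nat_into \<Q> n = Q (z n)" by (rule exE)
  define \<phi> where "\<phi> n q = \<psi> (z n) q * (\<Prod>k<n. 1 - \<psi> (z k) q)" for n q
  have bump: "0 \<le> \<psi> p q" "\<psi> p q \<le> 1" "q \<in> Q p \<Longrightarrow> \<psi> p q = 1" "q \<notin> K p \<Longrightarrow> \<psi> p q = 0" for p q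
    using good[of p] by (auto simp: good_def)
  have \<phi>_nonneg: "0 \<le> \<phi> n q" for n q
    unfolding \<phi>_def using bump by (intro mult_nonneg_nonneg prod_nonneg) auto
  \<comment> \<open>The sum telescopes. The product on the right becomes 0 as soon as one of its
    bumps equals 1 at \<open>q\<close>.\<close>
  have \<phi>_sum: "(\<Sum>n<N. \<phi> n q) = 1 - (\<Prod>k<N. 1 - \<psi> (z k) q)" for N q
    by (induction N) (auto simp: \<phi>_def algebra_simps)
  have \<phi>_zero: "\<phi> n q = 0" if "q \<in> Q (z k)" "k < n" for n k q
    using that bump(3) by (auto simp: \<phi>_def)
  have \<phi>_smooth: "smooth_fun A UNIV (\<phi> n)" for n
  proof -
    have "smooth_fun A UNIV (\<psi> p)" for p using good[of p] by (simp add: good_def)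
    then show ?thesis unfolding \<phi>_def
      by (intro smooth_fun_mult smooth_fun_prod smooth_fun_diff smooth_fun_const open_UNIV)
  qed
  have ex: "\<exists>k. q \<in> Q (z k)" for q 
  proof -
    have "q \<in> \<Union>(range (from_nat_into \<Q>))" using cover e by simp
    then show ?thesis using z by auto
  qed
  \<comment> \<open>The cut-off \<open>N q\<close> jumps with \<open>q\<close>, so the sum below is
    not visibly smooth. On \<open>Q (z k)\<close> it may be replaced by the sum up to the fixed
    index \<open>k\<close>, because all later weights vanish there.\<close>
  define N where "N q = (LEAST k. q \<in> Q (z k))" for q
  have N: "q \<in> Q (z (N q))" for q using ex[of q] LeastI_ex unfolding N_def by metis
  define \<sigma> where "\<sigma> q = (\<Sum>n\<le>N q. \<phi> n q *\<^sub>R \<omega> (z n) q)" for q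
  have \<sigma>: "\<sigma> q = (\<Sum>n\<le>k. \<phi> n q *\<^sub>R \<omega> (z n) q)" if "q \<in> Q (z k)" for q k
  proof -
    have "N q \<le> k" unfolding N_def using that by (rule Least_le)
    then show ?thesis unfolding \<sigma>_def
      by (intro sum.mono_neutral_left) (auto simp: \<phi>_zero[OF N])
  qed
  show thesis
  proof
    fix i
    have summand: "smooth_form A UNIV (\<lambda>q. \<phi> n q *\<^sub>R \<omega> (z n) q $ i)" for n
    proof (rule smooth_form_local)
      fix q
      obtain V where V: "open V" "K (z n) \<subseteq> V" "\<forall>i. smooth_form A V (\<lambda>q. \<omega> (z n) q $ i)"
        using good[of "z n"] unfolding good_def by blast
      show "\<exists>V. open V \<and> q \<in> V \<and> smooth_form A V (\<lambda>q. \<phi> n q *\<^sub>R \<omega> (z n) q $ i)"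
      proof (cases "q \<in> V")
        case True
        moreover have "smooth_form A V (\<lambda>q. \<phi> n q *\<^sub>R \<omega> (z n) q $ i)"
          using V smooth_fun_subset[OF \<phi>_smooth] by (intro smooth_form_scaleR) auto
        ultimately show ?thesis using V(1) by blast
      next
        case False
        have o: "open (- K (z n))" using good[of "z n"] by (simp add: good_def open_Compl)
        have "smooth_form A (- K (z n)) (\<lambda>q. \<phi> n q *\<^sub>R \<omega> (z n) q $ i)"
          by (rule smooth_form_cong[OF o _ smooth_form_zero[OF o]]) (auto simp: \<phi>_def bump)
        then show ?thesis using o False V(2) by blast
      qed
    qed
    show "smooth_form A UNIV (\<lambda>q. \<sigma> q $ i)"
    proof (rule smooth_form_local)
      fix q
      obtain k where k: "q \<in> Q (z k)" using ex by blast
      have o: "open (Q (z k))" using good by (simp add: good_def)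
      have "smooth_form A (Q (z k)) (\<lambda>q. \<Sum>n\<le>k. \<phi> n q *\<^sub>R \<omega> (z n) q $ i)"
        by (intro smooth_form_sum o smooth_form_subset[OF summand]) auto
      then have "smooth_form A (Q (z k)) (\<lambda>q. \<sigma> q $ i)"
        by (rule smooth_form_cong[OF o, rotated]) (simp add: \<sigma>)
      then show "\<exists>V. open V \<and> q \<in> V \<and> smooth_form A V (\<lambda>q. \<sigma> q $ i)" using o k by blast
    qed
  next
    fix q
    obtain w where w: "w \<in> F q" using loc[of q] by blast
    \<comment> \<open>A local form lies in \<open>F q\<close> only near its set \<open>K\<close>.
      Where its weight is zero it is replaced by an arbitrary member of \<open>F q\<close>, which
      does not change the sum and makes it a convex combination.\<close>
    define y where "y n = (if \<phi> n q = 0 then w else \<omega> (z n) q)" for n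
    have "y n \<in> F q" for n
    proof (cases "\<phi> n q = 0")
      case False
      then have "q \<in> K (z n)" using bump(4) by (auto simp: \<phi>_def)
      then show ?thesis using False good[of "z n"] unfolding good_def y_def by auto
    qed (simp add: y_def w)
    moreover have "(\<Sum>n\<le>N q. \<phi> n q) = 1"
    proof -
      \<comment> \<open>The bound \<open>Suc (N q)\<close> ensures that the factor with index
        \<open>N q\<close>, which is 0, occurs in the product.\<close>
      have "(\<Prod>k<Suc (N q). 1 - \<psi> (z k) q) = 0" using bump(3)[OF N] by auto
      then show ?thesis using \<phi>_sum[where N = "Suc (N q)"] by (simp add: lessThan_Suc_atMost)
    qed
    ultimately have "(\<Sum>n\<le>N q. \<phi> n q *\<^sub>R y n) \<in> F q"
      by (intro convex_sum conv) (auto simp: \<phi>_nonneg)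
    also have "(\<Sum>n\<le>N q. \<phi> n q *\<^sub>R y n) = \<sigma> q"
      unfolding \<sigma>_def by (intro sum.cong) (auto simp: y_def)
    finally show "\<sigma> q \<in> F q" .
  qed
qed

end

section \<open>Pointwise algebra of coframes\<close>

lemma vector_4 [simp]:
  "(vector [a, b, c, d] :: 'a::zero^4) $ 1 = a"
  "(vector [a, b, c, d] :: 'a^4) $ 2 = b"
  "(vector [a, b, c, d] :: 'a^4) $ 3 = c"
  "(vector [a, b, c, d] :: 'a^4) $ 4 = d"
  by (simp_all add: vector_def)

text \<open>The action of \<open>structure_group\<close>, with \<open>b = b\<^sub>2\<^sub>1\<close>, \<open>s = S\<^sub>1\<^sub>2\<close>, \<open>t = S\<^sub>2\<^sub>2\<close> and
  \<open>x = S\<^sub>1\<^sub>1 - b S\<^sub>1\<^sub>2\<close>.\<close>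

definition change :: "real \<Rightarrow> real \<Rightarrow> real \<Rightarrow> real \<Rightarrow> real^4^4 \<Rightarrow> real^4^4" where
  "change b x s t M = vector [M $ 1, M $ 2 + b *\<^sub>R M $ 1,
     M $ 3 - b *\<^sub>R M $ 4 + x *\<^sub>R M $ 1 + (s - b * t) *\<^sub>R M $ 2, M $ 4 + s *\<^sub>R M $ 1 + t *\<^sub>R M $ 2]"

lemma change_rows [simp]:
  "change b x s t M $ 1 = M $ 1"
  "change b x s t M $ 2 = M $ 2 + b *\<^sub>R M $ 1"
  "change b x s t M $ 3 = M $ 3 - b *\<^sub>R M $ 4 + x *\<^sub>R M $ 1 + (s - b * t) *\<^sub>R M $ 2"
  "change b x s t M $ 4 = M $ 4 + s *\<^sub>R M $ 1 + t *\<^sub>R M $ 2"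
  by (simp_all add: change_def)

lemma rows_eqI:
  fixes M N :: "'a^'n^4"
  shows "M $ 1 = N $ 1 \<Longrightarrow> M $ 2 = N $ 2 \<Longrightarrow> M $ 3 = N $ 3 \<Longrightarrow> M $ 4 = N $ 4 \<Longrightarrow> M = N"
  by (simp add: vec_eq_iff[of M N] forall_4)

lemma change_0 [simp]: "change 0 0 0 0 M = M"
  by (rule rows_eqI) simp_all

lemma change_change:
  "change b' x' s' t' (change b x s t M) =
     change (b + b') (x - b' * s + x' + (s' - b' * t') * b) (s + s' + t' * b) (t + t') M"
  by (rule rows_eqI) (simp_all add: algebra_simps)

lemma change_inverse: "change (- b) (- x) (t * b - s) (- t) (change b x s t M) = M"
  by (simp add: change_change algebra_simps)

lemma change_matrix_mult: "change b x s t M = change b x s t (mat 1) ** M"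
proof -
  have id: "(mat 1 :: real^4^4) $ i v* M = M $ i" for i
    by (metis matrix_mul_lid row_matrix_mult)
  show ?thesis
    by (rule rows_eqI)
      (simp_all add: row_matrix_mult vector_matrix_left_distrib vector_matrix_mult_diff_distrib
        scaleR_vector_matrix_assoc id)
qed

lemma invertible_change:
  assumes "invertible M"
  shows "invertible (change b x s t M)"
proof -
  have "change (- b) (- x) (t * b - s) (- t) (mat 1) ** change b x s t (mat 1) = mat 1"
    by (metis change_inverse change_matrix_mult)
  then have "invertible (change b x s t (mat 1))"
    using invertible_left_inverse by blast
  then show ?thesis by (subst change_matrix_mult) (rule invertible_mult[OF _ assms])
qed

text \<open>The inverse transpose of the block \<open>B11\<close> has rows (1, -b) and (0, 1).
  Multiplying it by \<open>S\<close> gives the first row (S11 - b S12, S12 - b S22), which explains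
  the coefficients of \<open>\<omega>1\<close> and \<open>\<omega>2\<close> in the third row of
  \<open>change\<close>.\<close>

lemma structure_group_orbit:
  "{B ** M |B. B \<in> structure_group} = {change b x s t M |b x s t. True}"
proof -
  have inv: "matrix_inv (transpose (vector [vector [1, 0], vector [b, 1]] :: real^2^2)) =
      vector [vector [1, - b], vector [0, 1]]" (is "matrix_inv ?L = ?R") for b
  proof -
    have RL: "?R ** ?L = mat 1"
      by (simp add: vec_eq_iff forall_2 matrix_matrix_mult_def sum_2 transpose_def mat_def)
    then have L: "invertible ?L" using invertible_left_inverse by blast
    have "matrix_inv ?L = (?R ** ?L) ** matrix_inv ?L" unfolding RL by simp
    also have "\<dots> = ?R" by (simp only: matrix_mul_assoc[symmetric] matrix_inv_inverse(1)[OF L] matrix_mul_rid)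
    finally show ?thesis .
  qed
  have rows: "(B ** M) $ i = B $ i $ 1 *\<^sub>R M $ 1 + B $ i $ 2 *\<^sub>R M $ 2 + B $ i $ 3 *\<^sub>R M $ 3 + B $ i $ 4 *\<^sub>R M $ 4"
    for B :: "real^4^4" and i
    by (simp add: vec_eq_iff matrix_matrix_mult_def sum_4)
  have entries: "(X ** Y) $ i $ j = X $ i $ 1 * Y $ 1 $ j + X $ i $ 2 * Y $ 2 $ j" for X Y :: "real^2^2" and i j
    by (simp add: matrix_matrix_mult_def sum_2)
  have B: "block_matrix B11 0 (matrix_inv (transpose B11) ** S) (matrix_inv (transpose B11)) ** M =
      change b (S $ 1 $ 1 - b * S $ 1 $ 2) (S $ 1 $ 2) (S $ 2 $ 2) M"
    if "transpose S = S" "B11 = vector [vector [1, 0], vector [b, 1]]" for B11 S b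
  proof -
    have "transpose S $ 1 $ 2 = S $ 1 $ 2" using that(1) by (rule arg_cong)
    then have "S $ 2 $ 1 = S $ 1 $ 2" by (simp add: transpose_def)
    then show ?thesis
      unfolding that(2) inv block_matrix_def
      by (intro rows_eqI) (simp_all add: rows entries algebra_simps)
  qed
  show ?thesis
  proof (intro equalityI subsetI)
    fix N assume "N \<in> {B ** M |B. B \<in> structure_group}"
    then show "N \<in> {change b x s t M |b x s t. True}"
      unfolding structure_group_def using B by blast
  next
    fix N assume "N \<in> {change b x s t M |b x s t. True}"
    then obtain b x s t where N: "N = change b x s t M" by blast
    \<comment> \<open>The entry \<open>x + b * s\<close> solves x = S11 - b S12 for S11.\<close>
    define S :: "real^2^2" where "S = vector [vector [x + b * s, s], vector [s, t]]"
    have "transpose S = S" by (simp add: S_def vec_eq_iff forall_2 transpose_def)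
    then have "block_matrix (vector [vector [1, 0], vector [b, 1]]) 0
        (matrix_inv (transpose (vector [vector [1, 0], vector [b, 1]])) ** S)
        (matrix_inv (transpose (vector [vector [1, 0], vector [b, 1]]))) ** M = N"
      by (subst B[where b = b]) (simp_all add: S_def N)
    then show "N \<in> {B ** M |B. B \<in> structure_group}"
      unfolding structure_group_def using \<open>transpose S = S\<close> by blast
  qed
qed

section \<open>Two-forms expanded in a coframe\<close>

lemma eval2_linear [simp]:
  "eval2 (F + G) u v = eval2 F u v + eval2 G u v"
  "eval2 (r *\<^sub>R F) u v = r * eval2 F u v"
  by (simp_all add: eval2_def matrix_vector_mult_add_rdistrib inner_add_right scaleR_matrix_vector_assoc[symmetric])

lemma eval2_wedge [simp]: "eval2 (\<alpha> \<and>\<^sub>f \<beta>) u v = (\<alpha> \<bullet> u) * (\<beta> \<bullet> v) - (\<alpha> \<bullet> v) * (\<beta> \<bullet> u)"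
  by (simp add: eval2_def wedge_def inner_vec_def matrix_vector_mult_def sum_4 algebra_simps)

lemma coframe_expansion:
  fixes W :: "real^4^4"
  assumes "invertible W"
  obtains b1 b2 b3 b4 where "\<beta> = b1 *\<^sub>R W $ 1 + b2 *\<^sub>R W $ 2 + b3 *\<^sub>R W $ 3 + b4 *\<^sub>R W $ 4"
proof -
  define y where "y = \<beta> v* matrix_inv W"
  have "\<beta> = y v* W"
    by (simp add: y_def vector_matrix_mul_assoc matrix_inv_inverse(2)[OF assms])
  then have "\<beta> = y $ 1 *\<^sub>R W $ 1 + y $ 2 *\<^sub>R W $ 2 + y $ 3 *\<^sub>R W $ 3 + y $ 4 *\<^sub>R W $ 4"
    by (simp add: vec_eq_iff vector_matrix_mult_def sum_4 mult.commute)
  then show thesis by (rule that)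
qed

text \<open>Collecting the cofactors of each generator shows that the sums on the right already form
  a subspace, so the span contains nothing else.\<close>

lemma ideal2_pairD:
  assumes "F \<in> ideal2 {\<alpha>, \<beta>}"
  obtains \<mu> \<nu> where "F = \<mu> \<and>\<^sub>f \<alpha> + \<nu> \<and>\<^sub>f \<beta>"
proof -
  let ?V = "{\<mu> \<and>\<^sub>f \<alpha> + \<nu> \<and>\<^sub>f \<beta> |\<mu> \<nu>. True}"
  have add: "\<mu> \<and>\<^sub>f \<alpha> + \<nu> \<and>\<^sub>f \<beta> + (\<mu>' \<and>\<^sub>f \<alpha> + \<nu>' \<and>\<^sub>f \<beta>) = (\<mu> + \<mu>') \<and>\<^sub>f \<alpha> + (\<nu> + \<nu>') \<and>\<^sub>f \<beta>" for \<mu> \<mu>' \<nu> \<nu>'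
    by (simp add: wedge_def vec_eq_iff algebra_simps)
  have scale: "r *\<^sub>R (\<mu> \<and>\<^sub>f \<alpha> + \<nu> \<and>\<^sub>f \<beta>) = (r *\<^sub>R \<mu>) \<and>\<^sub>f \<alpha> + (r *\<^sub>R \<nu>) \<and>\<^sub>f \<beta>" for r \<mu> \<nu>
    by (simp add: wedge_def vec_eq_iff algebra_simps)
  have gen: "\<alpha> \<and>\<^sub>f \<gamma> = (- \<gamma>) \<and>\<^sub>f \<alpha> + 0 \<and>\<^sub>f \<beta>" "\<beta> \<and>\<^sub>f \<gamma> = 0 \<and>\<^sub>f \<alpha> + (- \<gamma>) \<and>\<^sub>f \<beta>" for \<gamma>
    by (simp_all add: wedge_def vec_eq_iff)
  have "subspace ?V"
  proof (rule subspaceI)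
    have "0 = 0 \<and>\<^sub>f \<alpha> + 0 \<and>\<^sub>f \<beta>" by (simp add: wedge_def vec_eq_iff)
    then show "0 \<in> ?V" by blast
  next
    show "F + G \<in> ?V" if "F \<in> ?V" "G \<in> ?V" for F G
      using that add by fastforce
    show "r *\<^sub>R F \<in> ?V" if "F \<in> ?V" for r F
      using that scale by fastforce
  qed
  moreover have "{\<alpha>' \<and>\<^sub>f \<gamma> |\<alpha>' \<gamma>. \<alpha>' \<in> {\<alpha>, \<beta>}} \<subseteq> ?V" using gen by blast
  ultimately have "ideal2 {\<alpha>, \<beta>} \<subseteq> ?V" unfolding ideal2_def by (rule span_minimal[rotated])
  then show thesis using assms that by blast
qed

lemma ideal2_singleD:
  assumes "F \<in> ideal2 {\<alpha>}"
  obtains \<mu> where "F = \<mu> \<and>\<^sub>f \<alpha>"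
proof -
  obtain \<mu> \<nu> where "F = \<mu> \<and>\<^sub>f \<alpha> + \<nu> \<and>\<^sub>f \<alpha>" using ideal2_pairD[of F \<alpha> \<alpha>] assms by auto
  then have "F = (\<mu> + \<nu>) \<and>\<^sub>f \<alpha>" by (simp add: wedge_def vec_eq_iff algebra_simps)
  then show thesis by (rule that)
qed

lemma wedge_in_ideal2: "\<mu> \<and>\<^sub>f \<alpha> \<in> ideal2 {\<alpha>}"
proof -
  have "\<mu> \<and>\<^sub>f \<alpha> = \<alpha> \<and>\<^sub>f (- \<mu>)" by (simp add: wedge_def vec_eq_iff)
  then show ?thesis unfolding ideal2_def by (intro span_base) blast
qed

text \<open>\<open>F\<close> stands for the value of \<open>d\<omega>1\<close> at a point. Keeping
  it as a free matrix separates the algebra of coframe changes from differentiation.\<close>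

definition eqs1 :: "real \<Rightarrow> real^4^4 \<Rightarrow> real^4^4 \<Rightarrow> real \<Rightarrow> real \<Rightarrow> real \<Rightarrow> bool" where
  "eqs1 \<epsilon> W F a2 a3 a4 \<longleftrightarrow> F = \<epsilon> *\<^sub>R (W $ 4 \<and>\<^sub>f W $ 2) +
     (a2 *\<^sub>R W $ 2 + a3 *\<^sub>R W $ 3 + a4 *\<^sub>R W $ 4) \<and>\<^sub>f W $ 1"

text \<open>The general 2-form congruent to \<open>\<omega>3 \<and> \<omega>4\<close> modulo
  \<open>\<omega>1, \<omega>2\<close>: one coefficient for each of the other five basis
  2-forms.\<close>

definition eqs2 :: "real^4^4 \<Rightarrow> real^4^4 \<Rightarrow> real \<Rightarrow> real \<Rightarrow> real \<Rightarrow> real \<Rightarrow> real \<Rightarrow> bool" where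
  "eqs2 W G a q3 q4 c e \<longleftrightarrow> G = (a *\<^sub>R W $ 1 + q3 *\<^sub>R W $ 3 + q4 *\<^sub>R W $ 4) \<and>\<^sub>f W $ 2 +
     (c *\<^sub>R W $ 3 + e *\<^sub>R W $ 4) \<and>\<^sub>f W $ 1 + W $ 3 \<and>\<^sub>f W $ 4"

text \<open>Evaluation on dual vectors isolates each coefficient. Both the uniqueness of the
  coefficients and their smoothness along a section follow from these formulas.\<close>

lemma eqs1_coeffs:
  assumes "invertible W" "eqs1 \<epsilon> W F a2 a3 a4"
  shows "a2 = eval2 F (dual_vec W 2) (dual_vec W 1)" "a3 = eval2 F (dual_vec W 3) (dual_vec W 1)"
    "a4 = eval2 F (dual_vec W 4) (dual_vec W 1)"
  using assms by (simp_all add: eqs1_def inner_add_left)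

lemma eqs2_coeffs:
  assumes "invertible W" "eqs2 W G a q3 q4 c e"
  shows "a = eval2 G (dual_vec W 1) (dual_vec W 2)" "q3 = eval2 G (dual_vec W 3) (dual_vec W 2)"
    "q4 = eval2 G (dual_vec W 4) (dual_vec W 2)" "c = eval2 G (dual_vec W 3) (dual_vec W 1)"
    "e = eval2 G (dual_vec W 4) (dual_vec W 1)"
  using assms by (simp_all add: eqs2_def inner_add_left)

text \<open>The same \<open>F\<close> occurs before and after the change because every change keeps
  the first row.\<close>

lemma eqs1_change:
  assumes "eqs1 \<epsilon> W F a2 a3 a4"
  shows "eqs1 \<epsilon> (change b x s t W) F (a2 + (\<epsilon> - a3) * s - t * a4) a3 (a4 - (\<epsilon> - a3) * b)"
  using assms unfolding eqs1_def by (simp add: wedge_def vec_eq_iff algebra_simps)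

text \<open>With \<open>b = 0\<close> the second row is kept as well, so \<open>G\<close> is
  unchanged and the new coefficients follow by expanding.\<close>

lemma eqs2_change:
  assumes "eqs2 W G a q3 q4 c e"
  shows "eqs2 (change 0 x s t W) G (a - q3 * x - q4 * s + c * s + e * t + x * t - s\<^sup>2)
    (q3 - t) (q4 + s) (c - s) (e + x)"
  using assms unfolding eqs2_def by (simp add: wedge_def vec_eq_iff algebra_simps power2_eq_square)

lemma eqs1_exI:
  assumes W: "invertible W" and F: "F = \<epsilon> *\<^sub>R (W $ 4 \<and>\<^sub>f W $ 2) + \<beta> \<and>\<^sub>f W $ 1"
  obtains a2 a3 a4 where "eqs1 \<epsilon> W F a2 a3 a4"
proof -
  obtain b1 b2 b3 b4 where "\<beta> = b1 *\<^sub>R W $ 1 + b2 *\<^sub>R W $ 2 + b3 *\<^sub>R W $ 3 + b4 *\<^sub>R W $ 4"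
    using coframe_expansion[OF W] by blast
  then have "eqs1 \<epsilon> W F b2 b3 b4"
    unfolding F eqs1_def by (simp add: wedge_def vec_eq_iff algebra_simps)
  then show thesis by (rule that)
qed

lemma eqs2_exI:
  assumes W: "invertible W" and G: "G = \<mu> \<and>\<^sub>f W $ 1 + \<nu> \<and>\<^sub>f W $ 2 + W $ 3 \<and>\<^sub>f W $ 4"
  obtains a q3 q4 c e where "eqs2 W G a q3 q4 c e"
proof -
  obtain m1 m2 m3 m4 where \<mu>: "\<mu> = m1 *\<^sub>R W $ 1 + m2 *\<^sub>R W $ 2 + m3 *\<^sub>R W $ 3 + m4 *\<^sub>R W $ 4"
    using coframe_expansion[OF W] by blast
  obtain n1 n2 n3 n4 where \<nu>: "\<nu> = n1 *\<^sub>R W $ 1 + n2 *\<^sub>R W $ 2 + n3 *\<^sub>R W $ 3 + n4 *\<^sub>R W $ 4"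
    using coframe_expansion[OF W] by blast
  \<comment> \<open>The 2-form \<open>\<omega>1 \<and> \<omega>2\<close> receives \<open>n1\<close>
    from \<open>\<nu>\<close> and, with reversed sign, \<open>m2\<close> from
    \<open>\<mu>\<close>.\<close>
  have "eqs2 W G (n1 - m2) n3 n4 m3 m4"
    unfolding G \<mu> \<nu> eqs2_def by (simp add: wedge_def vec_eq_iff algebra_simps)
  then show thesis by (rule that)
qed

lemma eqs2_change_ex:
  assumes W: "invertible W" and F: "eqs1 \<epsilon> W F a2 a3 a4" and G: "eqs2 W G a q3 q4 c e"
  obtains a' q3' q4' c' e' where
    "eqs2 (change b x s t W) (G + b *\<^sub>R F + \<eta> \<and>\<^sub>f W $ 1) a' q3' q4' c' e'"
proof -
  let ?C = "change b x s t W"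
  \<comment> \<open>Expressing \<open>\<omega>3 \<and> \<omega>4\<close> through the new third and
    fourth rows leaves multiples of \<open>\<omega>1\<close> and \<open>\<omega>2\<close>, whose
    cofactors are gathered in \<open>\<mu>\<close> and \<open>\<nu>\<close>. Replacing
    \<open>\<omega>2\<close> by the new second row minus \<open>b \<omega>1\<close> turns
    \<open>\<mu>\<close> into \<open>\<mu> - b \<nu>\<close>.\<close>
  define \<nu> where "\<nu> = a *\<^sub>R W $ 1 + q3 *\<^sub>R W $ 3 + q4 *\<^sub>R W $ 4 - t *\<^sub>R ?C $ 3 + (s - b * t + b * \<epsilon>) *\<^sub>R W $ 4"
  define \<mu> where "\<mu> = c *\<^sub>R W $ 3 + e *\<^sub>R W $ 4 - s *\<^sub>R ?C $ 3 + x *\<^sub>R W $ 4 +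
    b *\<^sub>R (a2 *\<^sub>R W $ 2 + a3 *\<^sub>R W $ 3 + a4 *\<^sub>R W $ 4) + \<eta>"
  have "G + b *\<^sub>R F + \<eta> \<and>\<^sub>f W $ 1 = (\<mu> - b *\<^sub>R \<nu>) \<and>\<^sub>f ?C $ 1 + \<nu> \<and>\<^sub>f ?C $ 2 + ?C $ 3 \<and>\<^sub>f ?C $ 4"
    unfolding F[unfolded eqs1_def] G[unfolded eqs2_def] \<mu>_def \<nu>_def
    by (simp add: wedge_def vec_eq_iff algebra_simps)
  then show thesis using eqs2_exI[OF invertible_change[OF W]] that by blast
qed

section \<open>Sections of the normalized bundle\<close>

locale normalized_structure = smooth_manifold A
  for A :: "'a::{t2_space, second_countable_topology} chart set" +
  fixes \<Omega> :: "'a \<Rightarrow> real^4^4" and D :: "'a \<Rightarrow> (real^4) set" and \<epsilon> :: real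
    and P :: "'a \<Rightarrow> (real^4^4) set"
  assumes norm_bundle: "normalized_bundle A \<Omega> D \<epsilon> P"
begin

section \<open>The fibres of P and its sections\<close>

lemma local_normalized:
  obtains V \<omega> where "open V" "p \<in> V" "normalized A \<Omega> D \<epsilon> V \<omega>" "coframing A V \<omega>" "\<And>q. q \<in> V \<Longrightarrow> \<omega> q \<in> P q"
    "\<And>q. q \<in> V \<Longrightarrow> P q = {change b x s t (\<omega> q) |b x s t. True}"
proof -
  obtain V \<omega> where V: "open V" "p \<in> V" "normalized A \<Omega> D \<epsilon> V \<omega>"
    and P: "\<forall>q\<in>V. P q = {B ** \<omega> q |B. B \<in> structure_group}"
    using norm_bundle[unfolded normalized_bundle_def, rule_format, of p] by (elim exE conjE)
  have P': "P q = {change b x s t (\<omega> q) |b x s t. True}" if "q \<in> V" for q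
    using P that structure_group_orbit by simp
  moreover have "\<omega> q \<in> P q" if "q \<in> V" for q
    unfolding P'[OF that] using change_0[of "\<omega> q"] by (metis (mono_tags, lifting) mem_Collect_eq)
  moreover have "coframing A V \<omega>"
    using V(3) by (simp add: normalized_def adapted1_def adapted0_def)
  ultimately show thesis using that[OF V] by simp
qed

lemma fiber_orbit:
  obtains \<omega> where "invertible \<omega>" "P q = {change b x s t \<omega> |b x s t. True}"
proof -
  obtain V \<omega> where V: "open V" "q \<in> V" "normalized A \<Omega> D \<epsilon> V \<omega>" "coframing A V \<omega>"
    "\<And>q. q \<in> V \<Longrightarrow> \<omega> q \<in> P q" "\<And>q. q \<in> V \<Longrightarrow> P q = {change b x s t (\<omega> q) |b x s t. True}"
    by (rule local_normalized[of q]) (rule that)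
  have "invertible (\<omega> q)" using V(2,4) by (simp add: coframing_def)
  then show thesis using that V(6)[OF V(2)] by simp
qed

lemma invertible_fiber:
  assumes "w \<in> P q"
  shows "invertible w"
proof -
  obtain \<omega> where \<omega>: "invertible \<omega>" "P q = {change b x s t \<omega> |b x s t. True}" by (rule fiber_orbit)
  then show ?thesis using assms invertible_change by auto
qed

lemma fiber_change:
  assumes "w \<in> P q"
  shows "change b x s t w \<in> P q"
proof -
  obtain \<omega> where \<omega>: "P q = {change b x s t \<omega> |b x s t. True}" by (rule fiber_orbit)
  obtain b' x' s' t' where "w = change b' x' s' t' \<omega>" using assms \<omega> by auto
  then have "change b x s t w =
      change (b' + b) (x' - b * s' + x + (s - b * t) * b') (s' + s + t * b') (t' + t) \<omega>"
    by (simp only: change_change)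
  then show ?thesis unfolding \<omega> by blast
qed

lemma fiber_transitive:
  assumes "w \<in> P q" "w' \<in> P q"
  obtains b x s t where "w' = change b x s t w"
proof -
  obtain \<omega> where \<omega>: "P q = {change b x s t \<omega> |b x s t. True}" by (rule fiber_orbit)
  obtain b x s t where "w = change b x s t \<omega>" using assms \<omega> by auto
  then have "\<omega> = change (- b) (- x) (t * b - s) (- t) w" by (simp add: change_inverse)
  moreover obtain b' x' s' t' where "w' = change b' x' s' t' \<omega>" using assms \<omega> by auto
  ultimately show thesis using that by (simp add: change_change)
qed

text \<open>Rows 2 and 4 pin down \<open>b, s, t\<close>, so \<open>x\<close> is the only freedom
  left once these rows are known. Writing the parameters as contractions also makes them smooth when
  the rows are.\<close>

lemma change_parameters:
  assumes "w \<in> P q" "change b x s t w $ 2 = v2" "change b x s t w $ 4 = v4"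
  shows "b = v2 \<bullet> dual_vec w 1" "s = v4 \<bullet> dual_vec w 1" "t = v4 \<bullet> dual_vec w 2"
  using invertible_fiber[OF assms(1)] by (simp_all add: inner_add_left flip: assms(2,3))

lemma section_ofI:
  assumes "\<And>q. q \<in> U \<Longrightarrow> W q \<in> P q" "\<And>i. smooth_form A U (\<lambda>q. W q $ i)"
  shows "section_of A P U W"
  using assms by (auto simp: section_of_def coframing_def intro: invertible_fiber)

lemma section_ofD:
  assumes "section_of A P U W"
  shows "coframing A U W" "q \<in> U \<Longrightarrow> W q \<in> P q" "smooth_form A U (\<lambda>q. W q $ i)"
    "q \<in> U \<Longrightarrow> invertible (W q)"
  using assms by (auto simp: section_of_def coframing_def)

lemma section_of_subset: "section_of A P U W \<Longrightarrow> V \<subseteq> U \<Longrightarrow> section_of A P V W"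
  by (auto simp: section_of_def coframing_def intro: smooth_form_subset)

lemma section_change:
  assumes U: "open U" and W: "section_of A P U W"
    and sm: "smooth_fun A U b" "smooth_fun A U x" "smooth_fun A U s" "smooth_fun A U t"
  shows "section_of A P U (\<lambda>q. change (b q) (x q) (s q) (t q) (W q))"
proof (rule section_ofI)
  show "change (b q) (x q) (s q) (t q) (W q) \<in> P q" if "q \<in> U" for q
    using fiber_change section_ofD(2)[OF W that] .
  have "smooth_form A U (\<lambda>q. change (b q) (x q) (s q) (t q) (W q) $ i)" if "i = 1 \<or> i = 2 \<or> i = 3 \<or> i = 4" for i
    using that
    by (elim disjE; simp; intro smooth_form_add smooth_form_diff smooth_form_scaleR smooth_fun_diff
        smooth_fun_mult sm U section_ofD(3)[OF W])
  then show "smooth_form A U (\<lambda>q. change (b q) (x q) (s q) (t q) (W q) $ i)" for i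
    using exhaust_4[of i] by blast
qed

text \<open>Smoothness is recorded for \<open>b\<close> alone, since this is the only parameter that
  has to be differentiated when \<open>d\<omega>1\<close> and \<open>d\<omega>2\<close> are
  compared.\<close>

lemma section_transition:
  assumes U: "open U" and W: "section_of A P U W" and W': "section_of A P U W'"
  obtains b x s t where "smooth_fun A U b" "\<And>q. q \<in> U \<Longrightarrow> W' q = change (b q) (x q) (s q) (t q) (W q)"
proof -
  have sm: "smooth_fun A U (\<lambda>q. W' q $ 2 \<bullet> dual_vec (W q) 1)"
    by (rule smooth_fun_inner_dual_vec[OF U section_ofD(1)[OF W] section_ofD(3)[OF W']])
  have "\<forall>q. \<exists>v. q \<in> U \<longrightarrow> W' q = change (W' q $ 2 \<bullet> dual_vec (W q) 1) (fst v) (fst (snd v)) (snd (snd v)) (W q)"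
  proof
    fix q
    show "\<exists>v. q \<in> U \<longrightarrow> W' q = change (W' q $ 2 \<bullet> dual_vec (W q) 1) (fst v) (fst (snd v)) (snd (snd v)) (W q)"
    proof (cases "q \<in> U")
      case True
      then obtain b x s t where c: "W' q = change b x s t (W q)"
        using fiber_transitive section_ofD(2) W W' by metis
      then have "b = W' q $ 2 \<bullet> dual_vec (W q) 1"
        using change_parameters(1)[OF section_ofD(2)[OF W True]] by simp
      then show ?thesis using c by (intro exI[of _ "(x, s, t)"]) simp
    qed simp
  qed
  from choice[OF this] obtain v where "\<forall>q. q \<in> U \<longrightarrow>
      W' q = change (W' q $ 2 \<bullet> dual_vec (W q) 1) (fst (v q)) (fst (snd (v q))) (snd (snd (v q))) (W q)"
    by (rule exE)
  then show thesis
    using that[OF sm, of "fst \<circ> v" "fst \<circ> snd \<circ> v" "snd \<circ> snd \<circ> v"] by simp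
qed

lemma d_comp_1_eq:
  assumes U: "open U" and W: "section_of A P U W" and W': "section_of A P U W'" and q: "q \<in> U"
  shows "d_comp A W' 1 q = d_comp A W 1 q"
proof -
  obtain b x s t where "smooth_fun A U b" "\<And>q. q \<in> U \<Longrightarrow> W' q = change (b q) (x q) (s q) (t q) (W q)"
    using section_transition[OF U W W'] by blast
  then show ?thesis
    unfolding d_comp_def by (intro ext_d_cong_open[OF U q]) simp
qed

text \<open>Convexity of \<open>P q\<close> fails only because of the term \<open>b t \<omega>\<^sub>2\<close> in the third row. Without that row
  the fibres are convex, and so is the set of third rows that complete three given ones.\<close>

lemma global_section: obtains W where "section_of A P UNIV W"
proof -
  \<comment> \<open>The third row is overwritten by 0 to discard it while keeping a matrix, which is
    the format of the gluing lemma.\<close>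
  define F where "F q = {M :: real^4^4. \<exists>w\<in>P q. M $ 1 = w $ 1 \<and> M $ 2 = w $ 2 \<and> M $ 3 = 0 \<and> M $ 4 = w $ 4}" for q
  have "convex (F q)" for q
  proof (rule convexI)
    fix M N and u v :: real assume M: "M \<in> F q" and N: "N \<in> F q" and uv: "0 \<le> u" "0 \<le> v" "u + v = 1"
    obtain w w' where w: "w \<in> P q" "M $ 1 = w $ 1" "M $ 2 = w $ 2" "M $ 3 = 0" "M $ 4 = w $ 4"
      and w': "w' \<in> P q" "N $ 1 = w' $ 1" "N $ 2 = w' $ 2" "N $ 3 = 0" "N $ 4 = w' $ 4"
      using M N unfolding F_def by blast
    obtain b x s t where c: "w' = change b x s t w" using fiber_transitive[OF w(1) w'(1)] .
    have u: "u = 1 - v" using uv by simp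
    show "u *\<^sub>R M + v *\<^sub>R N \<in> F q"
      unfolding F_def mem_Collect_eq
      by (rule bexI[OF _ fiber_change[OF w(1), of "v * b" 0 "v * s" "v * t"]])
        (use w w' in \<open>simp add: c u algebra_simps\<close>)
  qed
  moreover have "\<exists>V \<omega>. open V \<and> p \<in> V \<and> (\<forall>i. smooth_form A V (\<lambda>q. \<omega> q $ i)) \<and> (\<forall>q\<in>V. \<omega> q \<in> F q)" for p
  proof -
    obtain V \<omega> where V: "open V" "p \<in> V" "coframing A V \<omega>" "\<And>q. q \<in> V \<Longrightarrow> \<omega> q \<in> P q"
      by (rule local_normalized[of p]) blast
    let ?\<omega> = "\<lambda>q. \<chi> i. if i = 3 then 0 else \<omega> q $ i"
    have "smooth_form A V (\<lambda>q. ?\<omega> q $ i)" for i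
      using V(3) smooth_form_zero[OF V(1)] by (cases "i = 3") (simp_all add: coframing_def)
    moreover have "?\<omega> q \<in> F q" if "q \<in> V" for q
      using V(4)[OF that] unfolding F_def by auto
    ultimately show ?thesis using V(1,2) by (intro exI[of _ V] exI[of _ ?\<omega>] conjI ballI allI)
  qed
  ultimately obtain g where g: "\<And>i. smooth_form A UNIV (\<lambda>q. g q $ i)" "\<And>q. g q \<in> F q"
    using glue_convex[of F] by blast
  define G where "G q = {w \<in> P q. w $ 2 = g q $ 2 \<and> w $ 4 = g q $ 4}" for q
  have "convex (G q)" for q
  proof (rule convexI)
    fix w w' and u v :: real assume w: "w \<in> G q" and w': "w' \<in> G q" and uv: "0 \<le> u" "0 \<le> v" "u + v = 1"
    have wP: "w \<in> P q" "w' \<in> P q" using w w' by (simp_all add: G_def)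
    obtain b x s t where c: "w' = change b x s t w" using fiber_transitive[OF wP] .
    have "change b x s t w $ 2 = w $ 2" "change b x s t w $ 4 = w $ 4"
      unfolding c[symmetric] using w w' by (simp_all add: G_def)
    \<comment> \<open>Two members of \<open>G q\<close> share rows 2 and 4, so they differ only in
      \<open>x\<close>, which enters the third row affinely.\<close>
    from change_parameters[OF wP(1) this] have "b = 0" "s = 0" "t = 0"
      using invertible_fiber[OF wP(1)] by simp_all
    moreover have u: "u = 1 - v" using uv by simp
    ultimately have "u *\<^sub>R w + v *\<^sub>R w' = change 0 (v * x) 0 0 w"
      by (intro rows_eqI) (simp_all add: c u algebra_simps)
    then show "u *\<^sub>R w + v *\<^sub>R w' \<in> G q"
      using fiber_change[OF wP(1), of 0 "v * x" 0 0] w by (simp add: G_def)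
  qed
  moreover have "\<exists>V \<omega>. open V \<and> p \<in> V \<and> (\<forall>i. smooth_form A V (\<lambda>q. \<omega> q $ i)) \<and> (\<forall>q\<in>V. \<omega> q \<in> G q)" for p
  proof -
    obtain V \<omega> where V: "open V" "p \<in> V" "coframing A V \<omega>" "\<And>q. q \<in> V \<Longrightarrow> \<omega> q \<in> P q"
      by (rule local_normalized[of p]) blast
    have \<omega>: "section_of A P V \<omega>" using V by (simp add: section_of_def)
    \<comment> \<open>Rows 2 and 4 of \<open>g q\<close> come from some member of the fibre, so
      these contractions recover its parameters. The value 0 for \<open>x\<close> is an arbitrary
      smooth choice.\<close>
    let ?b = "\<lambda>q. g q $ 2 \<bullet> dual_vec (\<omega> q) 1" and ?s = "\<lambda>q. g q $ 4 \<bullet> dual_vec (\<omega> q) 1"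
      and ?t = "\<lambda>q. g q $ 4 \<bullet> dual_vec (\<omega> q) 2"
    let ?\<omega> = "\<lambda>q. change (?b q) 0 (?s q) (?t q) (\<omega> q)"
    have sm: "section_of A P V ?\<omega>"
      by (intro section_change[OF V(1) \<omega>] smooth_fun_const smooth_fun_inner_dual_vec V(1,3)
          smooth_form_subset[OF g(1)]) auto
    have "?\<omega> q \<in> G q" if q: "q \<in> V" for q
    proof -
      obtain w where w: "w \<in> P q" "g q $ 2 = w $ 2" "g q $ 4 = w $ 4" using g(2)[of q] by (auto simp: F_def)
      obtain b x s t where c: "w = change b x s t (\<omega> q)" using fiber_transitive[OF V(4)[OF q] w(1)] .
      have bst: "b = ?b q" "s = ?s q" "t = ?t q"
        using change_parameters[OF V(4)[OF q], of b x s t] w(2,3) c by simp_all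
      have eq: "?\<omega> q = change b 0 s t (\<omega> q)" by (simp only: bst)
      have "?\<omega> q $ 2 = g q $ 2" "?\<omega> q $ 4 = g q $ 4"
        unfolding eq unfolding w(2,3) c by simp_all
      then show ?thesis
        using section_ofD(2)[OF sm q] unfolding G_def by blast
    qed
    then show ?thesis using V(1,2) section_ofD(3)[OF sm] by (intro exI[of _ V] exI[of _ ?\<omega>] conjI ballI allI)
  qed
  ultimately obtain W where "\<And>i. smooth_form A UNIV (\<lambda>q. W q $ i)" "\<And>q. W q \<in> G q"
    using glue_convex[of G] by blast
  then have "section_of A P UNIV W" by (intro section_ofI) (simp_all add: G_def)
  then show thesis by (rule that)
qed

section \<open>Coefficients of the structure equations along a section\<close>

lemma normalized_eqs:
  assumes N: "normalized A \<Omega> D \<epsilon> V \<omega>" and q: "q \<in> V"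
  obtains a2 a3 a4 a q3 q4 c e where "eqs1 \<epsilon> (\<omega> q) (d_comp A \<omega> 1 q) a2 a3 a4"
    "eqs2 (\<omega> q) (d_comp A \<omega> 2 q) a q3 q4 c e"
proof -
  have inv: "invertible (\<omega> q)" and p: "p_coeffs A \<omega> q 0 \<epsilon>"
    and d2: "d_comp A \<omega> 2 q \<equiv>\<^sub>f \<omega> q $ 3 \<and>\<^sub>f \<omega> q $ 4 mod\<^sub>f {\<omega> q $ 1, \<omega> q $ 2}"
    using N q by (simp_all add: normalized_def adapted1_def adapted0_def coframing_def)
  obtain \<beta> where "d_comp A \<omega> 1 q - (0 *\<^sub>R \<omega> q $ 3 + \<epsilon> *\<^sub>R \<omega> q $ 4) \<and>\<^sub>f \<omega> q $ 2 = \<beta> \<and>\<^sub>f \<omega> q $ 1"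
    using ideal2_singleD[OF p[unfolded p_coeffs_def cong_mod_def]] .
  then have "d_comp A \<omega> 1 q = (0 *\<^sub>R \<omega> q $ 3 + \<epsilon> *\<^sub>R \<omega> q $ 4) \<and>\<^sub>f \<omega> q $ 2 + \<beta> \<and>\<^sub>f \<omega> q $ 1"
    by (simp add: algebra_simps)
  also have "\<dots> = \<epsilon> *\<^sub>R (\<omega> q $ 4 \<and>\<^sub>f \<omega> q $ 2) + \<beta> \<and>\<^sub>f \<omega> q $ 1"
    by (simp add: wedge_def vec_eq_iff algebra_simps)
  finally obtain a2 a3 a4 where 1: "eqs1 \<epsilon> (\<omega> q) (d_comp A \<omega> 1 q) a2 a3 a4"
    by (rule eqs1_exI[OF inv])
  obtain \<mu> \<nu> where "d_comp A \<omega> 2 q - \<omega> q $ 3 \<and>\<^sub>f \<omega> q $ 4 = \<mu> \<and>\<^sub>f \<omega> q $ 1 + \<nu> \<and>\<^sub>f \<omega> q $ 2"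
    using ideal2_pairD[OF d2[unfolded cong_mod_def]] .
  then have "d_comp A \<omega> 2 q = \<mu> \<and>\<^sub>f \<omega> q $ 1 + \<nu> \<and>\<^sub>f \<omega> q $ 2 + \<omega> q $ 3 \<and>\<^sub>f \<omega> q $ 4"
    by (simp add: algebra_simps)
  then obtain a q3 q4 c e where "eqs2 (\<omega> q) (d_comp A \<omega> 2 q) a q3 q4 c e"
    by (rule eqs2_exI[OF inv])
  with 1 show thesis by (rule that)
qed

text \<open>A section is only required to take values in the fibres, so nothing is known about its
  derivatives directly. Near \<open>q\<close> it is a change of a normalized coframing with smooth
  \<open>b\<close>, and the equations carry over.\<close>

lemma section_eqs:
  assumes U: "open U" and W: "section_of A P U W" and q: "q \<in> U"
  obtains a2 a3 a4 a q3 q4 c e where "eqs1 \<epsilon> (W q) (d_comp A W 1 q) a2 a3 a4"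
    "eqs2 (W q) (d_comp A W 2 q) a q3 q4 c e"
proof -
  obtain V \<omega> where V: "open V" "q \<in> V" "normalized A \<Omega> D \<epsilon> V \<omega>" "coframing A V \<omega>" "\<And>q. q \<in> V \<Longrightarrow> \<omega> q \<in> P q"
    by (rule local_normalized[of q]) blast
  have UV: "open (U \<inter> V)" "q \<in> U \<inter> V" using U V q by auto
  have W': "section_of A P (U \<inter> V) W" using section_of_subset[OF W] by simp
  have \<omega>: "section_of A P (U \<inter> V) \<omega>"
    using section_of_subset[of V \<omega> "U \<inter> V"] V by (simp add: section_of_def)
  obtain b x s t where b: "smooth_fun A (U \<inter> V) b"
    and c: "\<And>q. q \<in> U \<inter> V \<Longrightarrow> W q = change (b q) (x q) (s q) (t q) (\<omega> q)"
    using section_transition[OF UV(1) \<omega> W'] by blast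
  obtain a2 a3 a4 a q3 q4 c' e where e1: "eqs1 \<epsilon> (\<omega> q) (d_comp A \<omega> 1 q) a2 a3 a4"
    and e2: "eqs2 (\<omega> q) (d_comp A \<omega> 2 q) a q3 q4 c' e"
    using normalized_eqs[OF V(3,2)] .
  have Wq: "W q = change (b q) (x q) (s q) (t q) (\<omega> q)" by (rule c[OF UV(2)])
  obtain \<eta> where \<eta>: "ext_d A (\<lambda>q. \<omega> q $ 2 + b q *\<^sub>R \<omega> q $ 1) q =
      ext_d A (\<lambda>q. \<omega> q $ 2) q + b q *\<^sub>R ext_d A (\<lambda>q. \<omega> q $ 1) q + \<eta> \<and>\<^sub>f \<omega> q $ 1"
    using ext_d_add_scaleR[OF UV(1) section_ofD(3)[OF \<omega>] section_ofD(3)[OF \<omega>] b UV(2)] .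
  have d2: "d_comp A W 2 q = d_comp A \<omega> 2 q + b q *\<^sub>R d_comp A \<omega> 1 q + \<eta> \<and>\<^sub>f \<omega> q $ 1"
    unfolding d_comp_def \<eta>[symmetric] by (rule ext_d_cong_open[OF UV]) (simp add: c)
  obtain a' q3' q4' c'' e' where "eqs2 (W q) (d_comp A W 2 q) a' q3' q4' c'' e'"
    using eqs2_change_ex[OF section_ofD(4)[OF \<omega> UV(2)] e1 e2] unfolding Wq d2 by metis
  moreover have "eqs1 \<epsilon> (W q) (d_comp A W 1 q) (a2 + (\<epsilon> - a3) * s q - t q * a4) a3 (a4 - (\<epsilon> - a3) * b q)"
    unfolding Wq d_comp_1_eq[OF UV(1) \<omega> W' UV(2)] by (rule eqs1_change[OF e1])
  ultimately show thesis using that by blast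
qed

text \<open>Choosing coefficients point by point would say nothing about smoothness. They are
  therefore defined as values of \<open>d\<omega>1\<close> and \<open>d\<omega>2\<close> on the dual
  frame, and the pointwise expansions show that these are the right numbers.\<close>

lemma section_coeffs:
  assumes U: "open U" and W: "section_of A P U W"
  obtains a2 a3 a4 a q3 q4 c e where
    "\<And>q. q \<in> U \<Longrightarrow> eqs1 \<epsilon> (W q) (d_comp A W 1 q) (a2 q) (a3 q) (a4 q)"
    "\<And>q. q \<in> U \<Longrightarrow> eqs2 (W q) (d_comp A W 2 q) (a q) (q3 q) (q4 q) (c q) (e q)"
    "smooth_fun A U a2" "smooth_fun A U a3" "smooth_fun A U a4" "smooth_fun A U a"
    "smooth_fun A U q3" "smooth_fun A U q4" "smooth_fun A U c" "smooth_fun A U e"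
proof -
  define k where "k l i j q = eval2 (d_comp A W l q) (dual_vec (W q) i) (dual_vec (W q) j)" for l i j q
  have sm: "smooth_fun A U (k l i j)" for l i j
    using smooth_fun_ext_d[OF U section_ofD(1)[OF W] section_ofD(3)[OF W]] unfolding k_def d_comp_def .
  have "eqs1 \<epsilon> (W q) (d_comp A W 1 q) (k 1 2 1 q) (k 1 3 1 q) (k 1 4 1 q) \<and>
      eqs2 (W q) (d_comp A W 2 q) (k 2 1 2 q) (k 2 3 2 q) (k 2 4 2 q) (k 2 3 1 q) (k 2 4 1 q)" if q: "q \<in> U" for q
  proof -
    obtain a2 a3 a4 a q3 q4 c e where e: "eqs1 \<epsilon> (W q) (d_comp A W 1 q) a2 a3 a4"
      "eqs2 (W q) (d_comp A W 2 q) a q3 q4 c e"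
      using section_eqs[OF U W q] .
    note i = section_ofD(4)[OF W q]
    show ?thesis
      using e eqs1_coeffs[OF i e(1)] eqs2_coeffs[OF i e(2)] unfolding k_def by simp
  qed
  then show thesis using that sm by blast
qed

section \<open>Invariance of A3 and A4, and rigidity of the normal forms\<close>

lemma eqs1_unique:
  assumes "section_of A P U W" "q \<in> U" "eqs1 \<epsilon> (W q) F a2 a3 a4" "eqs1 \<epsilon> (W q) F a2' a3' a4'"
  shows "a2' = a2" "a3' = a3" "a4' = a4"
  using eqs1_coeffs[OF section_ofD(4)[OF assms(1,2)] assms(3)]
    eqs1_coeffs[OF section_ofD(4)[OF assms(1,2)] assms(4)] by simp_all

lemma eqs2_unique:
  assumes "section_of A P U W" "q \<in> U" "eqs2 (W q) G a q3 q4 c e" "eqs2 (W q) G a' q3' q4' c' e'"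
  shows "a' = a" "q3' = q3" "q4' = q4" "c' = c" "e' = e"
  using eqs2_coeffs[OF section_ofD(4)[OF assms(1,2)] assms(3)]
    eqs2_coeffs[OF section_ofD(4)[OF assms(1,2)] assms(4)] by simp_all

text \<open>Every change preserves A3 and alters A4 by a multiple of \<open>\<epsilon> - a3\<close>.
  This makes the definite descriptions in \<open>inv_A3\<close> and, for A3 =
  \<open>\<epsilon>\<close>, in \<open>inv_A4\<close> well defined.\<close>

lemma A_coeffs_invariant:
  assumes U: "open U" and W: "section_of A P U W" and q: "q \<in> U"
    and e: "eqs1 \<epsilon> (W q) (d_comp A W 1 q) a2 a3 a4"
    and V: "open V" "q \<in> V" "section_of A P V \<omega>" "A_coeffs A \<epsilon> \<omega> q a2' a3' a4'"
  shows "a3' = a3" "a3 = \<epsilon> \<Longrightarrow> a4' = a4"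
proof -
  have UV: "open (U \<inter> V)" "q \<in> U \<inter> V" using U V q by auto
  have W': "section_of A P (U \<inter> V) W" and \<omega>: "section_of A P (U \<inter> V) \<omega>"
    using section_of_subset W V by blast+
  obtain b x s t where c: "\<omega> q = change b x s t (W q)"
    using fiber_transitive section_ofD(2) W q V by metis
  have e': "eqs1 \<epsilon> (\<omega> q) (d_comp A \<omega> 1 q) a2' a3' a4'"
    using V(4) by (simp add: A_coeffs_def eqs1_def)
  have "eqs1 \<epsilon> (\<omega> q) (d_comp A \<omega> 1 q) (a2 + (\<epsilon> - a3) * s - t * a4) a3 (a4 - (\<epsilon> - a3) * b)"
    using eqs1_change[OF e] unfolding c d_comp_1_eq[OF UV(1) W' \<omega> UV(2)] .
  from eqs1_unique[OF \<omega> UV(2) this e'] show "a3' = a3" "a3 = \<epsilon> \<Longrightarrow> a4' = a4" by auto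
qed

lemma inv_A3_eq:
  assumes U: "open U" and W: "section_of A P U W" and q: "q \<in> U"
    and e: "eqs1 \<epsilon> (W q) (d_comp A W 1 q) a2 a3 a4"
  shows "inv_A3 A \<epsilon> P q = a3"
  unfolding inv_A3_def
proof (rule the_equality)
  have "A_coeffs A \<epsilon> W q a2 a3 a4" using e by (simp add: A_coeffs_def eqs1_def)
  then show "\<exists>V \<omega> a2 a4. open V \<and> q \<in> V \<and> section_of A P V \<omega> \<and> A_coeffs A \<epsilon> \<omega> q a2 a3 a4"
    using U W q by blast
next
  fix a3'
  assume "\<exists>V \<omega> a2 a4. open V \<and> q \<in> V \<and> section_of A P V \<omega> \<and> A_coeffs A \<epsilon> \<omega> q a2 a3' a4"
  then show "a3' = a3" by (elim exE conjE) (rule A_coeffs_invariant(1)[OF U W q e])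
qed

lemma inv_A4_eq:
  assumes U: "open U" and W: "section_of A P U W" and q: "q \<in> U"
    and e: "eqs1 \<epsilon> (W q) (d_comp A W 1 q) a2 \<epsilon> a4"
  shows "inv_A4 A \<epsilon> P q = a4"
  unfolding inv_A4_def
proof (rule the_equality)
  have "A_coeffs A \<epsilon> W q a2 \<epsilon> a4" using e by (simp add: A_coeffs_def eqs1_def)
  then show "\<exists>V \<omega> a2 a3. open V \<and> q \<in> V \<and> section_of A P V \<omega> \<and> A_coeffs A \<epsilon> \<omega> q a2 a3 a4"
    using U W q by blast
next
  fix a4'
  assume "\<exists>V \<omega> a2 a3. open V \<and> q \<in> V \<and> section_of A P V \<omega> \<and> A_coeffs A \<epsilon> \<omega> q a2 a3 a4'"
  then show "a4' = a4" by (elim exE conjE) (rule A_coeffs_invariant(2)[OF U W q e _ _ _ _ refl])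
qed

lemma d_comp_2_eq:
  assumes "open U" "q \<in> U" "\<And>q. q \<in> U \<Longrightarrow> W' q $ 2 = W q $ 2"
  shows "d_comp A W' 2 q = d_comp A W 2 q"
  unfolding d_comp_def by (rule ext_d_cong_open[OF assms])

text \<open>Comparing A4 forces \<open>b = 0\<close>, and comparing A2 then forces
  \<open>s = 0\<close>. The second rows agree, so \<open>d\<omega>2\<close> is the same for both
  sections, and comparing the coefficients \<open>q3\<close> and \<open>e\<close>, all zero, gives
  \<open>t = 0\<close> and \<open>x = 0\<close>.\<close>

lemma e_structure_unique:
  assumes U: "open U" and W: "section_of A P U W" "section_of A P U W'"
    and e1: "\<And>q. q \<in> U \<Longrightarrow> eqs1 \<epsilon> (W q) (d_comp A W 1 q) 0 (k q) 0"
      "\<And>q. q \<in> U \<Longrightarrow> eqs1 \<epsilon> (W' q) (d_comp A W' 1 q) 0 (k q) 0"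
    and k: "\<And>q. q \<in> U \<Longrightarrow> k q \<noteq> \<epsilon>"
    and e2: "\<And>q. q \<in> U \<Longrightarrow> eqs2 (W q) (d_comp A W 2 q) (a q) 0 (b q) (c q) 0"
      "\<And>q. q \<in> U \<Longrightarrow> eqs2 (W' q) (d_comp A W' 2 q) (a' q) 0 (b' q) (c' q) 0"
    and q: "q \<in> U"
  shows "W' q = W q"
proof -
  have "\<exists>x t. W' q = change 0 x 0 t (W q)" if q: "q \<in> U" for q
  proof -
    obtain b x s t where c: "W' q = change b x s t (W q)"
      using fiber_transitive section_ofD(2) W q by metis
    have "eqs1 \<epsilon> (W' q) (d_comp A W' 1 q) (0 + (\<epsilon> - k q) * s - t * 0) (k q) (0 - (\<epsilon> - k q) * b)"
      using eqs1_change[OF e1(1)[OF q]] unfolding c d_comp_1_eq[OF U W q] .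
    from eqs1_unique[OF W(2) q this e1(2)[OF q]] have "b = 0" "s = 0" using k[OF q] by auto
    then show ?thesis using c by blast
  qed
  note * = this
  \<comment> \<open>Agreement is needed on all of \<open>U\<close>, because
    \<open>d\<omega>2\<close> at a point depends on a neighbourhood.\<close>
  have "W' q $ 2 = W q $ 2" if "q \<in> U" for q using *[OF that] by auto
  then have d: "d_comp A W' 2 q = d_comp A W 2 q" by (rule d_comp_2_eq[OF U q])
  obtain x t where c: "W' q = change 0 x 0 t (W q)" using *[OF q] by blast
  have e: "eqs2 (W' q) (d_comp A W' 2 q) (a' q) 0 (b' q) (c' q) 0" by (rule e2(2)[OF q])
  from eqs2_unique(2,5)[OF W(2) q eqs2_change[OF e2(1)[OF q], of x 0 t, folded c d] e]
  have "x = 0" "t = 0" by simp_all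
  then show ?thesis using c by simp
qed

text \<open>The changes with \<open>b = 0\<close> are those used once \<open>b\<close> is settled.
  The new values of \<open>a\<close> and \<open>c\<close> do not matter for the normal forms, so
  only their existence as smooth functions is recorded.\<close>

lemma section_change_S:
  assumes U: "open U" and W: "section_of A P U W"
    and sm: "smooth_fun A U x" "smooth_fun A U s" "smooth_fun A U t"
    and e1: "\<And>q. q \<in> U \<Longrightarrow> eqs1 \<epsilon> (W q) (d_comp A W 1 q) (a2 q) (a3 q) (a4 q)"
    and e2: "\<And>q. q \<in> U \<Longrightarrow> eqs2 (W q) (d_comp A W 2 q) (a q) (q3 q) (q4 q) (c q) (e q)"
  obtains W' a' c' where "section_of A P U W'" "smooth_fun A U a'" "smooth_fun A U c'"
    "\<And>q. q \<in> U \<Longrightarrow> eqs1 \<epsilon> (W' q) (d_comp A W' 1 q) (a2 q + (\<epsilon> - a3 q) * s q - t q * a4 q) (a3 q) (a4 q)"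
    "\<And>q. q \<in> U \<Longrightarrow> eqs2 (W' q) (d_comp A W' 2 q) (a' q) (q3 q - t q) (q4 q + s q) (c' q) (e q + x q)"
proof -
  define W' where "W' q = change 0 (x q) (s q) (t q) (W q)" for q
  have W': "section_of A P U W'"
    unfolding W'_def by (intro section_change U W smooth_fun_const sm)
  have d: "d_comp A W' 1 q = d_comp A W 1 q" "d_comp A W' 2 q = d_comp A W 2 q" if "q \<in> U" for q
    using d_comp_1_eq[OF U W W' that] d_comp_2_eq[OF U that, of W' W] by (simp_all add: W'_def)
  have e1': "eqs1 \<epsilon> (W' q) (d_comp A W' 1 q) (a2 q + (\<epsilon> - a3 q) * s q - t q * a4 q) (a3 q) (a4 q)"
    if "q \<in> U" for q
    using eqs1_change[OF e1[OF that], of 0 "x q" "s q" "t q"] by (simp add: d[OF that] W'_def)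
  obtain a' q3' q4' c' e' where
    s: "\<And>q. q \<in> U \<Longrightarrow> eqs2 (W' q) (d_comp A W' 2 q) (a' q) (q3' q) (q4' q) (c' q) (e' q)"
    and sm': "smooth_fun A U a'" "smooth_fun A U c'"
    using section_coeffs[OF U W'] by metis
  have "eqs2 (W' q) (d_comp A W' 2 q) (a' q) (q3 q - t q) (q4 q + s q) (c' q) (e q + x q)" if q: "q \<in> U" for q
    using eqs2_unique(2,3,5)[OF W' q eqs2_change[OF e2[OF q], of "x q" "s q" "t q", folded W'_def d(2)[OF q]] s[OF q]]
      s[OF q] by simp
  then show thesis using that W' sm' e1' by blast
qed

end

section \<open>The normal forms\<close>

context normalized_structure
begin

section \<open>The case A3 different from \<open>\<epsilon>\<close>\<close>

lemma structure_eqs_1_iff: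
  "structure_eqs_1 A \<epsilon> k U W \<longleftrightarrow> (\<forall>q\<in>U. eqs1 \<epsilon> (W q) (d_comp A W 1 q) 0 (k q) 0) \<and>
     (\<exists>a b c. smooth_fun A U a \<and> smooth_fun A U b \<and> smooth_fun A U c \<and>
       (\<forall>q\<in>U. eqs2 (W q) (d_comp A W 2 q) (a q) 0 (b q) (c q) 0))"
proof -
  have scale: "(r *\<^sub>R \<alpha>) \<and>\<^sub>f \<beta> = r *\<^sub>R (\<alpha> \<and>\<^sub>f \<beta>)" for r \<alpha> \<beta>
    by (simp add: wedge_def vec_eq_iff algebra_simps)
  show ?thesis
    unfolding structure_eqs_1_def eqs1_def eqs2_def by (simp add: scale)
qed

lemma exists_e_structure:
  assumes U: "open U" and A3: "\<And>q. q \<in> U \<Longrightarrow> inv_A3 A \<epsilon> P q \<noteq> \<epsilon>"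
  obtains W where "section_of A P U W" "structure_eqs_1 A \<epsilon> (inv_A3 A \<epsilon> P) U W"
proof -
  obtain W where "section_of A P UNIV W" by (rule global_section)
  then have W: "section_of A P U W" by (rule section_of_subset) simp
  obtain a2 a3 a4 where e: "\<And>q. q \<in> U \<Longrightarrow> eqs1 \<epsilon> (W q) (d_comp A W 1 q) (a2 q) (a3 q) (a4 q)"
    and sm: "smooth_fun A U a3" "smooth_fun A U a4"
    by (rule section_coeffs[OF U W]) (rule that)
  have a3: "inv_A3 A \<epsilon> P q = a3 q" if "q \<in> U" for q
    by (rule inv_A3_eq[OF U W that e[OF that]])
  have ne: "\<epsilon> - a3 q \<noteq> 0" if "q \<in> U" for q using A3[OF that] a3[OF that] by simp
  \<comment> \<open>Solves \<open>a4 - (\<epsilon> - a3) b = 0\<close>.\<close>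
  define b where "b q = a4 q / (\<epsilon> - a3 q)" for q
  have b: "smooth_fun A U b"
    unfolding b_def by (intro smooth_fun_divide smooth_fun_diff smooth_fun_const U sm ne)
  define W' where "W' q = change (b q) 0 0 0 (W q)" for q
  have W': "section_of A P U W'"
    unfolding W'_def by (intro section_change U W b smooth_fun_const)
  obtain a2' a3' a4' a' q3' q4' c' e' where
    e1': "\<And>q. q \<in> U \<Longrightarrow> eqs1 \<epsilon> (W' q) (d_comp A W' 1 q) (a2' q) (a3' q) (a4' q)"
    and e2': "\<And>q. q \<in> U \<Longrightarrow> eqs2 (W' q) (d_comp A W' 2 q) (a' q) (q3' q) (q4' q) (c' q) (e' q)"
    and sm': "smooth_fun A U a2'" "smooth_fun A U q3'" "smooth_fun A U q4'" "smooth_fun A U e'"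
    by (rule section_coeffs[OF U W']) (rule that)
  have a34': "a3' q = a3 q" "a4' q = 0" if q: "q \<in> U" for q
  proof -
    have "eqs1 \<epsilon> (W' q) (d_comp A W' 1 q) (a2 q + (\<epsilon> - a3 q) * 0 - 0 * a4 q) (a3 q) (a4 q - (\<epsilon> - a3 q) * b q)"
      using eqs1_change[OF e[OF q]] unfolding W'_def[of q] d_comp_1_eq[OF U W W' q] .
    from eqs1_unique[OF W' q this e1'[OF q]] show "a3' q = a3 q" "a4' q = 0"
      using ne[OF q] by (simp_all add: b_def)
  qed
  \<comment> \<open>Solves \<open>a2' + (\<epsilon> - a3) s = 0\<close>; the contribution of
    \<open>t\<close> is absent because \<open>a4'\<close> vanishes.\<close>
  define s where "s q = (- a2' q) / (\<epsilon> - a3 q)" for q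
  have s: "smooth_fun A U s"
    unfolding s_def by (intro smooth_fun_divide smooth_fun_minus smooth_fun_diff smooth_fun_const U sm sm' ne)
  have x: "smooth_fun A U (\<lambda>q. - e' q)" by (rule smooth_fun_minus[OF U sm'(4)])
  \<comment> \<open>The change uses \<open>t = q3'\<close> and \<open>x = - e'\<close>, which clear
    the two remaining coefficients of \<open>d\<omega>2\<close>.\<close>
  obtain W'' a'' c'' where W'': "section_of A P U W''" "smooth_fun A U a''" "smooth_fun A U c''"
    and e1'': "\<And>q. q \<in> U \<Longrightarrow> eqs1 \<epsilon> (W'' q) (d_comp A W'' 1 q)
      (a2' q + (\<epsilon> - a3' q) * s q - q3' q * a4' q) (a3' q) (a4' q)"
    and e2'': "\<And>q. q \<in> U \<Longrightarrow> eqs2 (W'' q) (d_comp A W'' 2 q) (a'' q) (q3' q - q3' q) (q4' q + s q) (c'' q) (e' q + - e' q)"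
    by (rule section_change_S[OF U W' x s sm'(2) e1' e2']) (assumption | rule that)+
  have "eqs1 \<epsilon> (W'' q) (d_comp A W'' 1 q) 0 (inv_A3 A \<epsilon> P q) 0" if q: "q \<in> U" for q
    using e1''[OF q] ne[OF q] by (simp add: a34'[OF q] a3[OF q] s_def)
  moreover have "eqs2 (W'' q) (d_comp A W'' 2 q) (a'' q) 0 (q4' q + s q) (c'' q) 0" if q: "q \<in> U" for q
    using e2''[OF q] by simp
  ultimately have "structure_eqs_1 A \<epsilon> (inv_A3 A \<epsilon> P) U W''"
    unfolding structure_eqs_1_iff using W'' smooth_fun_add[OF U sm'(3) s] by blast
  then show thesis using that W''(1) by blast
qed

lemma structure_eqs_1_unique:
  assumes U: "open U" and A3: "\<And>q. q \<in> U \<Longrightarrow> inv_A3 A \<epsilon> P q \<noteq> \<epsilon>"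
    and W: "section_of A P U W" "structure_eqs_1 A \<epsilon> (inv_A3 A \<epsilon> P) U W"
    and W': "section_of A P U W'" "structure_eqs_1 A \<epsilon> (inv_A3 A \<epsilon> P) U W'"
    and q: "q \<in> U"
  shows "W' q = W q"
proof -
  obtain a b c where e: "\<forall>q\<in>U. eqs2 (W q) (d_comp A W 2 q) (a q) 0 (b q) (c q) 0"
    using W(2) unfolding structure_eqs_1_iff by blast
  obtain a' b' c' where e': "\<forall>q\<in>U. eqs2 (W' q) (d_comp A W' 2 q) (a' q) 0 (b' q) (c' q) 0"
    using W'(2) unfolding structure_eqs_1_iff by blast
  show ?thesis
    by (rule e_structure_unique[OF U W(1) W'(1), of "inv_A3 A \<epsilon> P" a b c a' b' c'])
      (use W(2) W'(2) A3 e e' q in \<open>auto simp: structure_eqs_1_iff\<close>)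
qed

lemma degenerate_section:
  assumes U: "open U" and A3: "\<And>q. q \<in> U \<Longrightarrow> inv_A3 A \<epsilon> P q = \<epsilon>"
  obtains W a2 a q3 q4 c e where "section_of A P U W" "smooth_fun A U a2" "smooth_fun A U (inv_A4 A \<epsilon> P)"
    "smooth_fun A U q3" "smooth_fun A U q4"
    "\<And>q. q \<in> U \<Longrightarrow> eqs1 \<epsilon> (W q) (d_comp A W 1 q) (a2 q) \<epsilon> (inv_A4 A \<epsilon> P q)"
    "\<And>q. q \<in> U \<Longrightarrow> eqs2 (W q) (d_comp A W 2 q) (a q) (q3 q) (q4 q) (c q) (e q)"
proof -
  obtain W where "section_of A P UNIV W" by (rule global_section)
  then have W: "section_of A P U W" by (rule section_of_subset) simp
  obtain a2 a3 a4 a q3 q4 c e where e1: "\<And>q. q \<in> U \<Longrightarrow> eqs1 \<epsilon> (W q) (d_comp A W 1 q) (a2 q) (a3 q) (a4 q)"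
    and e2: "\<And>q. q \<in> U \<Longrightarrow> eqs2 (W q) (d_comp A W 2 q) (a q) (q3 q) (q4 q) (c q) (e q)"
    and sm: "smooth_fun A U a2" "smooth_fun A U a4" "smooth_fun A U q3" "smooth_fun A U q4"
    by (rule section_coeffs[OF U W]) (rule that)
  have "a3 q = \<epsilon>" if "q \<in> U" for q
    using inv_A3_eq[OF U W that e1[OF that]] A3[OF that] by simp
  then have e: "eqs1 \<epsilon> (W q) (d_comp A W 1 q) (a2 q) \<epsilon> (a4 q)" if "q \<in> U" for q
    using e1[OF that] that by simp
  have a4: "inv_A4 A \<epsilon> P q = a4 q" if "q \<in> U" for q
    by (rule inv_A4_eq[OF U W that e[OF that]])
  \<comment> \<open>\<open>inv_A4\<close> is known to equal the smooth coefficient \<open>a4\<close>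
    on \<open>U\<close> only, so smoothness is transferred in each chart over
    \<open>U\<close>.\<close>
  have "smooth_fun A U (inv_A4 A \<epsilon> P)"
    unfolding smooth_fun_def
  proof
    fix k assume k: "k \<in> A"
    show "smooth_on (snd k ` (U \<inter> fst k)) (inv_A4 A \<epsilon> P \<circ> chart_inv k)"
      by (rule smooth_on_cong[OF open_chart_image_Int[OF k U], of "a4 \<circ> chart_inv k"])
        (use sm(2) k a4 in \<open>auto simp: smooth_fun_def\<close>)
  qed
  then show thesis
    by (rule that[OF W sm(1) _ sm(3,4)]) (use e a4 e2 in simp_all)
qed

text \<open>With A3 = \<open>\<epsilon>\<close> and A4 = 0 no change affects A2, which therefore
  stays in the equations; \<open>t\<close> is free to remove \<open>q3\<close>, and \<open>s\<close>
  removes \<open>q4\<close>.\<close>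

lemma exists_structure_2a:
  assumes U: "open U" and A3: "\<And>q. q \<in> U \<Longrightarrow> inv_A3 A \<epsilon> P q = \<epsilon>" and A4: "\<And>q. q \<in> U \<Longrightarrow> inv_A4 A \<epsilon> P q = 0"
  obtains W where "section_of A P U W" "structure_eqs_2a A \<epsilon> U W"
proof -
  obtain W a2 a q3 q4 c e where W: "section_of A P U W"
    and sm: "smooth_fun A U a2" "smooth_fun A U q3" "smooth_fun A U q4"
    and e1: "\<And>q. q \<in> U \<Longrightarrow> eqs1 \<epsilon> (W q) (d_comp A W 1 q) (a2 q) \<epsilon> (inv_A4 A \<epsilon> P q)"
    and e2: "\<And>q. q \<in> U \<Longrightarrow> eqs2 (W q) (d_comp A W 2 q) (a q) (q3 q) (q4 q) (c q) (e q)"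
    by (rule degenerate_section[OF U A3]) (assumption | rule that)+
  obtain W' a' c' where W': "section_of A P U W'"
    and e1': "\<And>q. q \<in> U \<Longrightarrow> eqs1 \<epsilon> (W' q) (d_comp A W' 1 q)
      (a2 q + (\<epsilon> - \<epsilon>) * (- q4 q) - q3 q * inv_A4 A \<epsilon> P q) \<epsilon> (inv_A4 A \<epsilon> P q)"
    and e2': "\<And>q. q \<in> U \<Longrightarrow> eqs2 (W' q) (d_comp A W' 2 q) (a' q) (q3 q - q3 q) (q4 q + - q4 q) (c' q) (e q + 0)"
    by (rule section_change_S[OF U W smooth_fun_const[OF U] smooth_fun_minus[OF U sm(3)] sm(2) e1 e2])
      (assumption | rule that)+
  have "d_comp A W' 1 q = \<epsilon> *\<^sub>R (W' q $ 4 \<and>\<^sub>f W' q $ 2) + \<epsilon> *\<^sub>R (W' q $ 3 \<and>\<^sub>f W' q $ 1)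
      + a2 q *\<^sub>R (W' q $ 2 \<and>\<^sub>f W' q $ 1)" if q: "q \<in> U" for q
    unfolding e1'[OF q, unfolded eqs1_def] A4[OF q]
    by (simp add: wedge_def vec_eq_iff algebra_simps)
  moreover have "d_comp A W' 2 q \<equiv>\<^sub>f W' q $ 3 \<and>\<^sub>f W' q $ 4 mod\<^sub>f {W' q $ 1}" if q: "q \<in> U" for q
  proof -
    \<comment> \<open>All surviving terms contain \<open>\<omega>1\<close>; the one with
      \<open>\<omega>1 \<and> \<omega>2\<close> is reversed, hence the minus sign.\<close>
    have "d_comp A W' 2 q - W' q $ 3 \<and>\<^sub>f W' q $ 4 =
        (c' q *\<^sub>R W' q $ 3 + e q *\<^sub>R W' q $ 4 - a' q *\<^sub>R W' q $ 2) \<and>\<^sub>f W' q $ 1"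
      unfolding e2'[OF q, unfolded eqs2_def] by (simp add: wedge_def vec_eq_iff algebra_simps)
    then show ?thesis unfolding cong_mod_def by (simp only: wedge_in_ideal2)
  qed
  ultimately have "structure_eqs_2a A \<epsilon> U W'"
    unfolding structure_eqs_2a_def using sm(1) by blast
  then show thesis using that W' by blast
qed

text \<open>Where A4 is nonzero, \<open>t\<close> moves both A2 and \<open>q3\<close>. It is spent
  on removing A2, and the altered \<open>q3\<close> remains as the function in the second
  equation.\<close>

lemma exists_structure_2b:
  assumes U: "open U" and A3: "\<And>q. q \<in> U \<Longrightarrow> inv_A3 A \<epsilon> P q = \<epsilon>" and A4: "\<And>q. q \<in> U \<Longrightarrow> inv_A4 A \<epsilon> P q \<noteq> 0"
  obtains W where "section_of A P U W" "structure_eqs_2b A \<epsilon> (inv_A4 A \<epsilon> P) U W"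
proof -
  let ?a4 = "inv_A4 A \<epsilon> P"
  obtain W a2 a q3 q4 c e where W: "section_of A P U W"
    and sm: "smooth_fun A U a2" "smooth_fun A U ?a4" "smooth_fun A U q3" "smooth_fun A U q4"
    and e1: "\<And>q. q \<in> U \<Longrightarrow> eqs1 \<epsilon> (W q) (d_comp A W 1 q) (a2 q) \<epsilon> (?a4 q)"
    and e2: "\<And>q. q \<in> U \<Longrightarrow> eqs2 (W q) (d_comp A W 2 q) (a q) (q3 q) (q4 q) (c q) (e q)"
    by (rule degenerate_section[OF U A3]) (assumption | rule that)+
  have t: "smooth_fun A U (\<lambda>q. a2 q / ?a4 q)"
    by (intro smooth_fun_divide U sm A4)
  obtain W' a' c' where W': "section_of A P U W'"
    and e1': "\<And>q. q \<in> U \<Longrightarrow> eqs1 \<epsilon> (W' q) (d_comp A W' 1 q)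
      (a2 q + (\<epsilon> - \<epsilon>) * (- q4 q) - a2 q / ?a4 q * ?a4 q) \<epsilon> (?a4 q)"
    and e2': "\<And>q. q \<in> U \<Longrightarrow> eqs2 (W' q) (d_comp A W' 2 q) (a' q) (q3 q - a2 q / ?a4 q) (q4 q + - q4 q) (c' q) (e q + 0)"
    by (rule section_change_S[OF U W smooth_fun_const[OF U] smooth_fun_minus[OF U sm(4)] t e1 e2])
      (assumption | rule that)+
  have "d_comp A W' 1 q = \<epsilon> *\<^sub>R (W' q $ 4 \<and>\<^sub>f W' q $ 2) + \<epsilon> *\<^sub>R (W' q $ 3 \<and>\<^sub>f W' q $ 1)
      + ?a4 q *\<^sub>R (W' q $ 4 \<and>\<^sub>f W' q $ 1)" if q: "q \<in> U" for q
  proof -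
    have "eqs1 \<epsilon> (W' q) (d_comp A W' 1 q) 0 \<epsilon> (?a4 q)" using e1'[OF q] A4[OF q] by simp
    then show ?thesis unfolding eqs1_def by (simp add: wedge_def vec_eq_iff algebra_simps)
  qed
  moreover have "d_comp A W' 2 q \<equiv>\<^sub>f (q3 q - a2 q / ?a4 q) *\<^sub>R (W' q $ 3 \<and>\<^sub>f W' q $ 2) + W' q $ 3 \<and>\<^sub>f W' q $ 4
      mod\<^sub>f {W' q $ 1}" if q: "q \<in> U" for q
  proof -
    have "d_comp A W' 2 q - ((q3 q - a2 q / ?a4 q) *\<^sub>R (W' q $ 3 \<and>\<^sub>f W' q $ 2) + W' q $ 3 \<and>\<^sub>f W' q $ 4) =
        (c' q *\<^sub>R W' q $ 3 + e q *\<^sub>R W' q $ 4 - a' q *\<^sub>R W' q $ 2) \<and>\<^sub>f W' q $ 1"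
      unfolding e2'[OF q, unfolded eqs2_def] by (simp add: wedge_def vec_eq_iff algebra_simps)
    then show ?thesis unfolding cong_mod_def by (simp only: wedge_in_ideal2)
  qed
  ultimately have "structure_eqs_2b A \<epsilon> ?a4 U W'"
    unfolding structure_eqs_2b_def using smooth_fun_diff[OF U sm(3) t] by blast
  then show thesis using that W' by blast
qed

end

theorem theorem2p4:
  fixes A :: "'a::{t2_space, second_countable_topology} chart set"
    and \<Omega> :: "'a \<Rightarrow> real^4^4"
    and D :: "'a \<Rightarrow> (real^4) set"
    and \<epsilon> :: real
    and P :: "'a \<Rightarrow> (real^4^4) set"
  assumes "smooth_atlas A"
    and "lagrangian_engel_structure A \<Omega> D"
    and "non_generic A \<Omega> D"
    and "sign_p4 A \<Omega> D \<epsilon>"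
    and "normalized_bundle A \<Omega> D \<epsilon> P"
  shows
    "(\<forall>U. open U \<and>
        ((\<forall>q\<in>U. inv_A3 A \<epsilon> P q = 0) \<or>
         (\<forall>q\<in>U. inv_A3 A \<epsilon> P q \<noteq> \<epsilon> \<and> inv_A3 A \<epsilon> P q \<noteq> 0)) \<longrightarrow>
        (\<exists>\<omega>. section_of A P U \<omega> \<and> structure_eqs_1 A \<epsilon> (inv_A3 A \<epsilon> P) U \<omega> \<and>
          (\<forall>\<omega>'. section_of A P U \<omega>' \<and> structure_eqs_1 A \<epsilon> (inv_A3 A \<epsilon> P) U \<omega>' \<longrightarrow>
            (\<forall>q\<in>U. \<omega>' q = \<omega> q)))) \<and>
     (\<forall>U. open U \<and> (\<forall>q\<in>U. inv_A3 A \<epsilon> P q = \<epsilon>) \<and> (\<forall>q\<in>U. inv_A4 A \<epsilon> P q = 0) \<longrightarrow>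
        (\<exists>\<omega>. section_of A P U \<omega> \<and> structure_eqs_2a A \<epsilon> U \<omega>)) \<and>
     (\<forall>U. open U \<and> (\<forall>q\<in>U. inv_A3 A \<epsilon> P q = \<epsilon>) \<and> (\<forall>q\<in>U. inv_A4 A \<epsilon> P q \<noteq> 0) \<longrightarrow>
        (\<exists>\<omega>. section_of A P U \<omega> \<and> structure_eqs_2b A \<epsilon> (inv_A4 A \<epsilon> P) U \<omega>))"
proof -
  interpret normalized_structure A \<Omega> D \<epsilon> P
    by unfold_locales (rule assms)+
  have \<epsilon>: "\<epsilon> \<noteq> 0" using assms(4) by (auto simp: sign_p4_def)
  show ?thesis
  proof (intro conjI allI impI; elim conjE)
    fix U assume U: "open U"
      and "(\<forall>q\<in>U. inv_A3 A \<epsilon> P q = 0) \<or> (\<forall>q\<in>U. inv_A3 A \<epsilon> P q \<noteq> \<epsilon> \<and> inv_A3 A \<epsilon> P q \<noteq> 0)"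
    \<comment> \<open>In the alternative A3 = 0 this amounts to \<open>\<epsilon>\<close> being
      nonzero.\<close>
    then have A3: "inv_A3 A \<epsilon> P q \<noteq> \<epsilon>" if "q \<in> U" for q using \<epsilon> that by force
    obtain W where W: "section_of A P U W" "structure_eqs_1 A \<epsilon> (inv_A3 A \<epsilon> P) U W"
      by (rule exists_e_structure[OF U A3])
    show "\<exists>\<omega>. section_of A P U \<omega> \<and> structure_eqs_1 A \<epsilon> (inv_A3 A \<epsilon> P) U \<omega> \<and>
          (\<forall>\<omega>'. section_of A P U \<omega>' \<and> structure_eqs_1 A \<epsilon> (inv_A3 A \<epsilon> P) U \<omega>' \<longrightarrow>
            (\<forall>q\<in>U. \<omega>' q = \<omega> q))"
      using W structure_eqs_1_unique[OF U A3 W] by blast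
  next
    fix U assume "open U" "\<forall>q\<in>U. inv_A3 A \<epsilon> P q = \<epsilon>" "\<forall>q\<in>U. inv_A4 A \<epsilon> P q = 0"
    then show "\<exists>\<omega>. section_of A P U \<omega> \<and> structure_eqs_2a A \<epsilon> U \<omega>"
      using exists_structure_2a[of U] by blast
  next
    fix U assume "open U" "\<forall>q\<in>U. inv_A3 A \<epsilon> P q = \<epsilon>" "\<forall>q\<in>U. inv_A4 A \<epsilon> P q \<noteq> 0"
    then show "\<exists>\<omega>. section_of A P U \<omega> \<and> structure_eqs_2b A \<epsilon> (inv_A4 A \<epsilon> P) U \<omega>"
      using exists_structure_2b[of U] by blast
  qed
qed

end
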